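(* There exists a randomized online algorithm for the $k$-taxi problem that is $\mathcal{O}(\log^5(k/\sigma))$-competitive on $\sigma$-smooth instances, provided a non-zero lower bound on $\sigma$ is known to the algorithm.
   Context: Metric setting: $M\subseteq\mathbb{R}^m$ is a set of bounded diameter, with metric $d(x,y)=\|x-y\|$ for an arbitrary norm $\|\cdot\|$ on $\mathbb{R}^m$. $B_M$ denotes a closed ball of smallest radius containing $M$, and $R_M$ its radius. $k$-taxi problem on $M$: the algorithm controls $k$ taxis located at points of $M$. Requests $r_t=(a_t,b_t)\in M^2$ arrive online; to serve $r_t$ the algorithm chooses a taxi and moves it first to $a_t$ and then to $b_t$. The cost is the total distance travelled excluding the trips from $a_t$ to $b_t$ (i.e. the total distance of empty runs). Smoothed instances: each request $r_t$ is drawn from a distribution $D_t$ on $M^2$ which the adversary may choose adaptively after the realizations of $r_1,\dots,r_{t-1}$ are known (but without knowledge of the algorithm's random choices); the adversary may also decide adaptively when the sequence stops, so the length $T$ may be random. For $\sigma\in(0,1]$, the instance is $\sigma$-smooth if for every $t$ and each of the two marginal distributions $D_{t1},D_{t2}$ of $D_t$ (the distributions of $a_t$ and $b_t$), every measurable $S\subseteq M$ has probability at most $\frac{1}{\sigma}\cdot\frac{\mathrm{vol}(S\cap B_M)}{\mathrm{vol}(B_M)}$. Competitive ratio: let $\mathrm{cost}(A,I)$ be the expected cost of algorithm $A$ on instance $I$, and $\mathrm{OPT}$ the offline optimum which knows the entire realized request sequence in advance. $A$ is $c$-competitive on $\sigma$-smooth instances if there is a constant $\alpha$ independent of the request sequence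 such that $\mathbb{E}[\mathrm{cost}(A,I)]\le c\cdot\mathbb{E}[\mathrm{cost}(\mathrm{OPT},I)]+\alpha$ for every $\sigma$-smooth instance $I$, expectations taken also over the randomness of $I$. *)

theory Defs
  imports "HOL-Probability.Probability"
begin

section \<open>The normed space of dimension \<open>m\<close>\<close>

text \<open>
  The constant hidden in the competitive ratio is independent of the dimension, so the dimension
  has to be a term. The space of dimension \<open>m\<close> is the set of extensional functions on
  \<open>{..<m}\<close>, which is the space of the product measure \<open>vol m\<close>.
\<close>

type_synonym point = "nat \<Rightarrow> real"

definition vol :: "nat \<Rightarrow> point measure" where
  "vol m = (\<Pi>\<^sub>M i\<in>{..<m}. lborel)"

abbreviation Rn :: "nat \<Rightarrow> point set" where
  "Rn m \<equiv> space (vol m)"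

definition is_norm :: "nat \<Rightarrow> (point \<Rightarrow> real) \<Rightarrow> bool" where
  "is_norm m N \<longleftrightarrow>
     (\<forall>x\<in>Rn m. 0 \<le> N x) \<and>
     (\<forall>x\<in>Rn m. N x = 0 \<longleftrightarrow> x = (\<lambda>i\<in>{..<m}. 0)) \<and>
     (\<forall>x\<in>Rn m. \<forall>a. N (\<lambda>i\<in>{..<m}. a * x i) = \<bar>a\<bar> * N x) \<and>
     (\<forall>x\<in>Rn m. \<forall>y\<in>Rn m. N (\<lambda>i\<in>{..<m}. x i + y i) \<le> N x + N y)"

definition ndist :: "nat \<Rightarrow> (point \<Rightarrow> real) \<Rightarrow> point \<Rightarrow> point \<Rightarrow> real" where
  "ndist m N x y = N (\<lambda>i\<in>{..<m}. x i - y i)"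

definition bounded_diameter :: "nat \<Rightarrow> (point \<Rightarrow> real) \<Rightarrow> point set \<Rightarrow> bool" where
  "bounded_diameter m N M \<longleftrightarrow> (\<exists>d. \<forall>x\<in>M. \<forall>y\<in>M. ndist m N x y \<le> d)"

definition closed_ball :: "nat \<Rightarrow> (point \<Rightarrow> real) \<Rightarrow> point \<Rightarrow> real \<Rightarrow> point set" where
  "closed_ball m N z R = {x \<in> Rn m. ndist m N z x \<le> R}"

definition smallest_enclosing_ball ::
    "nat \<Rightarrow> (point \<Rightarrow> real) \<Rightarrow> point set \<Rightarrow> point set \<Rightarrow> bool" where
  "smallest_enclosing_ball m N M B \<longleftrightarrow>
     (\<exists>z\<in>Rn m. \<exists>R\<ge>0. B = closed_ball m N z R \<and> M \<subseteq> B \<and>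
        (\<forall>z'\<in>Rn m. \<forall>R'\<ge>0. M \<subseteq> closed_ball m N z' R' \<longrightarrow> R \<le> R'))"


section \<open>The taxi problem\<close>

type_synonym request = "point \<times> point"

text \<open>
  Time starts at \<open>0\<close>: the requests are \<open>r 0, r 1, \<dots>\<close>, and \<open>c t\<close> is the taxi chosen to serve
  \<open>r t\<close>. Taxi \<open>j\<close> starts at \<open>x0 j\<close>, and \<open>taxi_pos x0 r c t j\<close> is its position just before
  \<open>r t\<close> is served.
\<close>

primrec taxi_pos ::
    "(nat \<Rightarrow> point) \<Rightarrow> (nat \<Rightarrow> request) \<Rightarrow> (nat \<Rightarrow> nat) \<Rightarrow> nat \<Rightarrow> nat \<Rightarrow> point" where
  "taxi_pos x0 r c 0 = x0"
| "taxi_pos x0 r c (Suc t) = (taxi_pos x0 r c t)(c t := snd (r t))"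

text \<open>Only the empty runs to the start points of the requests are paid for.\<close>

definition taxi_cost ::
    "nat \<Rightarrow> (point \<Rightarrow> real) \<Rightarrow> (nat \<Rightarrow> point) \<Rightarrow> nat \<Rightarrow> (nat \<Rightarrow> request) \<Rightarrow> (nat \<Rightarrow> nat) \<Rightarrow> real" where
  "taxi_cost m N x0 n r c = (\<Sum>t<n. ndist m N (taxi_pos x0 r c t (c t)) (fst (r t)))"

definition opt_cost ::
    "nat \<Rightarrow> (point \<Rightarrow> real) \<Rightarrow> nat \<Rightarrow> (nat \<Rightarrow> point) \<Rightarrow> nat \<Rightarrow> (nat \<Rightarrow> request) \<Rightarrow> real" where
  "opt_cost m N k x0 n r = (INF c\<in>{..<n} \<rightarrow> {..<k}. taxi_cost m N x0 n r c)"

text \<open>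
  \<open>M\<close> need not be measurable, so points of \<open>M\<close> and requests carry the trace sigma-algebras.
\<close>

definition point_space :: "nat \<Rightarrow> point set \<Rightarrow> point measure" where
  "point_space m M = restrict_space (vol m) M"

definition request_space :: "nat \<Rightarrow> point set \<Rightarrow> request measure" where
  "request_space m M = point_space m M \<Otimes>\<^sub>M point_space m M"

abbreviation history_space :: "nat \<Rightarrow> point set \<Rightarrow> nat set \<Rightarrow> (nat \<Rightarrow> request) measure" where
  "history_space m M J \<equiv> (\<Pi>\<^sub>M t\<in>J. request_space m M)"


section \<open>Randomized online algorithms\<close>

text \<open>
  A randomized online algorithm draws a seed and then acts deterministically:
  \<open>dispatch A u t h\<close> is the taxi serving request number \<open>t\<close> when the seed is \<open>u\<close> and
  \<open>h\<close> is the sequence of the requests \<open>0, \<dots>, t\<close>.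
\<close>

record online_alg =
  seed :: "real measure"
  dispatch :: "real \<Rightarrow> nat \<Rightarrow> (nat \<Rightarrow> request) \<Rightarrow> nat"

definition is_online_alg :: "nat \<Rightarrow> point set \<Rightarrow> nat \<Rightarrow> online_alg \<Rightarrow> bool" where
  "is_online_alg m M k A \<longleftrightarrow>
     prob_space (seed A) \<and>
     (\<forall>t. (\<lambda>(u, h). dispatch A u t h)
        \<in> measurable (seed A \<Otimes>\<^sub>M history_space m M {..t}) (count_space {..<k}))"

definition alg_cost ::
    "nat \<Rightarrow> (point \<Rightarrow> real) \<Rightarrow> (nat \<Rightarrow> point) \<Rightarrow> online_alg \<Rightarrow> nat \<Rightarrow> (nat \<Rightarrow> request) \<Rightarrow> ennreal" where
  "alg_cost m N x0 A n r =
     (\<integral>\<^sup>+u. ennreal (taxi_cost m N x0 n r (\<lambda>t. dispatch A u t (restrict r {..t}))) \<partial>seed A)"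


section \<open>Smoothed instances\<close>

text \<open>
  Outer measure extends the volume to traces of Borel sets on a non-measurable \<open>M\<close>; it agrees
  with \<open>vol m\<close> on measurable sets.
\<close>

definition smooth_marginal ::
    "nat \<Rightarrow> point set \<Rightarrow> point set \<Rightarrow> real \<Rightarrow> point measure \<Rightarrow> bool" where
  "smooth_marginal m M B \<sigma> \<mu> \<longleftrightarrow>
     (\<forall>S\<in>sets (point_space m M).
        emeasure \<mu> S \<le> ennreal (1 / \<sigma>) * (outer_measure_of (vol m) (S \<inter> B) / emeasure (vol m) B))"

definition smooth_dist ::
    "nat \<Rightarrow> point set \<Rightarrow> point set \<Rightarrow> real \<Rightarrow> request measure \<Rightarrow> bool" where
  "smooth_dist m M B \<sigma> \<mu> \<longleftrightarrow>
     smooth_marginal m M B \<sigma> (distr \<mu> (point_space m M) fst) \<and>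
     smooth_marginal m M B \<sigma> (distr \<mu> (point_space m M) snd)"

text \<open>
  An instance is an adaptive adversary. For a sequence \<open>h\<close> of the requests \<open>0, \<dots>, t - 1\<close>,
  \<open>next_dist I t h\<close> is the distribution of request number \<open>t\<close>, and \<open>stop I t h\<close> tells whether
  the sequence ends after these \<open>t\<close> requests.
\<close>

record instance_adv =
  next_dist :: "nat \<Rightarrow> (nat \<Rightarrow> request) \<Rightarrow> request measure"
  stop :: "nat \<Rightarrow> (nat \<Rightarrow> request) \<Rightarrow> bool"

text \<open>
  The law of the infinite request sequence generated by the kernels \<open>next_dist I\<close>. Formally
  requests keep being drawn after the adversary has stopped; they do not contribute to any cost.
\<close>

definition request_law :: "nat \<Rightarrow> point set \<Rightarrow> instance_adv \<Rightarrow> (nat \<Rightarrow> request) measure" where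
  "request_law m M I =
     projective_family.lim UNIV (Ionescu_Tulcea.CI (next_dist I) (\<lambda>_. request_space m M))
       (\<lambda>_. request_space m M)"

definition stopped :: "instance_adv \<Rightarrow> nat \<Rightarrow> (nat \<Rightarrow> request) \<Rightarrow> bool" where
  "stopped I t r \<longleftrightarrow> (\<exists>s\<le>t. stop I s (restrict r {..<s}))"

definition num_requests :: "instance_adv \<Rightarrow> (nat \<Rightarrow> request) \<Rightarrow> nat" where
  "num_requests I r = (LEAST t. stopped I t r)"

text \<open>
  The predicate \<open>Ionescu_Tulcea\<close> says that each \<open>next_dist I t\<close> is a measurable probability
  kernel from request sequences of length \<open>t\<close> to requests.
\<close>

definition is_instance :: "nat \<Rightarrow> point set \<Rightarrow> instance_adv \<Rightarrow> bool" where
  "is_instance m M I \<longleftrightarrow>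
     Ionescu_Tulcea (next_dist I) (\<lambda>_. request_space m M) \<and>
     (\<forall>t. Measurable.pred (history_space m M {..<t}) (stop I t)) \<and>
     (AE r in request_law m M I. \<exists>t. stopped I t r)"

definition smooth_instance ::
    "nat \<Rightarrow> point set \<Rightarrow> point set \<Rightarrow> real \<Rightarrow> instance_adv \<Rightarrow> bool" where
  "smooth_instance m M B \<sigma> I \<longleftrightarrow>
     is_instance m M I \<and>
     (\<forall>t. \<forall>h\<in>space (history_space m M {..<t}).
        \<not> stopped I t h \<longrightarrow> smooth_dist m M B \<sigma> (next_dist I t h))"


section \<open>Competitiveness\<close>

definition expected_alg_cost ::
    "nat \<Rightarrow> (point \<Rightarrow> real) \<Rightarrow> point set \<Rightarrow> (nat \<Rightarrow> point) \<Rightarrow> online_alg \<Rightarrow> instance_adv \<Rightarrow> ennreal" where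
  "expected_alg_cost m N M x0 A I =
     (\<integral>\<^sup>+r. alg_cost m N x0 A (num_requests I r) r \<partial>request_law m M I)"

definition expected_opt_cost ::
    "nat \<Rightarrow> (point \<Rightarrow> real) \<Rightarrow> point set \<Rightarrow> nat \<Rightarrow> (nat \<Rightarrow> point) \<Rightarrow> instance_adv \<Rightarrow> ennreal" where
  "expected_opt_cost m N M k x0 I =
     (\<integral>\<^sup>+r. ennreal (opt_cost m N k x0 (num_requests I r) r) \<partial>request_law m M I)"

definition competitive_on_smooth ::
    "nat \<Rightarrow> (point \<Rightarrow> real) \<Rightarrow> point set \<Rightarrow> point set \<Rightarrow> nat \<Rightarrow> (nat \<Rightarrow> point) \<Rightarrow>
     real \<Rightarrow> real \<Rightarrow> online_alg \<Rightarrow> bool" where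
  "competitive_on_smooth m N M B k x0 \<sigma> c A \<longleftrightarrow>
     (\<exists>\<alpha>\<ge>0. \<forall>I. smooth_instance m M B \<sigma> I \<longrightarrow>
        expected_alg_cost m N M x0 A I \<le> ennreal c * expected_opt_cost m N M k x0 I + ennreal \<alpha>)"

end

theory Submission
  imports Defs
begin

text \<open>
  No competitive algorithm for finite metrics is used as a black box. The metric is replaced by a random sum of cut
  metrics: at each scale \<open>R / 2 ^ j\<close> the set \<open>M\<close> is partitioned into random cells around the centers
  of a net, and \<open>d\<^sub>T x y\<close> is the sum of the scales at which \<open>x\<close> and \<open>y\<close> are separated. The algorithm adds to
  each cell a fixed random terminal cost and always keeps its taxis where an optimal offline solution of the past
  requests, with respect to \<open>d\<^sub>T\<close> and this perturbation, would leave them. Offline solutions are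
  matchings, so an exchange along an alternating path shows that one taxi can be moved per request to maintain this.

  Seen as a function of the terminal cost of a cell that contains the requested point, the increase of the perturbed optimum
  has slope \<open>1\<close> whenever the taxi comes from outside the cell and slope \<open>0\<close> otherwise. Hence the hazard rate of the noise
  bounds the expected cost at that scale by a multiple of the expected increase, plus an error
  per request. A relocation changes the perturbation by an amount of mean zero, so the increases sum up to the
  optimum; this is why relocations cost nothing.

  Smoothness pays for the errors: a source of a taxi is used at most once, so in a window of \<open>4 * k\<close>
  requests at most \<open>k\<close> of them are served from sources older than the window, while the other ones are unlikely to
  start near a recent end point. The optimum is therefore at least of order \<open>R * (\<sigma> / (16 * k)) powr (1 / m)\<close> per
  request. The distribution of the noise does not depend on \<open>\<sigma>\<close>; only the number of scales and the
  resolution of the noise depend on the lower bound for \<open>\<sigma>\<close>.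
\<close>

section \<open>Discrete noise with slowly growing hazard rate\<close>

text \<open>The exponent 5 is 2 + 3/2 + 3/2. Both randomizations, of the cells and of the terminal
  costs, pay once per level, which gives \<open>(J + 1)\<^sup>2\<close>. Both also pay a hazard rate
  \<open>2 * Z ^ 3\<close> at a threshold whose square is logarithmic in the tolerated error. The
  obstacle is a constant that depends neither on \<open>m\<close> nor on
  \<open>\<sigma>\<^sub>0\<close>. A net of scale \<open>R / 2 ^ j\<close> may have
  \<open>2 ^ ((j + 2) * m)\<close> centers, so the threshold for the cells satisfies
  \<open>Y\<^sup>2 = m * (J + 4)\<close>. This is affordable because \<open>J\<close> is only of
  order \<open>ln (k / \<sigma>) / m\<close>: a bound of order \<open>m\<^sup>2 * J ^ 5\<close> is
  still of order \<open>ln (k / \<sigma>) ^ 5\<close>. If \<open>m\<close> exceeds the logarithm,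
  then the radius in the lower bound is within a constant factor of \<open>R\<close>, and paying the
  diameter for each request is competitive. The algorithm runs with \<open>L\<close> levels,
  determined by \<open>\<sigma>\<^sub>0\<close>, whereas the analysis stops at the level
  \<open>J \<le> L\<close> that belongs to the true \<open>\<sigma>\<close> and picks its thresholds
  accordingly. Hence one noise distribution has to serve all thresholds; truncated exponential noise
  would fix its rate in advance.\<close>

abbreviation expect :: "'a pmf \<Rightarrow> ('a \<Rightarrow> real) \<Rightarrow> real" where
  "expect p \<equiv> measure_pmf.expectation p"

abbreviation prob :: "'a pmf \<Rightarrow> 'a set \<Rightarrow> real" where
  "prob p \<equiv> measure_pmf.prob p"

definition tail :: "nat \<Rightarrow> nat \<Rightarrow> real" where
  "tail K i = (if i < K then exp (1 - 1 / (1 - real i / real K)\<^sup>2) else 0)"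

text \<open>Beyond the threshold the density \<open>2 * z ^ 3 * exp (1 - z\<^sup>2)\<close> of the
  noise decreases. By \<open>x \<le> exp (x - 1)\<close> for \<open>x = z / Z\<close> this reduces
  to \<open>3 * (z / Z - 1) \<le> z\<^sup>2 - Z\<^sup>2\<close>.\<close>

lemma cube_exp_decreasing:
  fixes z Z :: real
  assumes "2 \<le> Z" "Z \<le> z"
  shows "z ^ 3 * exp (1 - z\<^sup>2) \<le> Z ^ 3 * exp (1 - Z\<^sup>2)"
proof -
  have "z / Z \<le> exp (z / Z - 1)"
    using exp_ge_add_one_self[of "z / Z - 1"] by simp
  then have "(z / Z) ^ 3 \<le> exp (z / Z - 1) ^ 3"
    using assms by (intro power_mono) auto
  also have "\<dots> = exp (3 * (z / Z - 1))"
    by (simp add: exp_of_nat_mult[symmetric])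
  also have "\<dots> \<le> exp (z\<^sup>2 - Z\<^sup>2)"
  proof -
    have "3 * (z / Z - 1) = 3 * (z - Z) / Z"
      using assms by (simp add: field_simps)
    also have "\<dots> \<le> 3 * (z - Z) / 1"
      using assms by (intro divide_left_mono) auto
    also have "\<dots> \<le> (z + Z) * (z - Z)"
      unfolding div_by_1 using assms by (intro mult_right_mono) auto
    also have "\<dots> = z\<^sup>2 - Z\<^sup>2"
      by (simp add: power2_eq_square algebra_simps)
    finally show ?thesis by simp
  qed
  finally have "z ^ 3 \<le> Z ^ 3 * exp (z\<^sup>2 - Z\<^sup>2)"
    using assms by (simp add: power_divide field_simps)
  then have "z ^ 3 * exp (1 - z\<^sup>2) \<le> Z ^ 3 * exp (z\<^sup>2 - Z\<^sup>2) * exp (1 - z\<^sup>2)"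
    by (intro mult_right_mono) auto
  also have "\<dots> = Z ^ 3 * exp (1 - Z\<^sup>2)"
    by (simp add: mult_exp_exp mult.assoc)
  finally show ?thesis .
qed

lemma tail_0: "0 < K \<Longrightarrow> tail K 0 = 1"
  by (simp add: tail_def)

lemma tail_nonneg: "0 \<le> tail K i"
  by (simp add: tail_def)

lemma tail_ge_K: "K \<le> i \<Longrightarrow> tail K i = 0"
  by (simp add: tail_def)

lemma tail_antimono: assumes "i \<le> i'" shows "tail K i' \<le> tail K i"
proof (cases "i' < K")
  case True
  then have "0 < 1 - real i' / real K" "1 - real i' / real K \<le> 1 - real i / real K"
    using assms by (auto simp: field_simps)
  then have "(1 - real i' / real K)\<^sup>2 \<le> (1 - real i / real K)\<^sup>2" "0 < (1 - real i' / real K)\<^sup>2"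
    by (auto intro!: power_mono)
  then show ?thesis
    using True assms by (auto simp: tail_def intro!: divide_left_mono mult_pos_pos)
qed (simp add: tail_def)

lemma tail_le_1: "0 < K \<Longrightarrow> tail K i \<le> 1"
  using tail_antimono[of 0 i K] by (simp add: tail_0)

definition rate :: "real \<Rightarrow> real" where
  "rate Z = 2 * Z ^ 3"

text \<open>The density of the noise at \<open>z = Z\<close>. Where the hazard rate exceeds
  \<open>rate Z\<close>, the density itself is below this value.\<close>

definition slack :: "real \<Rightarrow> real" where
  "slack Z = 2 * Z ^ 3 * exp (1 - Z\<^sup>2)"

text \<open>
  As a function of \<open>x = i / K\<close>, the tail \<open>exp (1 - z\<^sup>2)\<close> with \<open>z = 1 / (1 - x)\<close> has hazard rate
  \<open>2 * z ^ 3\<close>. It grows with \<open>z\<close> only as a power of \<open>ln (1 / tail)\<close> and yet the support is bounded,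
  so the bound below holds for all thresholds \<open>Z\<close> at once.
\<close>

lemma tail_step:
  assumes "2 \<le> Z" "i < K"
  shows "tail K i - tail K (Suc i) \<le> (rate Z * tail K i + slack Z) / real K"
proof (cases "Suc i < K")
  case True
  define g :: "real \<Rightarrow> real" where "g = (\<lambda>x. exp (1 - 1 / (1 - x)\<^sup>2))"
  define a b where "a = real i / real K" and "b = real (Suc i) / real K"
  have ab: "a < b" "b < 1" "b - a = 1 / real K"
    using True by (auto simp: a_def b_def field_simps)
  have "\<exists>x. a < x \<and> x < b \<and> g b - g a = (b - a) * (- 2 / (1 - x) ^ 3 * g x)"
  proof (rule MVT2[OF ab(1)])
    fix x assume "a \<le> x" "x \<le> b"
    then have "x < 1" using ab by simp
    then have "1 - x \<noteq> 0" by simp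
    then have "((\<lambda>u. exp (1 - 1 / u\<^sup>2)) has_real_derivative 2 / (1 - x) ^ 3 * g x) (at (1 - x))"
      unfolding g_def
      by (auto intro!: derivative_eq_intros) (simp add: divide_simps eval_nat_numeral, simp add: algebra_simps)
    moreover have "((\<lambda>x. 1 - x) has_real_derivative - 1) (at x)"
      by (auto intro!: derivative_eq_intros)
    ultimately show "(g has_real_derivative - 2 / (1 - x) ^ 3 * g x) (at x)"
      using DERIV_chain2[of "\<lambda>u. exp (1 - 1 / u\<^sup>2)" _ "\<lambda>x. 1 - x" x "- 1"] unfolding g_def
      by fastforce
  qed
  then obtain x where x: "a < x" "x < b" "g b - g a = (b - a) * (- 2 / (1 - x) ^ 3 * g x)"
    by blast
  define z where "z = 1 / (1 - x)"
  have "0 \<le> a" by (simp add: a_def)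
  then have z1: "1 \<le> z" using x ab by (simp add: z_def field_simps)
  have gx: "g x = exp (1 - z\<^sup>2)" by (simp add: g_def z_def power_divide)
  have T: "tail K i = g a" "tail K (Suc i) = g b"
    using True by (simp_all add: tail_def g_def a_def b_def)
  have xx: "(1 - x)\<^sup>2 \<le> (1 - a)\<^sup>2" "0 < (1 - x)\<^sup>2" "0 < (1 - a)\<^sup>2"
    using x ab by (auto intro!: power_mono)
  then have le: "g x \<le> g a"
    unfolding g_def by (auto intro!: divide_left_mono mult_pos_pos)
  have eq: "tail K i - tail K (Suc i) = 2 * z ^ 3 * exp (1 - z\<^sup>2) / real K"
    using x(3) ab(3) by (simp add: T gx z_def power_divide) (simp add: field_simps)
  show ?thesis
  proof (cases "z \<le> Z")
    case True
    have "2 * z ^ 3 * exp (1 - z\<^sup>2) \<le> 2 * Z ^ 3 * tail K i"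
      using True z1 le unfolding gx[symmetric] T
      by (intro mult_mono power_mono) (auto simp: g_def)
    also have "\<dots> \<le> rate Z * tail K i + slack Z"
      using assms by (simp add: rate_def slack_def)
    finally show ?thesis
      unfolding eq by (intro divide_right_mono) auto
  next
    case False
    then have "2 * z ^ 3 * exp (1 - z\<^sup>2) \<le> slack Z"
      using cube_exp_decreasing[OF assms(1), of z] by (simp add: slack_def)
    also have "\<dots> \<le> rate Z * tail K i + slack Z"
      using assms by (simp add: rate_def tail_nonneg)
    finally show ?thesis
      unfolding eq by (intro divide_right_mono) auto
  qed
next
  case False
  \<comment> \<open>The mean value theorem does not reach the last step: \<open>g 1 = exp 1\<close>,
    as division by 0 gives 0, whereas the tail drops to 0. The last atom corresponds to
    \<open>z = K\<close>. If \<open>K\<close> exceeds \<open>rate Z\<close>, it lies beyond the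
    threshold and the density bound applies.\<close>
  then have i: "Suc i = K" using assms by simp
  have t: "tail K i = exp (1 - (real K)\<^sup>2)"
  proof -
    have "1 - real i / real K = 1 / real K"
      using i by (auto simp: field_simps)
    then show ?thesis using assms by (simp add: tail_def power_divide)
  qed
  have "real K * tail K i \<le> rate Z * tail K i + slack Z"
  proof (cases "real K \<le> rate Z")
    case True
    then have "real K * tail K i \<le> rate Z * tail K i"
      by (simp add: mult_right_mono tail_nonneg)
    then show ?thesis using assms by (simp add: slack_def add_increasing2)
  next
    case False
    have "Z * 1 \<le> Z * (2 * Z\<^sup>2)"
      using assms by (intro mult_left_mono) (auto intro!: order_trans[OF _ mult_left_mono[OF one_le_power]])
    then have "Z \<le> rate Z"
      by (simp add: rate_def power2_eq_square power3_eq_cube algebra_simps)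
    then have "Z \<le> real K" using False by simp
    then have "real K ^ 3 * exp (1 - (real K)\<^sup>2) \<le> Z ^ 3 * exp (1 - Z\<^sup>2)"
      using assms by (intro cube_exp_decreasing) auto
    moreover have "real K ^ 1 * exp (1 - (real K)\<^sup>2) \<le> real K ^ 3 * exp (1 - (real K)\<^sup>2)"
      using assms by (intro mult_right_mono power_increasing) auto
    moreover have "0 \<le> Z ^ 3 * exp (1 - Z\<^sup>2)" using assms by simp
    moreover have "0 \<le> rate Z * tail K i" using assms by (simp add: rate_def tail_nonneg)
    ultimately show ?thesis unfolding t slack_def power_one_right by linarith
  qed
  then show ?thesis
    using i assms by (simp add: tail_ge_K field_simps)
qed

lemma rate_nonneg: "0 \<le> Z \<Longrightarrow> 0 \<le> rate Z"
  and slack_nonneg: "0 \<le> Z \<Longrightarrow> 0 \<le> slack Z"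
  by (simp_all add: rate_def slack_def)

section \<open>The law of a single noise variable\<close>

definition step_pmf :: "nat \<Rightarrow> nat pmf" where
  "step_pmf K = embed_pmf (\<lambda>i. tail K i - tail K (Suc i))"

lemma sum_tail: "(\<Sum>i\<in>{a..<b}. tail K i - tail K (Suc i)) = tail K a - tail K b" if "a \<le> b"
  using that sum_Suc_diff'[of a b "\<lambda>i. - tail K i"] by simp

lemma pmf_step_pmf:
  assumes "0 < K"
  shows "pmf (step_pmf K) i = tail K i - tail K (Suc i)"
  unfolding step_pmf_def
proof (rule pmf_embed_pmf)
  show "0 \<le> tail K x - tail K (Suc x)" for x
    using tail_antimono[of x "Suc x" K] by simp
  have "(\<integral>\<^sup>+x. ennreal (tail K x - tail K (Suc x)) \<partial>count_space UNIV)
      = (\<integral>\<^sup>+x. ennreal (tail K x - tail K (Suc x)) \<partial>count_space {..<K})"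
    by (rule nn_integral_count_space_eq) (auto simp: tail_ge_K)
  also have "\<dots> = (\<Sum>x<K. ennreal (tail K x - tail K (Suc x)))"
    by (rule nn_integral_count_space_finite) simp
  also have "\<dots> = ennreal (\<Sum>x<K. tail K x - tail K (Suc x))"
    by (rule sum_ennreal) (simp add: tail_antimono)
  also have "(\<Sum>x<K. tail K x - tail K (Suc x)) = 1"
    using sum_tail[of 0 K K] assms by (simp add: tail_0 tail_ge_K atLeast0LessThan)
  finally show "(\<integral>\<^sup>+x. ennreal (tail K x - tail K (Suc x)) \<partial>count_space UNIV) = 1"
    by simp
qed

lemma set_step_pmf: "0 < K \<Longrightarrow> set_pmf (step_pmf K) \<subseteq> {..<K}"
  by (auto simp: set_pmf_eq pmf_step_pmf) (metis le_SucI not_less tail_ge_K)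

lemma prob_step_pmf_interval:
  assumes "0 < K" "a \<le> b"
  shows "prob (step_pmf K) {a..<b} = tail K a - tail K b"
  using assms by (simp add: measure_measure_pmf_finite pmf_step_pmf sum_tail)

lemma prob_step_pmf_atLeast:
  assumes "0 < K"
  shows "prob (step_pmf K) {a..} = tail K a"
proof -
  have "prob (step_pmf K) {a..} = prob (step_pmf K) {a..<max a K}"
    using set_step_pmf[OF assms] by (intro measure_pmf.finite_measure_eq_AE) (auto simp: AE_measure_pmf_iff)
  then show ?thesis using assms by (simp add: prob_step_pmf_interval tail_ge_K)
qed

text \<open>Up to the slack, a bound for the chance that the noise stops within \<open>b - a\<close>
  steps once it has reached \<open>a\<close>: a substitute for the memorylessness of exponential
  noise.\<close>

lemma prob_step_pmf_interval_le:
  assumes K: "0 < K" and Z: "2 \<le> Z" and ab: "a \<le> b"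
  shows "prob (step_pmf K) {a..<b}
       \<le> real (b - a) * ((rate Z * prob (step_pmf K) {a..} + slack Z) / real K)"
proof -
  let ?c = "(rate Z * tail K a + slack Z) / real K"
  have c0: "0 \<le> ?c"
    using Z by (intro divide_nonneg_nonneg add_nonneg_nonneg mult_nonneg_nonneg)
      (auto simp: tail_nonneg rate_nonneg slack_nonneg)
  have "tail K i - tail K (Suc i) \<le> ?c" if "a \<le> i" for i
  proof (cases "i < K")
    case True
    have "tail K i - tail K (Suc i) \<le> (rate Z * tail K i + slack Z) / real K"
      by (rule tail_step[OF Z True])
    also have "\<dots> \<le> ?c"
      using Z that by (intro divide_right_mono add_right_mono mult_left_mono tail_antimono)
        (auto simp: rate_nonneg)
    finally show ?thesis .
  qed (use c0 in \<open>simp add: tail_ge_K\<close>)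
  then have "(\<Sum>i\<in>{a..<b}. tail K i - tail K (Suc i)) \<le> (\<Sum>i\<in>{a..<b}. ?c)"
    by (intro sum_mono) auto
  then show ?thesis
    using ab K by (simp add: prob_step_pmf_interval sum_tail prob_step_pmf_atLeast)
qed

lemma expectation_step_pmf:
  fixes X :: "nat \<Rightarrow> real"
  assumes "0 < K"
  shows "expect (step_pmf K) X = (\<Sum>i<K. (tail K i - tail K (Suc i)) * X i)"
  using integral_measure_pmf_real[of "{..<K}" "step_pmf K" X] set_step_pmf[OF assms]
  by (auto simp: pmf_step_pmf[OF assms] mult.commute)

lemma sum_tail_by_parts:
  fixes X :: "nat \<Rightarrow> real"
  assumes "0 < K"
  shows "(\<Sum>i<K. (tail K i - tail K (Suc i)) * X i) = X 0 + (\<Sum>i<K. tail K (Suc i) * (X (Suc i) - X i))"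
proof -
  have "(\<Sum>i<n. (tail K i - tail K (Suc i)) * X i)
      = tail K 0 * X 0 - tail K n * X n + (\<Sum>i<n. tail K (Suc i) * (X (Suc i) - X i))" for n
    by (induction n) (auto simp: algebra_simps)
  from this[of K] show ?thesis using assms by (simp add: tail_0 tail_ge_K)
qed

text \<open>
  Here \<open>i\<close> is the value of one noise variable, \<open>D i\<close> the increase of the perturbed optimum, \<open>e i\<close>
  tells whether the chosen taxi comes from outside the cell of that variable and \<open>U i\<close> is the number of taxis
  inside. Concavity of the perturbed optima gives \<open>step\<close>; a sum by parts then turns the hazard rate
  of the noise into a bound for the probability of \<open>e\<close>.
\<close>

lemma noise_bound:
  fixes D e U :: "nat \<Rightarrow> real"
  assumes K: "0 < K" and Z: "2 \<le> Z" and \<tau>: "0 \<le> \<tau>"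
    and D0: "\<And>i. i < K \<Longrightarrow> 0 \<le> D i"
    and e: "\<And>i. i < K \<Longrightarrow> 0 \<le> e i \<and> e i \<le> 1"
    and step: "\<And>i. Suc i < K \<Longrightarrow> D (Suc i) - D i \<ge> \<tau> * (e (Suc i) - (U i - U (Suc i)))"
    and U: "\<And>i. Suc i < K \<Longrightarrow> U (Suc i) \<le> U i"
    and U0: "\<And>i. i < K \<Longrightarrow> 0 \<le> U i \<and> U i \<le> k"
  shows "real K * \<tau> * expect (step_pmf K) e
       \<le> rate Z * (expect (step_pmf K) D + \<tau> * (k + 1)) + real K * \<tau> * slack Z"
proof -
  have r0: "0 \<le> rate Z" "0 \<le> slack Z"
    using Z by (auto simp: rate_nonneg slack_nonneg)
  define S where "S = (\<Sum>i<K-1. tail K (Suc i) * e (Suc i))"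
  have Ke: "(\<Sum>i<K. tail K i * e i) = e 0 + S"
    using K unfolding S_def by (cases K) (simp_all add: sum.lessThan_Suc_shift tail_0 del: sum.lessThan_Suc)
  \<comment> \<open>\<open>U\<close> decreases between \<open>k\<close> and 0 and tails are at most
    1, so all the losses in \<open>step\<close> together cost \<open>k\<close>, however fine the
    resolution is.\<close>
  have Usum: "(\<Sum>i<n. tail K (Suc i) * (U i - U (Suc i))) \<le> k" if "n \<le> K - 1" for n
  proof -
    have "(\<Sum>i<n. tail K (Suc i) * (U i - U (Suc i))) \<le> (\<Sum>i<n. 1 * (U i - U (Suc i)))"
      using that U K by (intro sum_mono mult_right_mono tail_le_1) auto
    also have "\<dots> = U 0 - U n"
      using sum_lessThan_telescope'[of U n] by simp
    also have "\<dots> \<le> k" using U0[of 0] U0[of n] that K by fastforce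
    finally show ?thesis .
  qed
  have "\<tau> * (S - k) \<le> \<tau> * (\<Sum>i<K-1. tail K (Suc i) * (e (Suc i) - (U i - U (Suc i))))"
    using Usum[of "K-1"] \<tau> unfolding S_def
    by (intro mult_left_mono) (simp_all add: right_diff_distrib sum_subtractf)
  also have "\<dots> = (\<Sum>i<K-1. tail K (Suc i) * (\<tau> * (e (Suc i) - (U i - U (Suc i)))))"
    by (simp add: sum_distrib_left mult_ac)
  also have "\<dots> \<le> (\<Sum>i<K-1. tail K (Suc i) * (D (Suc i) - D i))"
    using step by (intro sum_mono mult_left_mono) (auto simp: tail_nonneg)
  also have "\<dots> = (\<Sum>i<K. tail K (Suc i) * (D (Suc i) - D i))"
    using K by (cases K) (simp_all add: tail_ge_K)
  \<comment> \<open>Summation by parts; the boundary term \<open>D 0\<close> is nonnegative and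
    dropped.\<close>
  also have "\<dots> \<le> expect (step_pmf K) D"
    using D0[of 0] K by (simp add: expectation_step_pmf sum_tail_by_parts)
  finally have S: "\<tau> * S \<le> expect (step_pmf K) D + \<tau> * k"
    by (simp add: algebra_simps)
  have "real K * expect (step_pmf K) e
      = (\<Sum>i<K. real K * (tail K i - tail K (Suc i)) * e i)"
    using K by (simp add: expectation_step_pmf sum_distrib_left mult_ac)
  also have "\<dots> \<le> (\<Sum>i<K. (rate Z * tail K i + slack Z) * e i)"
  proof (intro sum_mono mult_right_mono)
    fix i assume i: "i \<in> {..<K}"
    then show "real K * (tail K i - tail K (Suc i)) \<le> rate Z * tail K i + slack Z"
      using tail_step[OF Z, of i K] K by (simp add: field_simps)
  qed (use e in auto)
  also have "\<dots> = rate Z * (\<Sum>i<K. tail K i * e i) + slack Z * (\<Sum>i<K. e i)"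
    by (simp add: distrib_right sum.distrib sum_distrib_left mult.assoc)
  also have "\<dots> = rate Z * (e 0 + S) + slack Z * (\<Sum>i<K. e i)"
    by (simp only: Ke)
  \<comment> \<open>\<open>step\<close> gives no information on \<open>e 0\<close>. Bounding it by 1
    is what turns \<open>k\<close> into \<open>k + 1\<close>.\<close>
  also have "\<dots> \<le> rate Z * (1 + S) + slack Z * real K"
  proof -
    have "(\<Sum>i<K. e i) \<le> (\<Sum>i<K. 1)" using e by (intro sum_mono) auto
    then show ?thesis using e[of 0] K r0 by (intro add_mono mult_left_mono) auto
  qed
  finally have "\<tau> * (real K * expect (step_pmf K) e)
      \<le> \<tau> * (rate Z * (1 + S) + slack Z * real K)"
    using \<tau> by (intro mult_left_mono)
  also have "\<dots> = rate Z * (\<tau> * S + \<tau>) + real K * \<tau> * slack Z"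
    by (simp add: algebra_simps)
  also have "\<dots> \<le> rate Z * (expect (step_pmf K) D + \<tau> * k + \<tau>) + real K * \<tau> * slack Z"
    using S r0 by (intro add_right_mono mult_left_mono) auto
  finally show ?thesis by (simp add: algebra_simps)
qed

section \<open>Offline schedules as matchings\<close>

text \<open>
  Taxis are identified with the place where they come from: source \<open>s < k\<close> is the initial position
  of taxi \<open>s\<close> and source \<open>k + i\<close> is the end point of request \<open>i\<close>. Offline service of \<open>t\<close> requests is then
  a matching of requests to earlier sources, and the unmatched sources are the final positions of the
  taxis. The position of source \<open>s\<close> is \<open>q s\<close>, the start point of request \<open>i\<close> is \<open>A i\<close>, and \<open>h\<close> is a
  terminal cost for every taxi.
\<close>

definition sched :: "nat \<Rightarrow> nat \<Rightarrow> (nat \<Rightarrow> nat) set" where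
  "sched k t = {m \<in> PiE {..<t} (\<lambda>i. {..<k + i}). inj_on m {..<t}}"

definition unused :: "nat \<Rightarrow> nat \<Rightarrow> (nat \<Rightarrow> nat) \<Rightarrow> nat set" where
  "unused k t m = {..<k + t} - m ` {..<t}"

definition val ::
    "nat \<Rightarrow> ('l \<Rightarrow> 'l \<Rightarrow> real) \<Rightarrow> ('l \<Rightarrow> real) \<Rightarrow> (nat \<Rightarrow> 'l) \<Rightarrow> (nat \<Rightarrow> 'l) \<Rightarrow> nat \<Rightarrow> (nat \<Rightarrow> nat) \<Rightarrow> real" where
  "val k D h q A t m = (\<Sum>i<t. D (q (m i)) (A i)) + (\<Sum>s\<in>unused k t m. h (q s))"

definition opt ::
    "nat \<Rightarrow> ('l \<Rightarrow> 'l \<Rightarrow> real) \<Rightarrow> ('l \<Rightarrow> real) \<Rightarrow> (nat \<Rightarrow> 'l) \<Rightarrow> (nat \<Rightarrow> 'l) \<Rightarrow> nat \<Rightarrow> real" where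
  "opt k D h q A t = Min (val k D h q A t ` sched k t)"

definition is_opt_set ::
    "nat \<Rightarrow> ('l \<Rightarrow> 'l \<Rightarrow> real) \<Rightarrow> ('l \<Rightarrow> real) \<Rightarrow> (nat \<Rightarrow> 'l) \<Rightarrow> (nat \<Rightarrow> 'l) \<Rightarrow> nat \<Rightarrow> nat set \<Rightarrow> bool" where
  "is_opt_set k D h q A t U \<longleftrightarrow> (\<exists>m\<in>sched k t. val k D h q A t m = opt k D h q A t \<and> unused k t m = U)"

primrec src :: "nat \<Rightarrow> (nat \<Rightarrow> nat) \<Rightarrow> nat \<Rightarrow> nat \<Rightarrow> nat" where
  "src k c 0 = (\<lambda>j. j)"
| "src k c (Suc t) = (src k c t)(c t := k + t)"

lemma finite_sched: "finite (sched k t)"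
proof -
  have "finite (PiE {..<t} (\<lambda>i. {..<k + i}))" by (intro finite_PiE) auto
  then show ?thesis unfolding sched_def by (rule rev_finite_subset) auto
qed

lemma src_bounds:
  assumes "c \<in> {..<t} \<rightarrow> {..<k}"
  shows "inj_on (src k c t) {..<k} \<and> src k c t ` {..<k} \<subseteq> {..<k + t}"
  using assms
proof (induction t)
  case (Suc t)
  have "c \<in> {..<t} \<rightarrow> {..<k}" using Suc.prems by auto
  from Suc.IH[OF this] have IH: "inj_on (src k c t) {..<k}" "src k c t ` {..<k} \<subseteq> {..<k + t}"
    by auto
  have "inj_on ((src k c t)(c t := k + t)) {..<k}"
    using IH by (intro inj_on_fun_updI) auto
  moreover have "(src k c t)(c t := k + t) ` {..<k} \<subseteq> {..<k + Suc t}"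
    using IH(2) by (force simp: fun_upd_def)
  ultimately show ?case by (simp only: src.simps)
qed auto

lemma src_less:
  assumes "c \<in> {..<n} \<rightarrow> {..<k}" "t < n" shows "src k c t (c t) < k + t"
proof -
  have "c \<in> {..<t} \<rightarrow> {..<k}" "c t < k" using assms by auto
  then show ?thesis using src_bounds[of c t k] by auto
qed

definition sched_of :: "nat \<Rightarrow> (nat \<Rightarrow> nat) \<Rightarrow> nat \<Rightarrow> nat \<Rightarrow> nat" where
  "sched_of k c t = (\<lambda>i\<in>{..<t}. src k c i (c i))"

text \<open>A run of the taxis is a matching because a taxi leaves its source for good and then
  occupies the fresh source \<open>k + t\<close>.\<close>

lemma sched_of:
  assumes "c \<in> {..<t} \<rightarrow> {..<k}"
  shows "sched_of k c t \<in> sched k t \<and> unused k t (sched_of k c t) = src k c t ` {..<k}"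
  using assms
proof (induction t)
  case 0
  then show ?case by (simp add: sched_def sched_of_def unused_def)
next
  case (Suc t)
  have ct: "c t < k" and c: "c \<in> {..<t} \<rightarrow> {..<k}" using Suc.prems by auto
  have IH: "sched_of k c t \<in> sched k t" "unused k t (sched_of k c t) = src k c t ` {..<k}"
    using Suc.IH[OF c] by auto
  have b: "inj_on (src k c t) {..<k}" "src k c t ` {..<k} \<subseteq> {..<k + t}"
    using src_bounds[OF c] by auto
  let ?p = "src k c t (c t)"
  have eq: "sched_of k c (Suc t) i = sched_of k c t i" if "i < t" for i
    using that by (simp add: sched_of_def)
  have eqt: "sched_of k c (Suc t) t = ?p" by (simp add: sched_of_def)
  have im: "sched_of k c (Suc t) ` {..<t} = sched_of k c t ` {..<t}"
    by (rule image_cong) (auto simp: eq)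
  have im': "sched_of k c (Suc t) ` {..<Suc t} = insert ?p (sched_of k c t ` {..<t})"
    by (simp only: lessThan_Suc image_insert im eqt)
  have p: "?p \<in> unused k t (sched_of k c t)" using ct IH(2) by auto
  have inj: "inj_on (sched_of k c t) {..<t}" using IH(1) by (simp add: sched_def)
  have inj': "inj_on (sched_of k c (Suc t)) {..<Suc t}"
  proof -
    have "inj_on (sched_of k c (Suc t)) {..<t}"
      using inj by (subst inj_on_cong[where g = "sched_of k c t"]) (auto simp: eq)
    then show ?thesis
      using p unfolding lessThan_Suc inj_on_insert eqt by (auto simp: unused_def im)
  qed
  have "sched_of k c (Suc t) \<in> PiE {..<Suc t} (\<lambda>i. {..<k + i})"
  proof
    fix i assume i: "i \<in> {..<Suc t}"
    then show "sched_of k c (Suc t) i \<in> {..<k + i}" using src_less[OF Suc.prems] by (simp add: sched_of_def)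
  qed (simp add: sched_of_def)
  then have "sched_of k c (Suc t) \<in> sched k (Suc t)" using inj' by (simp add: sched_def)
  moreover have "unused k (Suc t) (sched_of k c (Suc t)) = insert (k + t) (src k c t ` {..<k} - {?p})"
  proof -
    have "sched_of k c t ` {..<t} \<subseteq> {..<k + t}"
      using IH(1) by (force simp: sched_def PiE_iff)
    then show ?thesis
      using p b(2) unfolding unused_def im' IH(2)[symmetric] by auto
  qed
  moreover have "insert (k + t) (src k c t ` {..<k} - {?p}) = src k c (Suc t) ` {..<k}"
    using ct b(1) by (auto simp: inj_on_def)
  ultimately show ?case by simp
qed

lemma sched_nonempty: assumes "0 < k" shows "sched k t \<noteq> {}"
  using sched_of[of "\<lambda>_. 0" t k] assms by auto

lemma opt_le: "m \<in> sched k t \<Longrightarrow> opt k D h q A t \<le> val k D h q A t m"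
  unfolding opt_def by (intro Min_le) (auto simp: finite_sched)

lemma opt_attained:
  assumes "0 < k"
  obtains m where "m \<in> sched k t" "val k D h q A t m = opt k D h q A t"
proof -
  have "opt k D h q A t \<in> val k D h q A t ` sched k t"
    unfolding opt_def using assms by (intro Min_in) (auto simp: finite_sched sched_nonempty)
  then show ?thesis using that by auto
qed

text \<open>All sources are charged their terminal cost, which is refunded to a request that uses
  one. The remaining sum is over requests, so recombining two matchings request by request preserves
  the total of their values.\<close>

lemma val_eq:
  assumes "m \<in> sched k t"
  shows "val k D h q A t m = (\<Sum>s<k + t. h (q s)) + (\<Sum>i<t. D (q (m i)) (A i) - h (q (m i)))"
proof -
  have sub: "m ` {..<t} \<subseteq> {..<k + t}" and inj: "inj_on m {..<t}"
    using assms by (force simp: sched_def PiE_iff)+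
  have "(\<Sum>s\<in>unused k t m. h (q s)) = (\<Sum>s<k + t. h (q s)) - (\<Sum>s\<in>m ` {..<t}. h (q s))"
    unfolding unused_def using sub by (intro sum_diff) auto
  also have "(\<Sum>s\<in>m ` {..<t}. h (q s)) = (\<Sum>i<t. h (q (m i)))"
    using inj by (simp add: sum.reindex)
  finally show ?thesis by (simp add: val_def sum_subtractf)
qed

lemma card_unused:
  assumes "m \<in> sched k t" shows "card (unused k t m) = k"
proof -
  have "m ` {..<t} \<subseteq> {..<k + t}" "inj_on m {..<t}"
    using assms by (force simp: sched_def PiE_iff)+
  then show ?thesis unfolding unused_def by (simp add: card_Diff_subset card_image)
qed

text \<open>The elements are requests. If \<open>m'\<close> gives to \<open>i\<close> the source
  that \<open>i'\<close> has in \<open>m\<close>, then \<open>i'\<close> is displaced and joins the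
  path; \<open>t\<close> is the new request, which has no source in \<open>m\<close>.\<close>

inductive_set altpath :: "nat \<Rightarrow> (nat \<Rightarrow> nat) \<Rightarrow> (nat \<Rightarrow> nat) \<Rightarrow> nat set" for t m m' where
  start: "t \<in> altpath t m m'"
| step: "i \<in> altpath t m m' \<Longrightarrow> i' < t \<Longrightarrow> m' i = m i' \<Longrightarrow> i' \<in> altpath t m m'"

text \<open>
  Swapping the two matchings along the alternating path that starts at the new request keeps both of
  them matchings and preserves the sum of their costs.
\<close>

lemma exchange:
  assumes k: "0 < k" and m: "m \<in> sched k t" and opt: "val k D h q A t m = opt k D h q A t"
  shows "\<exists>p\<in>unused k t m. is_opt_set k D h q A (Suc t) (insert (k + t) (unused k t m - {p}))"
proof -
  obtain m' where m': "m' \<in> sched k (Suc t)" and opt': "val k D h q A (Suc t) m' = opt k D h q A (Suc t)"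
    by (rule opt_attained[OF k])
  let ?P = "altpath t m m'"
  define m1 where "m1 = (\<lambda>i\<in>{..<Suc t}. if i \<in> ?P then m' i else m i)"
  define m2 where "m2 = (\<lambda>i\<in>{..<t}. if i \<in> ?P then m i else m' i)"
  have minj: "inj_on m {..<t}" and mb: "\<And>i. i < t \<Longrightarrow> m i < k + i"
    and m'inj: "inj_on m' {..<Suc t}" and m'b: "\<And>i. i < Suc t \<Longrightarrow> m' i < k + i"
    using m m' by (auto simp: sched_def PiE_iff)
  \<comment> \<open>A request on the path was displaced by another one on the path. So
    \<open>m'\<close> on the path reuses every source that \<open>m\<close> uses there, and
    switching to \<open>m'\<close> along the path frees no source.\<close>
  have pred: "\<exists>r\<in>?P. r < Suc t \<and> m' r = m i" if "i \<in> ?P" "i < t" for i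
  proof -
    have le: "r < Suc t" if "r \<in> ?P" for r
      using that by cases auto
    from \<open>i \<in> ?P\<close> \<open>i < t\<close> show ?thesis
      by cases (use le in auto)
  qed
  have t_in: "t \<in> ?P" by (rule altpath.start)
  have m1: "m1 \<in> sched k (Suc t)"
  proof -
    have "inj_on m1 {..<Suc t}"
    proof (rule inj_onI)
      fix i j assume ij: "i \<in> {..<Suc t}" "j \<in> {..<Suc t}" "m1 i = m1 j"
      show "i = j"
      proof (cases "i \<in> ?P \<longleftrightarrow> j \<in> ?P")
        case True
        moreover have "i < t" if "i \<notin> ?P" using that ij t_in by (cases "i = t") auto
        moreover have "j < t" if "j \<notin> ?P" using that ij t_in by (cases "j = t") auto
        ultimately show ?thesis using ij minj m'inj by (auto simp: m1_def inj_on_def split: if_splits)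
      next
        case False
        moreover have "i < t" if "i \<notin> ?P" using that ij t_in by (cases "i = t") auto
        moreover have "j < t" if "j \<notin> ?P" using that ij t_in by (cases "j = t") auto
        ultimately show ?thesis
          using ij altpath.step[of i t m m' j] altpath.step[of j t m m' i]
          by (auto simp: m1_def split: if_splits)
      qed
    qed
    moreover have "m1 \<in> PiE {..<Suc t} (\<lambda>i. {..<k + i})"
    proof
      fix i assume i: "i \<in> {..<Suc t}"
      moreover have "i < t" if "i \<notin> ?P" using that i t_in by (cases "i = t") auto
      ultimately show "m1 i \<in> {..<k + i}" using mb[of i] m'b[of i] by (auto simp: m1_def)
    qed (simp add: m1_def)
    ultimately show ?thesis by (simp add: sched_def)
  qed
  have m2: "m2 \<in> sched k t"
  proof -
    have "inj_on m2 {..<t}"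
    proof (rule inj_onI)
      fix i j assume ij: "i \<in> {..<t}" "j \<in> {..<t}" "m2 i = m2 j"
      have F: False if "i \<in> ?P" "j \<notin> ?P" "m i = m' j" "i < t" "j < t" for i j
      proof -
        obtain r where r: "r \<in> ?P" "r < Suc t" "m' r = m i" using pred \<open>i \<in> ?P\<close> \<open>i < t\<close> by blast
        then have "r = j" using that m'inj by (auto simp: inj_on_def)
        with r that show False by simp
      qed
      show "i = j"
        using ij minj m'inj F[of i j] F[of j i] by (auto simp: m2_def inj_on_def split: if_splits)
    qed
    moreover have "m2 \<in> PiE {..<t} (\<lambda>i. {..<k + i})"
      using mb m'b by (auto simp: m2_def PiE_iff)
    ultimately show ?thesis by (simp add: sched_def)
  qed
  have sum: "val k D h q A (Suc t) m1 + val k D h q A t m2 = val k D h q A t m + val k D h q A (Suc t) m'"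
  proof -
    let ?f = "\<lambda>m i. D (q (m i)) (A i) - h (q (m i))"
    have "(\<Sum>i<t. ?f m1 i) + (\<Sum>i<t. ?f m2 i) = (\<Sum>i<t. ?f m i) + (\<Sum>i<t. ?f m' i)"
      unfolding sum.distrib[symmetric] by (rule sum.cong) (auto simp: m1_def m2_def)
    moreover have "m1 t = m' t" using t_in by (simp add: m1_def)
    ultimately show ?thesis by (simp add: val_eq[OF m] val_eq[OF m1] val_eq[OF m2] val_eq[OF m'])
  qed
  \<comment> \<open>Neither \<open>m1\<close> nor \<open>m2\<close> can beat an optimum, and the
    totals agree, so both are optimal.\<close>
  have val1: "val k D h q A (Suc t) m1 = opt k D h q A (Suc t)"
    using sum opt opt' opt_le[OF m1, of D h q A] opt_le[OF m2, of D h q A] by linarith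
  \<comment> \<open>The optimal \<open>m1\<close> keeps all the used sources and has one request
    more; the single new source \<open>p\<close> tells which taxi moves.\<close>
  have sub: "m ` {..<t} \<subseteq> m1 ` {..<Suc t}"
  proof
    fix s assume "s \<in> m ` {..<t}"
    then obtain i where i: "i < t" "s = m i" by auto
    show "s \<in> m1 ` {..<Suc t}"
    proof (cases "i \<in> ?P")
      case True
      then obtain r where "r \<in> ?P" "r < Suc t" "m' r = m i" using pred i by blast
      then show ?thesis using i by (intro image_eqI[of _ _ r]) (auto simp: m1_def)
    next
      case False
      then show ?thesis using i by (intro image_eqI[of _ _ i]) (auto simp: m1_def)
    qed
  qed
  have m1sub: "m1 ` {..<Suc t} \<subseteq> {..<k + t}"
  proof
    fix s assume "s \<in> m1 ` {..<Suc t}"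
    then obtain i where "i < Suc t" "s = m1 i" by auto
    then show "s \<in> {..<k + t}" using m1 by (force simp: sched_def PiE_iff)
  qed
  have "card (m1 ` {..<Suc t} - m ` {..<t}) = 1"
    using sub m1 m by (subst card_Diff_subset) (auto simp: card_image sched_def)
  then obtain p where p: "m1 ` {..<Suc t} - m ` {..<t} = {p}"
    by (auto simp: card_1_singleton_iff)
  then have im: "m1 ` {..<Suc t} = insert p (m ` {..<t})" and pn: "p \<notin> m ` {..<t}" using sub by auto
  have pin: "p \<in> unused k t m" using im pn m1sub by (auto simp: unused_def)
  have "unused k (Suc t) m1 = insert (k + t) (unused k t m - {p})"
  proof -
    have "k + t \<notin> m1 ` {..<Suc t}" using m1sub by auto
    then show ?thesis unfolding unused_def im by (auto simp: less_Suc_eq)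
  qed
  then show ?thesis
    using pin m1 val1 unfolding is_opt_set_def by blast
qed

lemma opt_mono_step:
  assumes k: "0 < k" and lip: "\<And>x y. h x \<le> h y + D x y"
  shows "opt k D h q A t \<le> opt k D h q A (Suc t) + h (A t) - h (q (k + t))"
proof -
  obtain m' where m': "m' \<in> sched k (Suc t)" and opt': "val k D h q A (Suc t) m' = opt k D h q A (Suc t)"
    by (rule opt_attained[OF k])
  define m where "m = restrict m' {..<t}"
  have m: "m \<in> sched k t"
    using m' by (auto simp: sched_def PiE_iff m_def inj_on_def)
  have eq: "(\<Sum>i<t. D (q (m i)) (A i) - h (q (m i))) = (\<Sum>i<t. D (q (m' i)) (A i) - h (q (m' i)))"
    by (rule sum.cong) (auto simp: m_def)
  have "opt k D h q A t \<le> val k D h q A t m" by (rule opt_le[OF m])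
  also have "\<dots> = opt k D h q A (Suc t) - h (q (k + t)) - (D (q (m' t)) (A t) - h (q (m' t)))"
    by (simp add: opt'[symmetric] val_eq[OF m] val_eq[OF m'] eq)
  also have "\<dots> \<le> opt k D h q A (Suc t) + h (A t) - h (q (k + t))"
    using lip[of "q (m' t)" "A t"] by simp
  finally show ?thesis .
qed

text \<open>The optimum is a minimum of functions that are affine in the terminal cost of
  \<open>X\<close>, hence concave. The number of taxis of an optimal schedule in \<open>X\<close> is
  a supergradient, so \<open>\<tau>\<close> may have either sign.\<close>

lemma opt_perturb:
  assumes U: "is_opt_set k D h q A t U" and h': "\<And>x. h' x = h x + \<tau> * of_bool (x \<in> X)"
  shows "opt k D h' q A t \<le> opt k D h q A t + \<tau> * card {s\<in>U. q s \<in> X}"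
proof -
  obtain m where m: "m \<in> sched k t" "val k D h q A t m = opt k D h q A t" "unused k t m = U"
    using U by (auto simp: is_opt_set_def)
  have fin: "finite U" using m(3) by (auto simp: unused_def)
  have "opt k D h' q A t \<le> val k D h' q A t m" by (rule opt_le[OF m(1)])
  also have "\<dots> = val k D h q A t m + (\<Sum>s\<in>U. \<tau> * of_bool (q s \<in> X))"
    by (simp add: val_def m(3) h' sum.distrib)
  also have "(\<Sum>s\<in>U. \<tau> * of_bool (q s \<in> X)) = \<tau> * card {s\<in>U. q s \<in> X}"
    using fin by (simp add: sum_distrib_left[symmetric] of_bool_def sum.If_cases Int_def)
  finally show ?thesis using m(2) by simp
qed

section \<open>Following the optimal final positions with one move per request\<close>

definition next_taxi ::
    "nat \<Rightarrow> ('l \<Rightarrow> 'l \<Rightarrow> real) \<Rightarrow> ('l \<Rightarrow> real) \<Rightarrow> (nat \<Rightarrow> 'l) \<Rightarrow> (nat \<Rightarrow> 'l) \<Rightarrow> nat \<Rightarrow> (nat \<Rightarrow> nat) \<Rightarrow> nat" where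
  "next_taxi k D h q A t \<sigma> =
     (SOME j. j < k \<and> is_opt_set k D h q A (Suc t) (\<sigma>(j := k + t) ` {..<k}))"

primrec alg_src ::
    "nat \<Rightarrow> ('l \<Rightarrow> 'l \<Rightarrow> real) \<Rightarrow> ('l \<Rightarrow> real) \<Rightarrow> (nat \<Rightarrow> 'l) \<Rightarrow> (nat \<Rightarrow> 'l) \<Rightarrow> nat \<Rightarrow> nat \<Rightarrow> nat" where
  "alg_src k D h q A 0 = (\<lambda>j. j)"
| "alg_src k D h q A (Suc t) =
     (alg_src k D h q A t)(next_taxi k D h q A t (alg_src k D h q A t) := k + t)"

definition alg_taxi ::
    "nat \<Rightarrow> ('l \<Rightarrow> 'l \<Rightarrow> real) \<Rightarrow> ('l \<Rightarrow> real) \<Rightarrow> (nat \<Rightarrow> 'l) \<Rightarrow> (nat \<Rightarrow> 'l) \<Rightarrow> nat \<Rightarrow> nat" where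
  "alg_taxi k D h q A t = next_taxi k D h q A t (alg_src k D h q A t)"

lemma alg_src_eq: "alg_src k D h q A t = src k (alg_taxi k D h q A) t"
  by (induction t) (simp_all add: alg_taxi_def)

text \<open>\<open>exchange\<close> supplies a witness for the choice in \<open>next_taxi\<close> as
  long as the current sources are an optimal set, so the choice never falls back to an arbitrary
  taxi.\<close>

lemma alg_invariant:
  assumes k: "0 < k"
  shows "alg_taxi k D h q A \<in> {..<t} \<rightarrow> {..<k}
       \<and> is_opt_set k D h q A t (src k (alg_taxi k D h q A) t ` {..<k})"
proof (induction t)
  case 0
  have s: "sched k 0 = {\<lambda>_. undefined}" by (auto simp: sched_def)
  show ?case by (simp add: is_opt_set_def opt_def s) (simp add: unused_def)
next
  case (Suc t)
  let ?c = "alg_taxi k D h q A"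
  have c: "?c \<in> {..<t} \<rightarrow> {..<k}" using Suc by simp
  obtain m where m: "m \<in> sched k t" "val k D h q A t m = opt k D h q A t"
      "unused k t m = src k ?c t ` {..<k}"
    using Suc by (auto simp: is_opt_set_def)
  obtain p where p: "p \<in> unused k t m" "is_opt_set k D h q A (Suc t) (insert (k + t) (unused k t m - {p}))"
    using exchange[OF k m(1,2)] by auto
  then obtain j where j: "j < k" "p = src k ?c t j" using m(3) by auto
  have "(src k ?c t)(j := k + t) ` {..<k} = insert (k + t) (unused k t m - {p})"
    using src_bounds[OF c] j unfolding m(3) by (auto simp: inj_on_def)
  then have "j < k \<and> is_opt_set k D h q A (Suc t) ((alg_src k D h q A t)(j := k + t) ` {..<k})"
    using p j by (simp add: alg_src_eq)
  then have "?c t < k \<and> is_opt_set k D h q A (Suc t) ((alg_src k D h q A t)(?c t := k + t) ` {..<k})"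
    unfolding alg_taxi_def next_taxi_def by (rule someI)
  then show ?case
    using c by (auto simp: alg_src_eq less_Suc_eq)
qed

lemma alg_taxi_less: "0 < k \<Longrightarrow> alg_taxi k D h q A t < k"
  using alg_invariant[of k D h q A "Suc t"] by auto

lemma is_opt_set_cong:
  assumes "\<And>s. s < k + t \<Longrightarrow> q s = q' s" "\<And>i. i < t \<Longrightarrow> A i = A' i"
  shows "is_opt_set k D h q A t = is_opt_set k D h q' A' t"
proof -
  have v: "val k D h q A t m = val k D h q' A' t m" if "m \<in> sched k t" for m
  proof -
    have "(\<Sum>i<t. D (q (m i)) (A i)) = (\<Sum>i<t. D (q' (m i)) (A' i))"
    proof (rule sum.cong)
      fix i assume i: "i \<in> {..<t}"
      then have "m i < k + i" using that by (auto simp: sched_def PiE_iff)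
      then show "D (q (m i)) (A i) = D (q' (m i)) (A' i)" using i assms by simp
    qed simp
    moreover have "(\<Sum>s\<in>unused k t m. h (q s)) = (\<Sum>s\<in>unused k t m. h (q' s))"
      using assms by (intro sum.cong) (auto simp: unused_def)
    ultimately show ?thesis by (simp add: val_def)
  qed
  then have "opt k D h q A t = opt k D h q' A' t"
    unfolding opt_def by (metis (no_types, lifting) image_cong)
  then show ?thesis unfolding is_opt_set_def fun_eq_iff using v by metis
qed

text \<open>This makes the algorithm online: the taxi for request \<open>t\<close> depends on
  requests up to \<open>t\<close> only, including the end point \<open>q (k + t)\<close> of this
  request.\<close>

lemma alg_taxi_cong:
  assumes q: "\<And>s. s < k + Suc t \<Longrightarrow> q s = q' s" and A: "\<And>i. i < Suc t \<Longrightarrow> A i = A' i"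
  shows "alg_taxi k D h q A t = alg_taxi k D h q' A' t"
proof -
  have n: "next_taxi k D h q A i \<sigma> = next_taxi k D h q' A' i \<sigma>" if "i \<le> t" for i \<sigma>
    using is_opt_set_cong[of k "Suc i" q q' A A' D h] that q A by (simp add: next_taxi_def)
  have "alg_src k D h q A i = alg_src k D h q' A' i" if "i \<le> t" for i
    using that by (induction i) (simp_all add: n)
  then show ?thesis by (simp add: alg_taxi_def n)
qed

lemma card_sources_step:
  assumes c: "c \<in> {..<Suc t} \<rightarrow> {..<k}"
  shows "real (card {s \<in> src k c (Suc t) ` {..<k}. q s \<in> X})
       = real (card {s \<in> src k c t ` {..<k}. q s \<in> X}) - of_bool (q (src k c t (c t)) \<in> X) + of_bool (q (k + t) \<in> X)"
proof -
  have c': "c \<in> {..<t} \<rightarrow> {..<k}" and ct: "c t < k" using c by auto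
  have b: "inj_on (src k c t) {..<k}" "src k c t ` {..<k} \<subseteq> {..<k + t}"
    using src_bounds[OF c'] by auto
  have count: "real (card {s \<in> f ` {..<k}. q s \<in> X}) = (\<Sum>j<k. of_bool (q (f j) \<in> X))"
    if "inj_on f {..<k}" for f
  proof -
    have "{s \<in> f ` {..<k}. q s \<in> X} = f ` {j\<in>{..<k}. q (f j) \<in> X}" by auto
    moreover have "inj_on f {j\<in>{..<k}. q (f j) \<in> X}"
      using that by (rule inj_on_subset) auto
    ultimately have "card {s \<in> f ` {..<k}. q s \<in> X} = card {j\<in>{..<k}. q (f j) \<in> X}"
      by (simp only: card_image)
    then show ?thesis by (simp add: of_bool_def sum.If_cases Int_def)
  qed
  have "inj_on (src k c (Suc t)) {..<k}" using src_bounds[OF c] by simp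
  then have "real (card {s \<in> src k c (Suc t) ` {..<k}. q s \<in> X}) = (\<Sum>j<k. of_bool (q (src k c (Suc t) j) \<in> X))"
    by (rule count)
  also have "\<dots> = of_bool (q (k + t) \<in> X) + (\<Sum>j\<in>{..<k} - {c t}. of_bool (q (src k c t j) \<in> X))"
    using ct by (subst sum.remove[of _ "c t"]) (auto intro!: sum.cong)
  also have "(\<Sum>j\<in>{..<k} - {c t}. of_bool (q (src k c t j) \<in> X))
      = (\<Sum>j<k. of_bool (q (src k c t j) \<in> X)) - (of_bool (q (src k c t (c t)) \<in> X) :: real)"
    using ct by (subst sum.remove[of "{..<k}" "c t"]) auto
  finally show ?thesis by (simp add: count[OF b(1)])
qed

section \<open>Perturbed offline optima\<close>

lemma expectation_mono_finite:
  fixes f g :: "'a \<Rightarrow> real"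
  assumes "finite (set_pmf p)" "\<And>x. x \<in> set_pmf p \<Longrightarrow> f x \<le> g x"
  shows "expect p f \<le> expect p g"
  using assms by (intro integral_mono_AE) (auto simp: AE_measure_pmf_iff integrable_measure_pmf_finite)

lemma expectation_bind_finite:
  fixes h :: "'b \<Rightarrow> real"
  assumes "finite (set_pmf p)" "\<And>x. x \<in> set_pmf p \<Longrightarrow> finite (set_pmf (f x))"
  shows "expect (bind_pmf p f) h = expect p (\<lambda>x. expect (f x) h)"
  using assms by (subst pmf_expectation_bind[of "set_pmf p"])
    (auto simp: integral_measure_pmf[of "set_pmf p"])

lemma expectation_pair_finite:
  fixes h :: "'a \<times> 'b \<Rightarrow> real"
  assumes "finite (set_pmf p)" "finite (set_pmf q)"
  shows "expect (pair_pmf p q) h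
       = expect p (\<lambda>x. expect q (\<lambda>y. h (x, y)))"
  using assms unfolding pair_pmf_def by (simp add: expectation_bind_finite)

definition steps_pmf :: "'i set \<Rightarrow> nat \<Rightarrow> ('i \<Rightarrow> nat) pmf" where
  "steps_pmf I K = Pi_pmf I 0 (\<lambda>_. step_pmf K)"

lemma finite_set_step_pmf: "0 < K \<Longrightarrow> finite (set_pmf (step_pmf K))"
  using set_step_pmf finite_subset by blast

lemma finite_set_steps_pmf: "finite I \<Longrightarrow> 0 < K \<Longrightarrow> finite (set_pmf (steps_pmf I K))"
  unfolding steps_pmf_def by (subst set_Pi_pmf) (auto intro!: finite_PiE_dflt finite_set_step_pmf)

lemma set_steps_pmf_less:
  assumes "finite I" "0 < K" "v \<in> set_pmf (steps_pmf I K)" shows "v x < K"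
proof (cases "x \<in> I")
  case True
  then have "v x \<in> set_pmf (step_pmf K)"
    using assms by (auto simp: steps_pmf_def set_Pi_pmf PiE_dflt_def)
  then show ?thesis using set_step_pmf assms by auto
qed (use assms in \<open>auto simp: steps_pmf_def set_Pi_pmf PiE_dflt_def\<close>)

text \<open>Redrawing one independent coordinate does not change the law. This allows
  \<open>noise_bound\<close> to be applied to one variable with the other ones frozen.\<close>

lemma expectation_resample:
  fixes X :: "('i \<Rightarrow> nat) \<Rightarrow> real"
  assumes I: "finite I" "x \<in> I" and K: "0 < K"
  shows "expect (steps_pmf I K) X
       = expect (steps_pmf I K) (\<lambda>v. expect (step_pmf K) (\<lambda>i. X (v(x := i))))"
proof -
  have fin: "finite (set_pmf (step_pmf K))" "finite (set_pmf (steps_pmf (I - {x}) K))"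
    using I K by (auto simp: finite_set_step_pmf finite_set_steps_pmf)
  have "insert x (I - {x}) = I" using I by auto
  then have split: "steps_pmf I K = map_pmf (\<lambda>(y, f). f(x := y)) (pair_pmf (step_pmf K) (steps_pmf (I - {x}) K))"
    using Pi_pmf_insert[of "I - {x}" x 0 "\<lambda>_. step_pmf K"] I by (simp add: steps_pmf_def)
  have split': "steps_pmf I K = map_pmf (\<lambda>(f, y). f(x := y)) (pair_pmf (steps_pmf (I - {x}) K) (step_pmf K))"
    unfolding split by (subst pair_commute_pmf) (simp add: pmf.map_comp o_def case_prod_unfold)
  have "expect (steps_pmf I K) (\<lambda>v. expect (step_pmf K) (\<lambda>i. X (v(x := i))))
     = expect (steps_pmf (I - {x}) K) (\<lambda>f. expect (step_pmf K) (\<lambda>i. X (f(x := i))))"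
    using fin unfolding split by (simp add: expectation_pair_finite)
  also have "\<dots> = expect (steps_pmf I K) X"
    using fin unfolding split' by (simp add: expectation_pair_finite)
  finally show ?thesis by simp
qed

lemma expectation_steps_component:
  fixes X :: "nat \<Rightarrow> real"
  assumes "finite I" "x \<in> I" "0 < K"
  shows "expect (steps_pmf I K) (\<lambda>v. X (v x)) = expect (step_pmf K) X"
  using assms by (subst expectation_resample[of I x K]) simp_all

text \<open>
  A label lists the cells of a point at the levels \<open>0, \<dots>, L\<close>. The distance \<open>cut_dist\<close> is a sum of cut
  metrics; the partitions of the different levels need not be nested.
\<close>

definition cut_dist :: "(nat \<Rightarrow> real) \<Rightarrow> nat \<Rightarrow> nat list \<Rightarrow> nat list \<Rightarrow> real" where
  "cut_dist w L l l' = (\<Sum>j\<le>L. w j * of_bool (l ! j \<noteq> l' ! j))"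

definition noise :: "(nat \<Rightarrow> real) \<Rightarrow> nat \<Rightarrow> nat \<Rightarrow> (nat \<times> nat \<Rightarrow> nat) \<Rightarrow> nat list \<Rightarrow> real" where
  "noise w L K v l = (\<Sum>j\<le>L. w j / real K * real (v (j, l ! j)))"

lemma cut_dist_nonneg: "(\<And>j. 0 \<le> w j) \<Longrightarrow> 0 \<le> cut_dist w L l l'"
  unfolding cut_dist_def by (intro sum_nonneg) auto

lemma noise_nonneg: "(\<And>j. 0 \<le> w j) \<Longrightarrow> 0 \<le> noise w L K v l"
  unfolding noise_def by (intro sum_nonneg) auto

lemma noise_le:
  assumes "\<And>j. 0 \<le> w j" "\<And>x. v x < K"
  shows "noise w L K v l \<le> (\<Sum>j\<le>L. w j)"
  unfolding noise_def
proof (intro sum_mono)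
  fix j
  have "real (v (j, l ! j)) / real K \<le> 1" using assms(2)[of "(j, l ! j)"] by simp
  from mult_left_mono[OF this assms(1)[of j]]
  show "w j / real K * real (v (j, l ! j)) \<le> w j" by simp
qed

text \<open>Each level contributes a value between 0 and \<open>w j\<close>, and only levels that
  separate the labels contribute differently. Bounded support of the noise is essential here; the
  lemma provides the hypothesis \<open>lip\<close> of \<open>opt_mono_step\<close>.\<close>

lemma noise_lipschitz:
  assumes w: "\<And>j. 0 \<le> w j" and v: "\<And>x. v x < K"
  shows "noise w L K v l \<le> noise w L K v l' + cut_dist w L l l'"
  unfolding noise_def cut_dist_def sum.distrib[symmetric]
proof (intro sum_mono)
  fix j
  show "w j / real K * real (v (j, l ! j))
      \<le> w j / real K * real (v (j, l' ! j)) + w j * of_bool (l ! j \<noteq> l' ! j)"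
  proof (cases "l ! j = l' ! j")
    case False
    have "real (v (j, l ! j)) / real K \<le> 1" using v[of "(j, l ! j)"] by simp
    from mult_left_mono[OF this w[of j]] have "w j / real K * real (v (j, l ! j)) \<le> w j" by simp
    moreover have "0 \<le> w j / real K * real (v (j, l' ! j))" using w by simp
    ultimately show ?thesis using False by simp
  qed simp
qed

lemma noise_upd:
  assumes "j \<le> L"
  shows "noise w L K (v((j, c) := i')) l
       = noise w L K (v((j, c) := i)) l + w j / real K * (real i' - real i) * of_bool (l \<in> {l. l ! j = c})"
proof -
  have "noise w L K (v((j, c) := i')) l - noise w L K (v((j, c) := i)) l
      = (\<Sum>a\<le>L. if a = j then w j / real K * (real i' - real i) * of_bool (l ! j = c) else 0)"
    unfolding noise_def sum_subtractf[symmetric]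
    by (intro sum.cong) (auto simp: algebra_simps diff_divide_distrib)
  also have "\<dots> = w j / real K * (real i' - real i) * of_bool (l ! j = c)"
    using assms by simp
  finally show ?thesis by simp
qed

definition perturbed_taxi ::
    "(nat \<Rightarrow> real) \<Rightarrow> nat \<Rightarrow> nat \<Rightarrow> nat \<Rightarrow> (nat \<Rightarrow> nat list) \<Rightarrow> (nat \<Rightarrow> nat list) \<Rightarrow> (nat \<times> nat \<Rightarrow> nat) \<Rightarrow> nat \<Rightarrow> nat" where
  "perturbed_taxi w L K k q A v = alg_taxi k (cut_dist w L) (noise w L K v) q A"

definition perturbed_opt ::
    "(nat \<Rightarrow> real) \<Rightarrow> nat \<Rightarrow> nat \<Rightarrow> nat \<Rightarrow> (nat \<Rightarrow> nat list) \<Rightarrow> (nat \<Rightarrow> nat list) \<Rightarrow> nat \<Rightarrow> (nat \<times> nat \<Rightarrow> nat) \<Rightarrow> real" where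
  "perturbed_opt w L K k q A t v = opt k (cut_dist w L) (noise w L K v) q A t"

text \<open>The noise terms undo the relocation from \<open>A t\<close> to \<open>q (k + t)\<close>:
  what remains is the increase caused by bringing a taxi to \<open>A t\<close>, which is
  nonnegative.\<close>

definition opt_increase ::
    "(nat \<Rightarrow> real) \<Rightarrow> nat \<Rightarrow> nat \<Rightarrow> nat \<Rightarrow> (nat \<Rightarrow> nat list) \<Rightarrow> (nat \<Rightarrow> nat list) \<Rightarrow> nat \<Rightarrow> (nat \<times> nat \<Rightarrow> nat) \<Rightarrow> real" where
  "opt_increase w L K k q A t v =
     perturbed_opt w L K k q A (Suc t) v - perturbed_opt w L K k q A t v + noise w L K v (A t) - noise w L K v (q (k + t))"

definition run_label ::
    "(nat \<Rightarrow> real) \<Rightarrow> nat \<Rightarrow> nat \<Rightarrow> nat \<Rightarrow> (nat \<Rightarrow> nat list) \<Rightarrow> (nat \<Rightarrow> nat list) \<Rightarrow> nat \<Rightarrow> (nat \<times> nat \<Rightarrow> nat) \<Rightarrow> nat list" where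
  "run_label w L K k q A t v =
     q (src k (perturbed_taxi w L K k q A v) t (perturbed_taxi w L K k q A v t))"

lemma opt_increase_nonneg:
  assumes "0 < k" "\<And>j. 0 \<le> w j" "\<And>x. v x < K"
  shows "0 \<le> opt_increase w L K k q A t v"
  using opt_mono_step[of k "noise w L K v" "cut_dist w L" q A t] noise_lipschitz[of w v K L] assms
  by (simp add: opt_increase_def perturbed_opt_def)

text \<open>The variable that is varied belongs to the cell of the requested point at level
  \<open>j\<close>. The whole run of the algorithm varies with it, but its taxis always form an
  optimal set, and only their numbers \<open>U\<close> in this cell matter.\<close>

lemma noise_bound_coordinate:
  assumes k: "0 < k" and w: "\<And>j. 0 < w j" and K: "0 < K" and Z: "2 \<le> Z"
    and v: "\<And>x. v x < K" and j: "j \<le> L"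
  shows "w j * expect (step_pmf K)
           (\<lambda>i. of_bool (run_label w L K k q A t (v((j, A t ! j) := i)) ! j \<noteq> A t ! j))
       \<le> rate Z * (expect (step_pmf K)
           (\<lambda>i. opt_increase w L K k q A t (v((j, A t ! j) := i))) + w j / real K * (real k + 1)) + w j * slack Z"
proof -
  let ?X = "{l. l ! j = A t ! j}"
  define W where "W i = v((j, A t ! j) := i)" for i
  define c where "c i = perturbed_taxi w L K k q A (W i)" for i
  define U where "U t' i = real (card {s \<in> src k (c i) t' ` {..<k}. q s \<in> ?X})" for t' i
  let ?\<tau> = "w j / real K"
  have \<tau>: "0 < ?\<tau>" using w K by simp
  have inv: "c i \<in> {..<t'} \<rightarrow> {..<k}"
      "is_opt_set k (cut_dist w L) (noise w L K (W i)) q A t' (src k (c i) t' ` {..<k})" for i t'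
    using alg_invariant[OF k, of "cut_dist w L" "noise w L K (W i)" q A t']
    unfolding c_def perturbed_taxi_def by simp_all
  \<comment> \<open>The supergradient inequality between two arbitrary noise values. It is used
    upwards and downwards.\<close>
  have V: "perturbed_opt w L K k q A t' (W i') \<le> perturbed_opt w L K k q A t' (W i) + ?\<tau> * (real i' - real i) * U t' i"
    for t' i i'
    unfolding perturbed_opt_def U_def
    by (rule opt_perturb[OF inv(2)]) (simp only: W_def noise_upd[OF j, of w K v _ i' _ i])
  have Ustep: "U (Suc t) i = U t i - of_bool (run_label w L K k q A t (W i) \<in> ?X) + of_bool (q (k + t) \<in> ?X)" for i
    unfolding U_def run_label_def c_def[symmetric] by (rule card_sources_step[OF inv(1)])
  have noise_diff: "noise w L K (W (Suc i)) l - noise w L K (W i) l = ?\<tau> * of_bool (l \<in> ?X)" for i l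
    using noise_upd[OF j, of w K v "A t ! j" "Suc i" l i] by (simp add: W_def)
  \<comment> \<open>Adding \<open>V\<close> in both directions cancels the optima: a larger terminal
    cost leaves no more taxis in the cell.\<close>
  have Umono: "U t (Suc i) \<le> U t i" for i
  proof -
    have "?\<tau> * U t (Suc i) \<le> ?\<tau> * U t i"
      using V[of t "Suc i" i] V[of t i "Suc i"] by simp
    then show ?thesis using \<tau> by (rule mult_left_le_imp_le)
  qed
  have "real K * ?\<tau> * expect (step_pmf K) (\<lambda>i. of_bool (run_label w L K k q A t (W i) ! j \<noteq> A t ! j))
      \<le> rate Z * (expect (step_pmf K) (\<lambda>i. opt_increase w L K k q A t (W i)) + ?\<tau> * (real k + 1))
        + real K * ?\<tau> * slack Z"
  proof (rule noise_bound[where U = "U t", OF K Z])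
    show "0 \<le> opt_increase w L K k q A t (W i)" if "i < K" for i
      using that v k w by (intro opt_increase_nonneg) (auto simp: W_def less_imp_le)
    show "0 \<le> U t i \<and> U t i \<le> real k" for i
    proof -
      have "card {s \<in> src k (c i) t ` {..<k}. q s \<in> ?X} \<le> card (src k (c i) t ` {..<k})"
        by (intro card_mono) auto
      also have "\<dots> \<le> k" using card_image_le[of "{..<k}" "src k (c i) t"] by simp
      finally show ?thesis by (simp add: U_def)
    qed
    \<comment> \<open>Going from noise \<open>i\<close> to \<open>Suc i\<close>, the optimum after
      the request grows by at least \<open>\<tau> * U (Suc t) (Suc i)\<close> and the one before it
      by at most \<open>\<tau> * U t i\<close>. \<open>Ustep\<close> relates the counts; the end
      point cancels against the noise terms in \<open>opt_increase\<close>, and \<open>A t\<close>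
      lies in the cell by choice of \<open>?X\<close>.\<close>
    show "?\<tau> * (of_bool (run_label w L K k q A t (W (Suc i)) ! j \<noteq> A t ! j) - (U t i - U t (Suc i)))
        \<le> opt_increase w L K k q A t (W (Suc i)) - opt_increase w L K k q A t (W i)" for i
    proof -
      have "?\<tau> * (U (Suc t) (Suc i) - U t i) + ?\<tau> * of_bool (A t \<in> ?X) - ?\<tau> * of_bool (q (k + t) \<in> ?X)
          \<le> opt_increase w L K k q A t (W (Suc i)) - opt_increase w L K k q A t (W i)"
        using V[of "Suc t" i "Suc i"] V[of t "Suc i" i] noise_diff[of i "A t"] noise_diff[of i "q (k + t)"]
        unfolding opt_increase_def by (simp add: right_diff_distrib)
      moreover have "?\<tau> * (U (Suc t) (Suc i) - U t i) + ?\<tau> * of_bool (A t \<in> ?X) - ?\<tau> * of_bool (q (k + t) \<in> ?X)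
          = ?\<tau> * (of_bool (run_label w L K k q A t (W (Suc i)) ! j \<noteq> A t ! j) - (U t i - U t (Suc i)))"
        unfolding Ustep by (simp add: algebra_simps)
      ultimately show ?thesis by simp
    qed
  qed (use Umono \<tau> in auto)
  then show ?thesis using K by (simp add: W_def)
qed

lemma noise_bound_level:
  assumes k: "0 < k" and w: "\<And>j. 0 < w j" and K: "0 < K" and Z: "2 \<le> Z"
    and I: "finite I" "(j, A t ! j) \<in> I" and j: "j \<le> L"
  shows "w j * expect (steps_pmf I K) (\<lambda>v. of_bool (run_label w L K k q A t v ! j \<noteq> A t ! j))
       \<le> rate Z * (expect (steps_pmf I K) (opt_increase w L K k q A t)
           + w j / real K * (real k + 1)) + w j * slack Z"
proof -
  let ?P = "steps_pmf I K" and ?x = "(j, A t ! j)"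
  let ?e = "\<lambda>v. of_bool (run_label w L K k q A t v ! j \<noteq> A t ! j) :: real"
  let ?D = "opt_increase w L K k q A t"
  let ?r = "w j / real K * (real k + 1)"
  have fin: "finite (set_pmf ?P)" using I K by (simp add: finite_set_steps_pmf)
  note [simp] = integrable_measure_pmf_finite[OF fin]
  have "w j * expect ?P ?e
      = expect ?P (\<lambda>v. w j * expect (step_pmf K) (\<lambda>i. ?e (v(?x := i))))"
    by (subst expectation_resample[OF I K]) simp
  also have "\<dots> \<le> expect ?P
      (\<lambda>v. rate Z * (expect (step_pmf K) (\<lambda>i. ?D (v(?x := i))) + ?r) + w j * slack Z)"
    using set_steps_pmf_less[OF I(1) K] k w K Z j
    by (intro expectation_mono_finite[OF fin] noise_bound_coordinate) auto
  also have "\<dots> = rate Z * (expect ?P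
      (\<lambda>v. expect (step_pmf K) (\<lambda>i. ?D (v(?x := i)))) + ?r) + w j * slack Z"
    by simp
  also have "expect ?P (\<lambda>v. expect (step_pmf K) (\<lambda>i. ?D (v(?x := i))))
      = expect ?P ?D"
    by (rule expectation_resample[OF I K, symmetric])
  finally show ?thesis .
qed

lemma expectation_noise:
  assumes "finite I" "0 < K" "\<And>j. j \<le> L \<Longrightarrow> (j, l ! j) \<in> I"
  shows "expect (steps_pmf I K) (\<lambda>v. noise w L K v l)
       = (\<Sum>j\<le>L. w j / real K * expect (step_pmf K) real)"
proof -
  have fin: "finite (set_pmf (steps_pmf I K))" using assms by (simp add: finite_set_steps_pmf)
  have "expect (steps_pmf I K) (\<lambda>v. noise w L K v l)
      = (\<Sum>j\<le>L. expect (steps_pmf I K) (\<lambda>v. w j / real K * real (v (j, l ! j))))"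
    unfolding noise_def by (intro Bochner_Integration.integral_sum integrable_measure_pmf_finite fin)
  also have "\<dots> = (\<Sum>j\<le>L. w j / real K * expect (step_pmf K) real)"
    using assms by (intro sum.cong) (auto simp: expectation_steps_component)
  finally show ?thesis .
qed

text \<open>
  The noise has the same mean at every point, so relocations of taxis do not change the
  expected noise, and the increases of the perturbed optimum telescope in expectation.
\<close>

lemma sum_opt_increase:
  assumes k: "0 < k" and w: "\<And>j. 0 \<le> w j" and K: "0 < K" and I: "finite I"
    and q: "\<And>s j. s < k + T \<Longrightarrow> j \<le> L \<Longrightarrow> (j, q s ! j) \<in> I"
    and A: "\<And>t j. t < T \<Longrightarrow> j \<le> L \<Longrightarrow> (j, A t ! j) \<in> I"
    and c: "c \<in> {..<T} \<rightarrow> {..<k}"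
  shows "(\<Sum>t<T. expect (steps_pmf I K) (opt_increase w L K k q A t))
       \<le> (\<Sum>t<T. cut_dist w L (q (src k c t (c t))) (A t)) + real k * (\<Sum>j\<le>L. w j)"
proof -
  let ?E = "expect (steps_pmf I K)"
  let ?V = "perturbed_opt w L K k q A"
  have fin: "finite (set_pmf (steps_pmf I K))" using I K by (simp add: finite_set_steps_pmf)
  note int[simp] = integrable_measure_pmf_finite[OF fin]
  have "?E (opt_increase w L K k q A t) = ?E (?V (Suc t)) - ?E (?V t)" if "t < T" for t
  proof -
    have "?E (opt_increase w L K k q A t)
        = ?E (?V (Suc t)) - ?E (?V t) + ?E (\<lambda>v. noise w L K v (A t)) - ?E (\<lambda>v. noise w L K v (q (k + t)))"
      unfolding opt_increase_def by simp
    also have "?E (\<lambda>v. noise w L K v (A t)) = ?E (\<lambda>v. noise w L K v (q (k + t)))"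
      using that q A K I by (simp add: expectation_noise)
    finally show ?thesis by simp
  qed
  then have "(\<Sum>t<T. ?E (opt_increase w L K k q A t)) = ?E (?V T) - ?E (?V 0)"
    using sum_lessThan_telescope[of "\<lambda>t. ?E (?V t)" T] by simp
  also have "0 \<le> ?E (?V 0)"
  proof (rule Bochner_Integration.integral_nonneg)
    fix v
    obtain m where m: "m \<in> sched k 0"
      "val k (cut_dist w L) (noise w L K v) q A 0 m = opt k (cut_dist w L) (noise w L K v) q A 0"
      by (rule opt_attained[OF k])
    have "0 \<le> val k (cut_dist w L) (noise w L K v) q A 0 m"
      unfolding val_def using w by (auto intro!: sum_nonneg noise_nonneg)
    then show "0 \<le> ?V 0 v" by (simp add: perturbed_opt_def m(2))
  qed
  then have "?E (?V T) - ?E (?V 0) \<le> ?E (?V T)" by simp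
  \<comment> \<open>For each noise vector, \<open>c\<close> is a feasible schedule, and its
    \<open>k\<close> final positions cost at most the total weight each.\<close>
  also have "?E (?V T) \<le> ?E (\<lambda>_. (\<Sum>t<T. cut_dist w L (q (src k c t (c t))) (A t)) + real k * (\<Sum>j\<le>L. w j))"
  proof (rule expectation_mono_finite[OF fin])
    fix v assume "v \<in> set_pmf (steps_pmf I K)"
    then have v: "\<And>x. v x < K" using set_steps_pmf_less[OF I K] by auto
    have m: "sched_of k c T \<in> sched k T" using sched_of[OF c] by simp
    have svc: "(\<Sum>t<T. cut_dist w L (q (sched_of k c T t)) (A t)) = (\<Sum>t<T. cut_dist w L (q (src k c t (c t))) (A t))"
      by (simp add: sched_of_def)
    have "?V T v \<le> val k (cut_dist w L) (noise w L K v) q A T (sched_of k c T)"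
      unfolding perturbed_opt_def by (rule opt_le[OF m])
    also have "(\<Sum>s\<in>unused k T (sched_of k c T). noise w L K v (q s)) \<le> real (card (unused k T (sched_of k c T))) * (\<Sum>j\<le>L. w j)"
      using w v by (intro sum_bounded_above noise_le) auto
    then have "val k (cut_dist w L) (noise w L K v) q A T (sched_of k c T)
        \<le> (\<Sum>t<T. cut_dist w L (q (src k c t (c t))) (A t)) + real k * (\<Sum>j\<le>L. w j)"
      unfolding val_def card_unused[OF m] using svc by simp
    finally show "?V T v \<le> (\<Sum>t<T. cut_dist w L (q (src k c t (c t))) (A t)) + real k * (\<Sum>j\<le>L. w j)" .
  qed
  finally show ?thesis by simp
qed

lemma sum_half_powers: "(\<Sum>j\<in>{a..<b}. (1 / 2) ^ j) \<le> 2 * (1 / 2 :: real) ^ a"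
proof (cases "a \<le> b")
  case True
  have "(\<Sum>j\<in>{a..<b}. (1 / 2 :: real) ^ j) = 2 * (1/2) ^ a - 2 * (1/2) ^ b"
    using True by (induction b rule: dec_induct) auto
  then show ?thesis by simp
qed simp

text \<open>\<open>J\<close> occurs only in the analysis. Up to level \<open>J\<close> the hazard
  bound is used, so each level pays the increase of the optimum once; the finer levels are bounded
  by their total weight, at most \<open>R * (1 / 2) ^ J\<close> per request.\<close>

lemma perturbed_taxi_cost:
  fixes R :: real
  assumes k: "0 < k" and R: "0 < R" and w: "w = (\<lambda>j. R * (1 / 2) ^ j)" and K: "0 < K" and Z: "2 \<le> Z"
    and I: "finite I"
    and q: "\<And>s j. s < k + T \<Longrightarrow> j \<le> L \<Longrightarrow> (j, q s ! j) \<in> I"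
    and A: "\<And>t j. t < T \<Longrightarrow> j \<le> L \<Longrightarrow> (j, A t ! j) \<in> I"
    and c: "c \<in> {..<T} \<rightarrow> {..<k}" and J: "J \<le> L"
  shows "expect (steps_pmf I K) (\<lambda>v. \<Sum>t<T. cut_dist w L (run_label w L K k q A t v) (A t))
       \<le> real (J + 1) * rate Z * ((\<Sum>t<T. cut_dist w L (q (src k c t (c t))) (A t)) + 2 * real k * R)
         + real T * (real (J + 1) * rate Z * (R * (real k + 1) / real K) + 2 * R * slack Z + R * (1 / 2) ^ J)"
proof -
  let ?E = "expect (steps_pmf I K)"
  let ?D = "\<lambda>t. ?E (opt_increase w L K k q A t)"
  let ?e = "\<lambda>j t v. of_bool (run_label w L K k q A t v ! j \<noteq> A t ! j) :: real"
  let ?r = "R * (real k + 1) / real K"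
  have fin: "finite (set_pmf (steps_pmf I K))" using I K by (simp add: finite_set_steps_pmf)
  note int[simp] = integrable_measure_pmf_finite[OF fin]
  have wpos: "0 < w j" and wR: "w j \<le> R" for j
    using R by (auto simp: w power_le_one)
  have r0: "0 \<le> rate Z" "0 \<le> slack Z" using Z by (auto simp: rate_nonneg slack_nonneg)
  have sumw: "(\<Sum>j\<le>L. w j) \<le> 2 * R"
    using sum_half_powers[of 0 "Suc L"] R
    by (simp add: w sum_distrib_left[symmetric] atLeast0LessThan lessThan_Suc_atMost)
  have sumw': "(\<Sum>j\<in>{Suc J..L}. w j) \<le> R * (1/2) ^ J"
    using sum_half_powers[of "Suc J" "Suc L"] R
    by (simp add: w sum_distrib_left[symmetric] atLeastLessThanSuc_atLeastAtMost)
  have one: "?E (\<lambda>v. cut_dist w L (run_label w L K k q A t v) (A t))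
      \<le> real (J + 1) * rate Z * (?D t + ?r) + 2 * R * slack Z + R * (1/2) ^ J" if t: "t < T" for t
  proof -
    have "?E (\<lambda>v. cut_dist w L (run_label w L K k q A t v) (A t)) = (\<Sum>j\<le>L. w j * ?E (?e j t))"
      unfolding cut_dist_def
      by (subst Bochner_Integration.integral_sum[OF int]) (simp only: integral_mult_right_zero)
    also have "{..L} = {..J} \<union> {Suc J..L}" using J by auto
    also have "(\<Sum>j\<in>{..J} \<union> {Suc J..L}. w j * ?E (?e j t))
        = (\<Sum>j\<le>J. w j * ?E (?e j t)) + (\<Sum>j\<in>{Suc J..L}. w j * ?E (?e j t))"
      by (rule sum.union_disjoint) auto
    also have "(\<Sum>j\<in>{Suc J..L}. w j * ?E (?e j t)) \<le> (\<Sum>j\<in>{Suc J..L}. w j * ?E (\<lambda>_. 1))"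
      using wpos by (intro sum_mono mult_left_mono expectation_mono_finite[OF fin]) (auto simp: less_imp_le)
    also have "\<dots> \<le> R * (1/2) ^ J" using sumw' by simp
    also have "(\<Sum>j\<le>J. w j * ?E (?e j t)) \<le> (\<Sum>j\<le>J. rate Z * (?D t + ?r) + w j * slack Z)"
    proof (intro sum_mono)
      fix j assume j: "j \<in> {..J}"
      have "w j * ?E (?e j t) \<le> rate Z * (?D t + w j / real K * (real k + 1)) + w j * slack Z"
        using j J t A by (intro noise_bound_level[OF k wpos K Z I]) auto
      also have "w j / real K * (real k + 1) \<le> ?r"
        using mult_right_mono[OF wR[of j], of "(real k + 1) / real K"] by simp
      finally show "w j * ?E (?e j t) \<le> rate Z * (?D t + ?r) + w j * slack Z"
        using r0 by (simp add: mult_left_mono)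
    qed
    also have "(\<Sum>j\<le>J. rate Z * (?D t + ?r) + w j * slack Z)
        = real (J + 1) * rate Z * (?D t + ?r) + (\<Sum>j\<le>J. w j) * slack Z"
      by (simp add: sum.distrib sum_distrib_right)
    also have "(\<Sum>j\<le>J. w j) \<le> (\<Sum>j\<le>L. w j)"
      using J wpos by (intro sum_mono2) (auto simp: less_imp_le)
    also have "\<dots> \<le> 2 * R" by (rule sumw)
    finally show ?thesis using r0 by (simp add: mult_right_mono)
  qed
  have D: "(\<Sum>t<T. ?D t) \<le> (\<Sum>t<T. cut_dist w L (q (src k c t (c t))) (A t)) + 2 * real k * R"
  proof -
    have "(\<Sum>t<T. ?D t) \<le> (\<Sum>t<T. cut_dist w L (q (src k c t (c t))) (A t)) + real k * (\<Sum>j\<le>L. w j)"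
      using wpos q A by (intro sum_opt_increase k K I c) (auto simp: less_imp_le)
    also have "real k * (\<Sum>j\<le>L. w j) \<le> real k * (2 * R)"
      using sumw by (intro mult_left_mono) auto
    finally show ?thesis by simp
  qed
  have "?E (\<lambda>v. \<Sum>t<T. cut_dist w L (run_label w L K k q A t v) (A t))
      = (\<Sum>t<T. ?E (\<lambda>v. cut_dist w L (run_label w L K k q A t v) (A t)))"
    by simp
  also have "\<dots> \<le> (\<Sum>t<T. real (J + 1) * rate Z * (?D t + ?r) + 2 * R * slack Z + R * (1/2) ^ J)"
    using one by (intro sum_mono) auto
  also have "\<dots> = real (J + 1) * rate Z * (\<Sum>t<T. ?D t)
      + real T * (real (J + 1) * rate Z * ?r + 2 * R * slack Z + R * (1/2) ^ J)"
    by (simp only: sum.distrib distrib_left sum_distrib_left[symmetric] sum_constant card_lessThan) (simp add: algebra_simps)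
  also have "\<dots> \<le> real (J + 1) * rate Z * ((\<Sum>t<T. cut_dist w L (q (src k c t (c t))) (A t)) + 2 * real k * R)
      + real T * (real (J + 1) * rate Z * ?r + 2 * R * slack Z + R * (1/2) ^ J)"
    using D r0 by (intro add_right_mono mult_left_mono) auto
  finally show ?thesis .
qed

section \<open>Random partitions\<close>

text \<open>Ball carving: the centers come in a fixed order with independent radii, and a point
  joins the first ball that contains it. For noise values below \<open>K\<close> a radius is at
  least \<open>R * (1 / 2) ^ j\<close> and less than twice that.\<close>

definition cell ::
    "('p \<Rightarrow> 'p \<Rightarrow> real) \<Rightarrow> real \<Rightarrow> nat \<Rightarrow> (nat \<Rightarrow> nat \<Rightarrow> 'p) \<Rightarrow> (nat \<times> nat \<Rightarrow> nat) \<Rightarrow> nat \<Rightarrow> 'p \<Rightarrow> nat" where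
  "cell d R K ctr u j x = (LEAST i. d (ctr j i) x \<le> R * (1 / 2) ^ j * (1 + real (u (j, i)) / real K))"

definition label ::
    "('p \<Rightarrow> 'p \<Rightarrow> real) \<Rightarrow> real \<Rightarrow> nat \<Rightarrow> (nat \<Rightarrow> nat \<Rightarrow> 'p) \<Rightarrow> nat \<Rightarrow> (nat \<times> nat \<Rightarrow> nat) \<Rightarrow> 'p \<Rightarrow> nat list" where
  "label d R K ctr L u x = map (\<lambda>j. cell d R K ctr u j x) [0..<Suc L]"

lemma label_nth: "j \<le> L \<Longrightarrow> label d R K ctr L u x ! j = cell d R K ctr u j x"
  unfolding label_def by (subst nth_map) (auto simp del: upt_Suc)

text \<open>The summands are the probabilities that trial \<open>i\<close> is the first success
  among independent trials; these events are disjoint.\<close>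

lemma first_hit_sum:
  fixes p :: "nat \<Rightarrow> real"
  assumes "\<And>i. 0 \<le> p i \<and> p i \<le> 1"
  shows "(\<Sum>i<n. (\<Prod>i'<i. 1 - p i') * p i) \<le> 1"
proof -
  have "(\<Sum>i<n. (\<Prod>i'<i. 1 - p i') * p i) = 1 - (\<Prod>i<n. 1 - p i)"
    by (induction n) (auto simp: algebra_simps)
  moreover have "0 \<le> (\<Prod>i<n. 1 - p i)" using assms by (intro prod_nonneg) auto
  ultimately show ?thesis by simp
qed

lemma prob_first_hit:
  fixes i :: nat
  assumes I: "finite I" "\<And>i'. i' \<le> i \<Longrightarrow> (j, i') \<in> I" and K: "0 < K"
  shows "prob (steps_pmf I K) {u. (\<forall>i'<i. u (j, i') < a i') \<and> a i \<le> u (j, i) \<and> u (j, i) < b}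
       = (\<Prod>i'<i. 1 - prob (step_pmf K) {a i'..}) * prob (step_pmf K) {a i..<b}"
proof -
  define B where "B x = (if fst x = j then if snd x < i then {..<a (snd x)} else if snd x = i then {a i..<b} else UNIV else UNIV)" for x
  have "{u. (\<forall>i'<i. u (j, i') < a i') \<and> a i \<le> u (j, i) \<and> u (j, i) < b} = Pi I B"
  proof (intro set_eqI iffI)
    fix u assume "u \<in> {u. (\<forall>i'<i. u (j, i') < a i') \<and> a i \<le> u (j, i) \<and> u (j, i) < b}"
    then show "u \<in> Pi I B" by (auto simp: B_def)
  next
    fix u assume u: "u \<in> Pi I B"
    have uB: "u (j, i') \<in> B (j, i')" if "i' \<le> i" for i' using u I(2)[OF that] by auto
    from uB[OF order_refl] have "a i \<le> u (j, i) \<and> u (j, i) < b" by (simp add: B_def)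
    moreover have "u (j, i') < a i'" if "i' < i" for i'
      using uB[of i'] that by (simp add: B_def)
    ultimately show "u \<in> {u. (\<forall>i'<i. u (j, i') < a i') \<and> a i \<le> u (j, i) \<and> u (j, i) < b}"
      by blast
  qed
  then have "prob (steps_pmf I K) {u. (\<forall>i'<i. u (j, i') < a i') \<and> a i \<le> u (j, i) \<and> u (j, i) < b}
      = (\<Prod>x\<in>I. prob (step_pmf K) (B x))"
    by (simp add: steps_pmf_def measure_Pi_pmf_Pi[OF I(1)])
  also have "\<dots> = (\<Prod>x\<in>Pair j ` {..i}. prob (step_pmf K) (B x))"
    using I by (intro prod.mono_neutral_right) (auto simp: B_def image_iff)
  also have "\<dots> = (\<Prod>i'\<le>i. prob (step_pmf K) (B (j, i')))"
    by (subst prod.reindex) (auto simp: inj_on_def)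
  also have "\<dots> = (\<Prod>i'<i. prob (step_pmf K) (B (j, i'))) * prob (step_pmf K) (B (j, i))"
    by (simp add: lessThan_Suc_atMost[symmetric])
  also have "(\<Prod>i'<i. prob (step_pmf K) (B (j, i'))) = (\<Prod>i'<i. 1 - prob (step_pmf K) {a i'..})"
  proof (rule prod.cong)
    fix i' assume "i' \<in> {..<i}"
    then have "B (j, i') = UNIV - {a i'..}" by (auto simp: B_def)
    then show "prob (step_pmf K) (B (j, i')) = 1 - prob (step_pmf K) {a i'..}"
      using measure_pmf.prob_compl[of "{a i'..}" "step_pmf K"] by simp
  qed simp
  also have "B (j, i) = {a i..<b}" by (simp add: B_def)
  finally show ?thesis .
qed

text \<open>Two points are separated only if the first ball to reach one of them misses the other
  one. Given that it reaches one, the hazard rate bounds the chance that its radius stops within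
  \<open>\<delta>\<close>; summing over the first hit loses no factor \<open>n\<close>. Only the
  slack is multiplied by \<open>n\<close>, which the second condition on \<open>Z\<close>
  absorbs.\<close>

lemma cell_cut_prob:
  assumes tri: "\<And>i. \<bar>d (ctr j i) x - d (ctr j i) y\<bar> \<le> \<delta>"
    and I: "finite I" "\<And>i. i < n \<Longrightarrow> (j, i) \<in> I" and K: "0 < K" and R: "0 < R"
    and cover: "\<exists>i<n. d (ctr j i) x \<le> R * (1 / 2) ^ j" "\<exists>i<n. d (ctr j i) y \<le> R * (1 / 2) ^ j"
    and Z: "2 \<le> Z" "real n * exp (1 - Z\<^sup>2) \<le> 1"
  shows "prob (steps_pmf I K) {u. cell d R K ctr u j x \<noteq> cell d R K ctr u j y}
       \<le> 2 * rate Z * (\<delta> / (R * (1 / 2) ^ j) + 1 / real K)"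
proof -
  define \<rho> where "\<rho> = R * (1 / 2) ^ j"
  \<comment> \<open>The least value of the radius variable for which ball \<open>i\<close> contains
    \<open>z\<close>. For points within the base radius \<open>nat\<close> makes it 0.\<close>
  define thr where "thr z i = nat \<lceil>real K * (d (ctr j i) z / \<rho> - 1)\<rceil>" for z i
  have \<rho>: "0 < \<rho>" using R by (simp add: \<rho>_def)
  have thr: "d (ctr j i) z \<le> \<rho> * (1 + real g / real K) \<longleftrightarrow> thr z i \<le> g" for z i g
  proof -
    have "thr z i \<le> g \<longleftrightarrow> real K * (d (ctr j i) z / \<rho> - 1) \<le> real g"
      unfolding thr_def by (simp add: nat_ceiling_le_eq)
    also have "\<dots> \<longleftrightarrow> d (ctr j i) z \<le> \<rho> * (1 + real g / real K)"
      using \<rho> K by (simp add: field_simps)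
    finally show ?thesis by simp
  qed
  have cell_eq: "cell d R K ctr u j z = (LEAST i. thr z i \<le> u (j, i))" for z u
    unfolding cell_def \<rho>_def[symmetric] thr ..
  define a where "a i = min (thr x i) (thr y i)" for i
  define b where "b i = max (thr x i) (thr y i)" for i
  \<comment> \<open>Rounding up the two thresholds may cost one grid step, which becomes the term
    \<open>1 / real K\<close>.\<close>
  have ba: "real (b i - a i) \<le> real K * (\<delta> / \<rho>) + 1" for i
  proof -
    let ?f = "\<lambda>z. real K * (d (ctr j i) z / \<rho> - 1)"
    have "\<bar>?f x - ?f y\<bar> = real K * (\<bar>d (ctr j i) x - d (ctr j i) y\<bar> / \<rho>)"
      using \<rho> by (simp add: right_diff_distrib[symmetric] diff_divide_distrib[symmetric] abs_mult abs_divide)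
    also have "\<dots> \<le> real K * (\<delta> / \<rho>)"
      using tri \<rho> by (intro mult_left_mono divide_right_mono) auto
    finally have f: "\<bar>?f x - ?f y\<bar> \<le> real K * (\<delta> / \<rho>)" .
    have "real (thr z i) \<le> real (thr z' i) + (\<bar>?f x - ?f y\<bar> + 1)" if "{z, z'} = {x, y}" for z z'
    proof -
      have "?f z - ?f z' \<le> \<bar>?f x - ?f y\<bar>" using that by (metis abs_ge_self abs_minus_commute doubleton_eq_iff)
      then show ?thesis unfolding thr_def by linarith
    qed
    from this[of x y] this[of y x] f show ?thesis
      unfolding a_def b_def by (auto simp: of_nat_diff min_def max_def insert_commute)
  qed
  let ?P = "prob (step_pmf K)"
  let ?\<eta> = "\<delta> / \<rho> + 1 / real K"
  have \<eta>0: "0 \<le> ?\<eta>"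
    using tri[of 0] \<rho> by (intro add_nonneg_nonneg divide_nonneg_nonneg) auto
  have one: "?P {a i..<b i} \<le> ?\<eta> * (rate Z * ?P {a i..} + slack Z)" for i
  proof -
    have c: "0 \<le> (rate Z * ?P {a i..} + slack Z) / real K"
      using Z by (intro divide_nonneg_nonneg add_nonneg_nonneg mult_nonneg_nonneg)
        (auto simp: rate_nonneg slack_nonneg)
    have "?P {a i..<b i} \<le> real (b i - a i) * ((rate Z * ?P {a i..} + slack Z) / real K)"
      by (rule prob_step_pmf_interval_le[OF K Z(1)]) (simp add: a_def b_def)
    also have "\<dots> \<le> (real K * (\<delta> / \<rho>) + 1) * ((rate Z * ?P {a i..} + slack Z) / real K)"
      by (intro mult_right_mono ba c)
    also have "\<dots> = ?\<eta> * (rate Z * ?P {a i..} + slack Z)"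
      using K by (simp add: field_simps)
    finally show ?thesis .
  qed
  \<comment> \<open>Balls before \<open>i\<close> contain neither point, and ball \<open>i\<close>
    contains exactly one of them.\<close>
  define E where "E i = {u :: nat \<times> nat \<Rightarrow> nat. (\<forall>i'<i. u (j, i') < a i') \<and> a i \<le> u (j, i) \<and> u (j, i) < b i}" for i
  have "{u. cell d R K ctr u j x \<noteq> cell d R K ctr u j y} \<subseteq> (\<Union>i<n. E i)"
  proof
    fix u assume "u \<in> {u. cell d R K ctr u j x \<noteq> cell d R K ctr u j y}"
    then have ne: "cell d R K ctr u j x \<noteq> cell d R K ctr u j y" by simp
    have zero: "thr z i \<le> u (j, i)" if "d (ctr j i) z \<le> R * (1 / 2) ^ j" for z i
      using that thr[of i z 0] by (simp add: \<rho>_def)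
    have ex: "\<exists>i<n. thr z i \<le> u (j, i)" if "z \<in> {x, y}" for z
      using that cover zero by blast
    have main: "\<exists>i<n. u \<in> E i" if zz: "{z, z'} = {x, y}" and lt: "cell d R K ctr u j z < cell d R K ctr u j z'" for z z'
    proof -
      let ?i = "cell d R K ctr u j z"
      obtain i0 where i0: "i0 < n" "thr z i0 \<le> u (j, i0)" using ex[of z] zz by blast
      have hit: "thr z ?i \<le> u (j, ?i)" unfolding cell_eq by (rule LeastI[of _ i0]) (rule i0)
      have "?i \<le> i0" unfolding cell_eq by (rule Least_le) (rule i0)
      then have "?i < n" using i0 by simp
      have miss: "\<not> thr z i' \<le> u (j, i')" if "i' < ?i" for i'
        using that unfolding cell_eq by (rule not_less_Least)
      have miss': "\<not> thr z' i' \<le> u (j, i')" if "i' < cell d R K ctr u j z'" for i'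
        using that unfolding cell_eq by (rule not_less_Least)
      have ab: "a i = min (thr z i) (thr z' i)" "b i = max (thr z i) (thr z' i)" for i
        using zz by (auto simp: a_def b_def doubleton_eq_iff min.commute max.commute)
      have "u \<in> E ?i"
        unfolding E_def mem_Collect_eq ab
      proof (intro conjI allI impI)
        fix i' assume "i' < ?i"
        then show "u (j, i') < min (thr z i') (thr z' i')" using miss[of i'] miss'[of i'] lt by auto
      next
        show "min (thr z ?i) (thr z' ?i) \<le> u (j, ?i)" using hit by auto
        show "u (j, ?i) < max (thr z ?i) (thr z' ?i)" using miss'[OF lt] by auto
      qed
      with \<open>?i < n\<close> show ?thesis by blast
    qed
    show "u \<in> (\<Union>i<n. E i)"
      using main[of x y] main[of y x] ne by (auto simp: insert_commute neq_iff)
  qed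
  then have "prob (steps_pmf I K) {u. cell d R K ctr u j x \<noteq> cell d R K ctr u j y}
      \<le> prob (steps_pmf I K) (\<Union>i<n. E i)"
    by (intro measure_pmf.finite_measure_mono) auto
  also have "\<dots> \<le> (\<Sum>i<n. prob (steps_pmf I K) (E i))"
    by (intro measure_pmf.finite_measure_subadditive_finite) auto
  also have "\<dots> = (\<Sum>i<n. (\<Prod>i'<i. 1 - ?P {a i'..}) * ?P {a i..<b i})"
    unfolding E_def using I K by (intro sum.cong prob_first_hit) auto
  also have "\<dots> \<le> (\<Sum>i<n. (\<Prod>i'<i. 1 - ?P {a i'..}) * (?\<eta> * (rate Z * ?P {a i..} + slack Z)))"
    by (intro sum_mono mult_left_mono one prod_nonneg) (auto simp: measure_pmf.prob_le_1)
  also have "\<dots> \<le> (\<Sum>i<n. ?\<eta> * rate Z * ((\<Prod>i'<i. 1 - ?P {a i'..}) * ?P {a i..}) + ?\<eta> * slack Z)"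
  proof (intro sum_mono)
    fix i
    have "(\<Prod>i'<i. 1 - ?P {a i'..}) \<le> 1" by (intro prod_le_1) (auto simp: measure_pmf.prob_le_1)
    then have "(\<Prod>i'<i. 1 - ?P {a i'..}) * (?\<eta> * slack Z) \<le> 1 * (?\<eta> * slack Z)"
      using \<eta>0 Z by (intro mult_right_mono mult_nonneg_nonneg) (auto simp: slack_nonneg)
    then show "(\<Prod>i'<i. 1 - ?P {a i'..}) * (?\<eta> * (rate Z * ?P {a i..} + slack Z))
        \<le> ?\<eta> * rate Z * ((\<Prod>i'<i. 1 - ?P {a i'..}) * ?P {a i..}) + ?\<eta> * slack Z"
      by (simp add: algebra_simps)
  qed
  also have "\<dots> = ?\<eta> * rate Z * (\<Sum>i<n. (\<Prod>i'<i. 1 - ?P {a i'..}) * ?P {a i..}) + real n * (?\<eta> * slack Z)"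
    by (simp add: sum.distrib sum_distrib_left)
  also have "\<dots> \<le> ?\<eta> * rate Z * 1 + ?\<eta> * rate Z"
  proof (intro add_mono mult_left_mono first_hit_sum)
    show "0 \<le> ?\<eta> * rate Z" using \<eta>0 Z by (simp add: rate_nonneg)
    have "real n * slack Z = rate Z * (real n * exp (1 - Z\<^sup>2))"
      by (simp add: slack_def rate_def)
    also have "\<dots> \<le> rate Z * 1" using Z by (intro mult_left_mono) (auto simp: rate_nonneg)
    finally have "?\<eta> * (real n * slack Z) \<le> ?\<eta> * rate Z" using \<eta>0 by (intro mult_left_mono) auto
    then show "real n * (?\<eta> * slack Z) \<le> ?\<eta> * rate Z" by (simp add: mult_ac)
  qed (auto simp: measure_pmf.prob_le_1)
  finally show ?thesis by (simp add: \<rho>_def algebra_simps)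
qed

section \<open>Comparison of the given metric with the random cut metric\<close>

locale covered_space =
  fixes M :: "'p set" and d :: "'p \<Rightarrow> 'p \<Rightarrow> real" and R :: real and ctr :: "nat \<Rightarrow> nat \<Rightarrow> 'p"
    and n :: "nat \<Rightarrow> nat" and L K :: nat
  assumes d_nonneg: "x \<in> M \<Longrightarrow> y \<in> M \<Longrightarrow> 0 \<le> d x y"
    and d_sym: "x \<in> M \<Longrightarrow> y \<in> M \<Longrightarrow> d x y = d y x"
    and d_tri: "x \<in> M \<Longrightarrow> y \<in> M \<Longrightarrow> z \<in> M \<Longrightarrow> d x z \<le> d x y + d y z"
    and d_diam: "x \<in> M \<Longrightarrow> y \<in> M \<Longrightarrow> d x y \<le> 2 * R"
    and ctr: "ctr j i \<in> M"
    and cover: "j \<le> L \<Longrightarrow> x \<in> M \<Longrightarrow> \<exists>i<n j. d (ctr j i) x \<le> R * (1 / 2) ^ j"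
    and R_pos: "0 < R" and K_pos: "0 < K"
begin

definition ix :: "(nat \<times> nat) set" where
  "ix = {(j, i). j \<le> L \<and> i < n j}"

definition wt :: "nat \<Rightarrow> real" where
  "wt j = R * (1 / 2) ^ j"

definition lab :: "(nat \<times> nat \<Rightarrow> nat) \<Rightarrow> 'p \<Rightarrow> nat list" where
  "lab u = label d R K ctr L u"

lemma finite_ix: "finite ix"
proof -
  have "ix = (SIGMA j:{..L}. {..<n j})" by (auto simp: ix_def)
  then show ?thesis by simp
qed

lemma wt_pos: "0 < wt j" using R_pos by (simp add: wt_def)

lemma cell_less:
  assumes "j \<le> L" "x \<in> M"
  shows "cell d R K ctr u j x < n j"
    and "d (ctr j (cell d R K ctr u j x)) x \<le> R * (1 / 2) ^ j * (1 + real (u (j, cell d R K ctr u j x)) / real K)"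
proof -
  obtain i where i: "i < n j" "d (ctr j i) x \<le> R * (1 / 2) ^ j" using cover assms by blast
  have "R * (1 / 2) ^ j * 1 \<le> R * (1 / 2) ^ j * (1 + real (u (j, i)) / real K)"
    using R_pos by (intro mult_left_mono) auto
  then have hit: "d (ctr j i) x \<le> R * (1 / 2) ^ j * (1 + real (u (j, i)) / real K)"
    using i by simp
  have "cell d R K ctr u j x \<le> i" unfolding cell_def by (rule Least_le) (rule hit)
  then show "cell d R K ctr u j x < n j" using i by simp
  show "d (ctr j (cell d R K ctr u j x)) x \<le> R * (1 / 2) ^ j * (1 + real (u (j, cell d R K ctr u j x)) / real K)"
    unfolding cell_def by (rule LeastI) (rule hit)
qed

lemma lab_in_ix: "x \<in> M \<Longrightarrow> j \<le> L \<Longrightarrow> (j, lab u x ! j) \<in> ix"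
  by (simp add: lab_def label_nth ix_def cell_less)

lemma same_cell_dist:
  assumes "j \<le> L" "x \<in> M" "y \<in> M" and u: "\<And>z. u z < K" and eq: "lab u x ! j = lab u y ! j"
  shows "d x y \<le> 4 * wt j"
proof -
  let ?c = "ctr j (cell d R K ctr u j x)"
  have near: "d ?c z \<le> 2 * wt j" if "z \<in> M" "cell d R K ctr u j z = cell d R K ctr u j x" for z
  proof -
    have "d ?c z \<le> wt j * (1 + real (u (j, cell d R K ctr u j z)) / real K)"
      using cell_less(2)[of j z u] assms(1) that by (simp add: wt_def)
    also have "\<dots> \<le> wt j * (1 + 1)"
      using u[of "(j, cell d R K ctr u j z)"] wt_pos[of j] by (intro mult_left_mono add_left_mono) auto
    finally show ?thesis by simp
  qed
  have "d x y \<le> d x ?c + d ?c y" using assms ctr by (intro d_tri) auto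
  then show ?thesis
    using near[of x] near[of y] assms eq ctr d_sym[of x ?c] by (simp add: lab_def label_nth)
qed

text \<open>At the level before the first separation the points share a cell of diameter
  \<open>4 * wt (j - 1) = 8 * wt j\<close>, and \<open>wt j\<close> is part of the cut distance.
  Without any separation only the finest cell bounds the distance. No nesting of the partitions is
  needed.\<close>

lemma dist_le_cut_dist:
  assumes "x \<in> M" "y \<in> M" and u: "\<And>z. u z < K"
  shows "d x y \<le> 8 * cut_dist wt L (lab u x) (lab u y) + 4 * wt L"
proof (cases "\<forall>j\<le>L. lab u x ! j = lab u y ! j")
  case True
  then have "d x y \<le> 4 * wt L" using assms by (intro same_cell_dist) auto
  moreover have "0 \<le> cut_dist wt L (lab u x) (lab u y)"
    by (intro cut_dist_nonneg) (simp add: wt_pos less_imp_le)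
  ultimately show ?thesis by simp
next
  case False
  define j where "j = (LEAST j. lab u x ! j \<noteq> lab u y ! j)"
  obtain j0 where j0: "j0 \<le> L" "lab u x ! j0 \<noteq> lab u y ! j0" using False by auto
  have j: "lab u x ! j \<noteq> lab u y ! j" unfolding j_def by (rule LeastI[of _ j0]) (rule j0)
  have "j \<le> j0" unfolding j_def by (rule Least_le) (rule j0)
  then have jL: "j \<le> L" using j0 by simp
  have "wt j = wt j * of_bool (lab u x ! j \<noteq> lab u y ! j)" using j by simp
  also have "\<dots> \<le> cut_dist wt L (lab u x) (lab u y)"
    unfolding cut_dist_def using jL
    by (intro member_le_sum[where f = "\<lambda>j. wt j * of_bool (lab u x ! j \<noteq> lab u y ! j)"])
      (auto simp: wt_pos less_imp_le)
  finally have le: "wt j \<le> cut_dist wt L (lab u x) (lab u y)" .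
  have "d x y \<le> 8 * wt j"
  proof (cases j)
    case 0
    then show ?thesis using d_diam[OF assms(1,2)] R_pos by (simp add: wt_def)
  next
    case (Suc j')
    then have "lab u x ! j' = lab u y ! j'" using not_less_Least[of j' "\<lambda>j. lab u x ! j \<noteq> lab u y ! j"] by (simp add: j_def)
    then have "d x y \<le> 4 * wt j'" using jL Suc assms by (intro same_cell_dist) auto
    then show ?thesis by (simp add: wt_def Suc)
  qed
  then show ?thesis using le wt_pos[of L] by simp
qed

text \<open>The weight of a level cancels the scale in its cutting probability, so each of the
  levels up to \<open>J\<close> contributes the same multiple of \<open>d x y\<close>. Only nets of
  these levels enter the condition on \<open>Z\<close>.\<close>

lemma expected_cut_dist:
  assumes x: "x \<in> M" and y: "y \<in> M" and J: "J \<le> L" and Z: "2 \<le> Z"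
    and n: "\<And>j. j \<le> J \<Longrightarrow> real (n j) * exp (1 - Z\<^sup>2) \<le> 1"
  shows "expect (steps_pmf ix K) (\<lambda>u. cut_dist wt L (lab u x) (lab u y))
       \<le> 2 * real (J + 1) * rate Z * d x y + 4 * R * rate Z / real K + R * (1 / 2) ^ J"
proof -
  let ?P = "steps_pmf ix K"
  let ?p = "\<lambda>j. prob ?P {u. lab u x ! j \<noteq> lab u y ! j}"
  have fin: "finite (set_pmf ?P)" using finite_ix K_pos by (simp add: finite_set_steps_pmf)
  have r0: "0 \<le> rate Z" using Z by (simp add: rate_nonneg)
  have sumJ: "(\<Sum>j\<le>J. wt j) \<le> 2 * R"
    using sum_half_powers[of 0 "Suc J"] R_pos
    by (simp add: wt_def sum_distrib_left[symmetric] atLeast0LessThan lessThan_Suc_atMost)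
  have sumJ': "(\<Sum>j\<in>{Suc J..L}. wt j) \<le> R * (1/2) ^ J"
    using sum_half_powers[of "Suc J" "Suc L"] R_pos
    by (simp add: wt_def sum_distrib_left[symmetric] atLeastLessThanSuc_atLeastAtMost)
  have ind: "expect ?P (\<lambda>u. of_bool (lab u x ! j \<noteq> lab u y ! j)) = ?p j" for j
  proof -
    have "(\<lambda>u. of_bool (lab u x ! j \<noteq> lab u y ! j) :: real) = indicator {u. lab u x ! j \<noteq> lab u y ! j}"
      by (auto simp: indicator_def fun_eq_iff)
    then show ?thesis by simp
  qed
  have "expect ?P (\<lambda>u. cut_dist wt L (lab u x) (lab u y)) = (\<Sum>j\<le>L. wt j * ?p j)"
    unfolding cut_dist_def
    by (subst Bochner_Integration.integral_sum[OF integrable_measure_pmf_finite[OF fin]])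
       (simp only: integral_mult_right_zero ind)
  also have "{..L} = {..J} \<union> {Suc J..L}" using J by auto
  also have "(\<Sum>j\<in>{..J} \<union> {Suc J..L}. wt j * ?p j) = (\<Sum>j\<le>J. wt j * ?p j) + (\<Sum>j\<in>{Suc J..L}. wt j * ?p j)"
    by (rule sum.union_disjoint) auto
  also have "(\<Sum>j\<in>{Suc J..L}. wt j * ?p j) \<le> (\<Sum>j\<in>{Suc J..L}. wt j * 1)"
    by (intro sum_mono mult_left_mono) (auto simp: wt_pos less_imp_le measure_pmf.prob_le_1)
  also have "\<dots> \<le> R * (1/2) ^ J" using sumJ' by simp
  also have "(\<Sum>j\<le>J. wt j * ?p j) \<le> (\<Sum>j\<le>J. 2 * rate Z * d x y + wt j * (2 * rate Z / real K))"
  proof (intro sum_mono)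
    fix j assume "j \<in> {..J}"
    then have j: "j \<le> J" "j \<le> L" using J by auto
    have "?p j = prob ?P {u. cell d R K ctr u j x \<noteq> cell d R K ctr u j y}"
      using j by (simp add: lab_def label_nth)
    also have "\<dots> \<le> 2 * rate Z * (d x y / (R * (1 / 2) ^ j) + 1 / real K)"
    proof (rule cell_cut_prob[where n = "n j"])
      show "\<bar>d (ctr j i) x - d (ctr j i) y\<bar> \<le> d x y" for i
        using d_tri[OF ctr x y, of j i] d_tri[OF ctr y x, of j i] d_sym[OF x y] by linarith
      show "(j, i) \<in> ix" if "i < n j" for i using that j by (simp add: ix_def)
    qed (use finite_ix K_pos R_pos cover j x y Z n in auto)
    finally have "wt j * ?p j \<le> wt j * (2 * rate Z * (d x y / wt j + 1 / real K))"
      unfolding wt_def[symmetric] by (rule mult_left_mono) (simp add: wt_pos less_imp_le)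
    also have "\<dots> = 2 * rate Z * d x y + wt j * (2 * rate Z / real K)"
      using wt_pos[of j] by (simp add: field_simps)
    finally show "wt j * ?p j \<le> 2 * rate Z * d x y + wt j * (2 * rate Z / real K)" .
  qed
  also have "\<dots> = 2 * real (J + 1) * rate Z * d x y + (\<Sum>j\<le>J. wt j) * (2 * rate Z / real K)"
    by (simp only: sum.distrib sum_distrib_right[symmetric] sum_constant card_atMost) (simp add: algebra_simps)
  also have "(\<Sum>j\<le>J. wt j) * (2 * rate Z / real K) \<le> 2 * R * (2 * rate Z / real K)"
    using sumJ r0 by (intro mult_right_mono) auto
  finally show ?thesis by (simp add: mult_ac)
qed

definition online_taxi ::
    "nat \<Rightarrow> (nat \<times> nat \<Rightarrow> nat) \<times> (nat \<times> nat \<Rightarrow> nat) \<Rightarrow> (nat \<Rightarrow> 'p) \<Rightarrow> (nat \<Rightarrow> 'p) \<Rightarrow> nat \<Rightarrow> nat" where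
  "online_taxi k s q A =
     perturbed_taxi wt L K k (\<lambda>i. lab (fst s) (q i)) (\<lambda>i. lab (fst s) (A i)) (snd s)"

definition seeds :: "((nat \<times> nat \<Rightarrow> nat) \<times> (nat \<times> nat \<Rightarrow> nat)) pmf" where
  "seeds = pair_pmf (steps_pmf ix K) (steps_pmf ix K)"

lemma finite_set_seeds: "finite (set_pmf seeds)"
  using finite_ix K_pos by (simp add: seeds_def finite_set_steps_pmf)

text \<open>The factor 16 is the 8 of \<open>dist_le_cut_dist\<close> times the 2 of
  \<open>cell_cut_prob\<close>. There are separate thresholds: \<open>Y\<close> for the cells must
  beat the number of centers, while the smaller \<open>Z\<close> for terminal costs need not, as the
  analysis of one request and level involves a single noise variable.\<close>

lemma online_taxi_cost:
  assumes k: "0 < k" and q: "\<And>s. s < k + T \<Longrightarrow> q s \<in> M" and A: "\<And>t. t < T \<Longrightarrow> A t \<in> M"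
    and c: "c \<in> {..<T} \<rightarrow> {..<k}" and J: "J \<le> L" and Z: "2 \<le> Z" and Y: "2 \<le> Y"
    and n: "\<And>j. j \<le> J \<Longrightarrow> real (n j) * exp (1 - Y\<^sup>2) \<le> 1"
  shows "expect seeds
           (\<lambda>s. \<Sum>t<T. d (q (src k (online_taxi k s q A) t (online_taxi k s q A t))) (A t))
       \<le> 16 * (real (J + 1))\<^sup>2 * rate Z * rate Y * (\<Sum>t<T. d (q (src k c t (c t))) (A t))
         + real T * R * (8 * real (J + 1) * rate Z * ((4 * rate Y + real k + 1) / real K + (1 / 2) ^ J)
             + 16 * slack Z + 12 * (1 / 2) ^ J)
         + 16 * real (J + 1) * rate Z * real k * R"
proof -
  let ?P = "steps_pmf ix K"
  let ?E = "expect ?P"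
  let ?q = "\<lambda>u i. lab u (q i)" and ?A = "\<lambda>u i. lab u (A i)"
  let ?run = "\<lambda>u v t. run_label wt L K k (?q u) (?A u) t v"
  let ?dt = "\<lambda>t. d (q (src k c t (c t))) (A t)"
  let ?tree = "\<lambda>u. \<Sum>t<T. cut_dist wt L (?q u (src k c t (c t))) (?A u t)"
  have fin: "finite (set_pmf ?P)" using finite_ix K_pos by (simp add: finite_set_steps_pmf)
  note int[simp] = integrable_measure_pmf_finite[OF fin]
  have r0: "0 \<le> rate Z" "0 \<le> rate Y" using Z Y by (auto simp: rate_nonneg)
  have qM: "q (src k c' t (c' t)) \<in> M" if "t < T" "c' \<in> {..<T} \<rightarrow> {..<k}" for c' t
    using src_less[OF that(2,1)] that(1) by (intro q) simp
  define B1 where "B1 = real (J + 1) * rate Z"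
  have B1: "0 \<le> B1" using r0 by (simp add: B1_def)
  define B2 where "B2 = B1 * (R * (real k + 1) / real K) + 2 * R * slack Z + R * (1 / 2) ^ J"
  have real_cost: "(\<Sum>t<T. d (q (src k (online_taxi k (u, v) q A) t (online_taxi k (u, v) q A t))) (A t))
      \<le> 8 * (\<Sum>t<T. cut_dist wt L (?run u v t) (?A u t)) + real T * (4 * wt L)"
    if u: "u \<in> set_pmf ?P" for u v
  proof -
    have u': "u z < K" for z using set_steps_pmf_less[OF finite_ix K_pos u] .
    have less: "online_taxi k (u, v) q A \<in> {..<T} \<rightarrow> {..<k}"
      by (simp add: online_taxi_def perturbed_taxi_def alg_taxi_less[OF k])
    have "(\<Sum>t<T. d (q (src k (online_taxi k (u, v) q A) t (online_taxi k (u, v) q A t))) (A t))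
        \<le> (\<Sum>t<T. 8 * cut_dist wt L (?run u v t) (?A u t) + 4 * wt L)"
    proof (rule sum_mono)
      fix t assume "t \<in> {..<T}"
      then have t: "t < T" by simp
      have "?run u v t = lab u (q (src k (online_taxi k (u, v) q A) t (online_taxi k (u, v) q A t)))"
        by (simp add: run_label_def online_taxi_def)
      then show "d (q (src k (online_taxi k (u, v) q A) t (online_taxi k (u, v) q A t))) (A t)
          \<le> 8 * cut_dist wt L (?run u v t) (?A u t) + 4 * wt L"
        using dist_le_cut_dist[OF qM[OF t less] A[OF t] u'] by simp
    qed
    then show ?thesis by (simp add: sum.distrib sum_distrib_left)
  qed
  have tree_cost: "?E (\<lambda>v. \<Sum>t<T. cut_dist wt L (?run u v t) (?A u t)) \<le> B1 * (?tree u + 2 * real k * R) + real T * B2" for u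
    unfolding B1_def B2_def
    by (rule perturbed_taxi_cost[OF k R_pos _ K_pos Z finite_ix _ _ c J])
       (auto simp: fun_eq_iff wt_def intro!: lab_in_ix q A)
  have "expect seeds
          (\<lambda>s. \<Sum>t<T. d (q (src k (online_taxi k s q A) t (online_taxi k s q A t))) (A t))
      = ?E (\<lambda>u. ?E (\<lambda>v. \<Sum>t<T. d (q (src k (online_taxi k (u, v) q A) t (online_taxi k (u, v) q A t))) (A t)))"
    unfolding seeds_def by (rule expectation_pair_finite[OF fin fin])
  also have "\<dots> \<le> ?E (\<lambda>u. ?E (\<lambda>v. 8 * (\<Sum>t<T. cut_dist wt L (?run u v t) (?A u t)) + real T * (4 * wt L)))"
    by (intro expectation_mono_finite[OF fin] real_cost)
  also have "\<dots> = ?E (\<lambda>u. 8 * ?E (\<lambda>v. \<Sum>t<T. cut_dist wt L (?run u v t) (?A u t)) + real T * (4 * wt L))"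
    by simp
  also have "\<dots> \<le> ?E (\<lambda>u. 8 * (B1 * (?tree u + 2 * real k * R) + real T * B2) + real T * (4 * wt L))"
    by (intro expectation_mono_finite[OF fin] add_right_mono mult_left_mono tree_cost) auto
  also have "\<dots> = 8 * (B1 * (?E ?tree + 2 * real k * R) + real T * B2) + real T * (4 * wt L)"
    by simp
  also have "?E ?tree = (\<Sum>t<T. ?E (\<lambda>u. cut_dist wt L (?q u (src k c t (c t))) (?A u t)))"
    by simp
  also have "\<dots> \<le> (\<Sum>t<T. 2 * real (J + 1) * rate Y * ?dt t + (4 * R * rate Y / real K + R * (1 / 2) ^ J))"
    using expected_cut_dist[OF qM[OF _ c] A J Y n] by (intro sum_mono) (simp add: add.assoc)
  also have "\<dots> = 2 * real (J + 1) * rate Y * (\<Sum>t<T. ?dt t) + real T * (4 * R * rate Y / real K + R * (1 / 2) ^ J)"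
    by (simp only: sum.distrib sum_distrib_left[symmetric] sum_constant card_lessThan) (simp add: algebra_simps)
  also have "wt L \<le> R * (1/2) ^ J"
    unfolding wt_def using J R_pos by (intro mult_left_mono power_decreasing) auto
  finally have "expect seeds
          (\<lambda>s. \<Sum>t<T. d (q (src k (online_taxi k s q A) t (online_taxi k s q A t))) (A t))
      \<le> 8 * (B1 * (2 * real (J + 1) * rate Y * (\<Sum>t<T. ?dt t) + real T * (4 * R * rate Y / real K + R * (1 / 2) ^ J)
          + 2 * real k * R) + real T * B2) + real T * (4 * (R * (1/2) ^ J))"
    using B1 by (simp add: mult_left_mono)
  also have "\<dots> = 16 * (real (J + 1))\<^sup>2 * rate Z * rate Y * (\<Sum>t<T. ?dt t)
         + real T * R * (8 * real (J + 1) * rate Z * ((4 * rate Y + real k + 1) / real K + (1 / 2) ^ J)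
             + 16 * slack Z + 12 * (1 / 2) ^ J)
         + 16 * real (J + 1) * rate Z * real k * R"
    unfolding B2_def B1_def by (simp add: algebra_simps add_divide_distrib power2_eq_square)
  finally show ?thesis .
qed

end

section \<open>Volume and nets in normed spaces\<close>

text \<open>Every function of a list of countable data is measurable, so a quantity that factors
  through such a list needs no further argument. It is applied to the norm and to the labels of
  requests.\<close>

lemma measurable_map_upt:
  fixes f :: "nat \<Rightarrow> 'a \<Rightarrow> 'b::countable"
  assumes "\<And>i. i < n \<Longrightarrow> f i \<in> measurable M (count_space UNIV)"
  shows "(\<lambda>x. map (\<lambda>i. f i x) [0..<n]) \<in> measurable M (count_space UNIV)"
  using assms
proof (induction n)
  case (Suc n)
  have f: "f n \<in> measurable M (count_space UNIV)" using Suc.prems by simp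
  have IH: "(\<lambda>x. map (\<lambda>i. f i x) [0..<n]) \<in> measurable M (count_space UNIV)"
    using Suc by simp
  have "(\<lambda>x. l @ [f n x]) \<in> measurable M (count_space UNIV)" for l
    using measurable_compose[OF f, of "\<lambda>y. l @ [y]" "count_space UNIV"] by simp
  from measurable_compose_countable[OF this IH] show ?case by simp
qed simp

locale norm_space =
  fixes m :: nat and N :: "point \<Rightarrow> real"
  assumes norm: "is_norm m N"
begin

lemma space_vol: "Rn m = extensional {..<m}"
  by (simp add: vol_def space_PiM PiE_def)

lemma restrict_Rn [simp]: "restrict f {..<m} \<in> Rn m"
  by (simp add: space_vol)

lemma N_nonneg: "x \<in> Rn m \<Longrightarrow> 0 \<le> N x"
  and N_zero: "N (\<lambda>i\<in>{..<m}. 0) = 0"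
  and N_scale: "x \<in> Rn m \<Longrightarrow> N (\<lambda>i\<in>{..<m}. a * x i) = \<bar>a\<bar> * N x"
  and N_add: "x \<in> Rn m \<Longrightarrow> y \<in> Rn m \<Longrightarrow> N (\<lambda>i\<in>{..<m}. x i + y i) \<le> N x + N y"
  using norm unfolding is_norm_def by (auto simp: space_vol)

lemma ndist_nonneg: "0 \<le> ndist m N x y"
  by (simp add: ndist_def N_nonneg)

lemma ndist_self: "ndist m N x x = 0"
  by (simp add: ndist_def N_zero)

lemma ndist_sym: "ndist m N x y = ndist m N y x"
proof -
  have "(\<lambda>i\<in>{..<m}. x i - y i) = (\<lambda>i\<in>{..<m}. (- 1) * (\<lambda>i\<in>{..<m}. y i - x i) i)"
    by (auto simp: restrict_def)
  then show ?thesis unfolding ndist_def by (simp only: N_scale restrict_Rn)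
qed

lemma ndist_triangle: "ndist m N x z \<le> ndist m N x y + ndist m N y z"
proof -
  have "(\<lambda>i\<in>{..<m}. x i - z i) = (\<lambda>i\<in>{..<m}. (\<lambda>i\<in>{..<m}. x i - y i) i + (\<lambda>i\<in>{..<m}. y i - z i) i)"
    by (auto simp: restrict_def)
  then show ?thesis unfolding ndist_def using N_add[of "\<lambda>i\<in>{..<m}. x i - y i" "\<lambda>i\<in>{..<m}. y i - z i"] by simp
qed

lemma N_le_sum:
  assumes "x \<in> Rn m"
  shows "N x \<le> (\<Sum>i<m. \<bar>x i\<bar> * N (\<lambda>j\<in>{..<m}. if j = i then 1 else 0))"
proof -
  let ?e = "\<lambda>i. \<lambda>j\<in>{..<m}. if j = i then 1 else (0::real)"
  have "N (\<lambda>j\<in>{..<m}. if j < p then x j else 0) \<le> (\<Sum>i<p. \<bar>x i\<bar> * N (?e i))" for p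
  proof (induction p)
    case 0
    have "(\<lambda>j\<in>{..<m}. if j < 0 then x j else 0) = (\<lambda>j\<in>{..<m}. 0)" by (rule restrict_ext) simp
    then have "N (\<lambda>j\<in>{..<m}. if j < 0 then x j else 0) = 0" by (simp only: N_zero)
    then show ?case unfolding lessThan_0 sum.empty by linarith
  next
    case (Suc p)
    have "(\<lambda>j\<in>{..<m}. if j < Suc p then x j else 0)
        = (\<lambda>j\<in>{..<m}. (\<lambda>j\<in>{..<m}. if j < p then x j else 0) j + (\<lambda>j\<in>{..<m}. x p * ?e p j) j)"
      by (auto simp: restrict_def fun_eq_iff less_Suc_eq)
    then have "N (\<lambda>j\<in>{..<m}. if j < Suc p then x j else 0)
        = N (\<lambda>j\<in>{..<m}. (\<lambda>j\<in>{..<m}. if j < p then x j else 0) j + (\<lambda>j\<in>{..<m}. x p * ?e p j) j)"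
      by (rule arg_cong)
    also have "\<dots> \<le> N (\<lambda>j\<in>{..<m}. if j < p then x j else 0) + N (\<lambda>j\<in>{..<m}. x p * ?e p j)"
      by (rule N_add) (rule restrict_Rn)+
    also have "N (\<lambda>j\<in>{..<m}. x p * ?e p j) = \<bar>x p\<bar> * N (?e p)"
      by (rule N_scale) (rule restrict_Rn)
    finally show ?case using Suc unfolding sum.lessThan_Suc by linarith
  qed
  from this[of m] have "N (\<lambda>j\<in>{..<m}. if j < m then x j else 0) \<le> (\<Sum>i<m. \<bar>x i\<bar> * N (?e i))" .
  also have "(\<lambda>j\<in>{..<m}. if j < m then x j else 0) = x"
    using assms by (auto simp: space_vol extensional_def fun_eq_iff restrict_def)
  finally show ?thesis .
qed

lemma N_diff_le:
  assumes "x \<in> Rn m" "y \<in> Rn m"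
  shows "\<bar>N x - N y\<bar> \<le> ndist m N x y"
proof -
  have *: "N x \<le> ndist m N x y + N y" if "x \<in> Rn m" "y \<in> Rn m" for x y
  proof -
    have "x = (\<lambda>i\<in>{..<m}. (\<lambda>i\<in>{..<m}. x i - y i) i + y i)"
      using that by (auto simp: space_vol extensional_def fun_eq_iff restrict_def)
    then show ?thesis unfolding ndist_def using N_add[of "\<lambda>i\<in>{..<m}. x i - y i" y] that by simp
  qed
  show ?thesis using *[OF assms] *[OF assms(2,1)] ndist_sym[of x y] by linarith
qed

text \<open>Rounding the coordinates down to multiples of \<open>1 / Suc n\<close> makes the norm a
  function of a list of integers, hence measurable; by \<open>N_le_sum\<close> the rounded norms
  converge to the norm.\<close>

lemma measurable_N [measurable]: "N \<in> borel_measurable (vol m)"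
proof (rule borel_measurable_LIMSEQ_real)
  let ?\<phi> = "\<lambda>n x. \<lambda>i\<in>{..<m}. real_of_int \<lfloor>x i * real (Suc n)\<rfloor> / real (Suc n)"
  fix n
  have comp: "(\<lambda>x. \<lfloor>x i * real (Suc n)\<rfloor>) \<in> measurable (vol m) (count_space UNIV)" if "i < m" for i
  proof -
    have "i \<in> {..<m}" using that by simp
    then have "(\<lambda>x. x i) \<in> borel_measurable (vol m)" unfolding vol_def by measurable
    moreover have "(\<lambda>y::real. \<lfloor>y * real (Suc n)\<rfloor>) \<in> measurable borel (count_space UNIV)" by measurable
    ultimately show ?thesis by (rule measurable_compose)
  qed
  have "(\<lambda>x. map (\<lambda>i. \<lfloor>x i * real (Suc n)\<rfloor>) [0..<m]) \<in> measurable (vol m) (count_space UNIV)"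
    by (rule measurable_map_upt) (rule comp)
  from measurable_compose[OF this, of "\<lambda>l. N (\<lambda>i\<in>{..<m}. real_of_int (l ! i) / real (Suc n))" borel]
  have "(\<lambda>x. N (\<lambda>i\<in>{..<m}. real_of_int (map (\<lambda>i. \<lfloor>x i * real (Suc n)\<rfloor>) [0..<m] ! i) / real (Suc n))) \<in> borel_measurable (vol m)"
    by simp
  also have "(\<lambda>x. N (\<lambda>i\<in>{..<m}. real_of_int (map (\<lambda>i. \<lfloor>x i * real (Suc n)\<rfloor>) [0..<m] ! i) / real (Suc n))) = (\<lambda>x. N (?\<phi> n x))"
    by (intro ext arg_cong[of _ _ N] restrict_ext) simp
  finally show "(\<lambda>x. N (?\<phi> n x)) \<in> borel_measurable (vol m)" .
next
  let ?\<phi> = "\<lambda>n x. \<lambda>i\<in>{..<m}. real_of_int \<lfloor>x i * real (Suc n)\<rfloor> / real (Suc n)"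
  let ?C = "\<Sum>i<m. N (\<lambda>j\<in>{..<m}. if j = i then 1 else 0)"
  fix x assume x: "x \<in> Rn m"
  have bound: "\<bar>N (?\<phi> n x) - N x\<bar> \<le> ?C * inverse (real (Suc n))" for n
  proof -
    have frac: "\<bar>x i - ?\<phi> n x i\<bar> \<le> inverse (real (Suc n))" if "i < m" for i
    proof -
      have "\<bar>x i * real (Suc n) - real_of_int \<lfloor>x i * real (Suc n)\<rfloor>\<bar> \<le> 1" by linarith
      then have "\<bar>x i * real (Suc n) - real_of_int \<lfloor>x i * real (Suc n)\<rfloor>\<bar> / real (Suc n) \<le> 1 / real (Suc n)"
        by (intro divide_right_mono) auto
      also have "\<bar>x i * real (Suc n) - real_of_int \<lfloor>x i * real (Suc n)\<rfloor>\<bar> / real (Suc n)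
          = \<bar>(x i * real (Suc n) - real_of_int \<lfloor>x i * real (Suc n)\<rfloor>) / real (Suc n)\<bar>"
        by (simp add: abs_divide)
      also have "(x i * real (Suc n) - real_of_int \<lfloor>x i * real (Suc n)\<rfloor>) / real (Suc n) = x i - ?\<phi> n x i"
        using that by (simp add: diff_divide_distrib del: of_nat_Suc)
      finally show ?thesis by (simp add: inverse_eq_divide)
    qed
    have "\<bar>N (?\<phi> n x) - N x\<bar> \<le> ndist m N x (?\<phi> n x)"
      using N_diff_le[of x "?\<phi> n x"] x by (simp add: abs_minus_commute)
    also have "\<dots> \<le> (\<Sum>i<m. \<bar>(\<lambda>i\<in>{..<m}. x i - ?\<phi> n x i) i\<bar> * N (\<lambda>j\<in>{..<m}. if j = i then 1 else 0))"
      unfolding ndist_def by (rule N_le_sum) simp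
    also have "\<dots> \<le> (\<Sum>i<m. inverse (real (Suc n)) * N (\<lambda>j\<in>{..<m}. if j = i then 1 else 0))"
    proof (intro sum_mono mult_right_mono)
      fix i assume "i \<in> {..<m}"
      then show "\<bar>(\<lambda>i\<in>{..<m}. x i - ?\<phi> n x i) i\<bar> \<le> inverse (real (Suc n))"
        using frac[of i] by simp
    qed (simp add: N_nonneg)
    finally show ?thesis by (simp add: sum_distrib_left mult.commute)
  qed
  have "(\<lambda>n. ?C * inverse (real (Suc n))) \<longlonglongrightarrow> ?C * 0"
    by (intro tendsto_mult tendsto_const LIMSEQ_inverse_real_of_nat)
  then have lim: "(\<lambda>n. ?C * inverse (real (Suc n))) \<longlonglongrightarrow> 0"
    unfolding mult_zero_right .
  have "\<forall>\<^sub>F n in sequentially. norm (N (?\<phi> n x) - N x) \<le> ?C * inverse (real (Suc n))"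
    by (intro always_eventually allI) (unfold real_norm_def, rule bound)
  from Lim_null_comparison[OF this lim]
  show "(\<lambda>n. N (?\<phi> n x)) \<longlonglongrightarrow> N x"
    by (rule LIM_zero_cancel)
qed

lemma measurable_ndist [measurable]:
  assumes [measurable]: "f \<in> measurable Q (vol m)" "g \<in> measurable Q (vol m)"
  shows "(\<lambda>x. ndist m N (f x) (g x)) \<in> borel_measurable Q"
proof -
  have "(\<lambda>x. \<lambda>i\<in>{..<m}. f x i - g x i) \<in> measurable Q (vol m)"
    unfolding vol_def
  proof (rule measurable_restrict)
    fix i assume i: "i \<in> {..<m}"
    have "(\<lambda>x. x i) \<in> borel_measurable (vol m)" using i unfolding vol_def by measurable
    then have "(\<lambda>x. f x i) \<in> borel_measurable Q" "(\<lambda>x. g x i) \<in> borel_measurable Q"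
      using measurable_compose assms by blast+
    then show "(\<lambda>x. f x i - g x i) \<in> measurable Q lborel" by simp
  qed
  from measurable_compose[OF this measurable_N] show ?thesis by (simp add: ndist_def)
qed

lemma sets_closed_ball [measurable]: "z \<in> Rn m \<Longrightarrow> closed_ball m N z \<rho> \<in> sets (vol m)"
proof -
  assume "z \<in> Rn m"
  then have [measurable]: "(\<lambda>x. ndist m N z x) \<in> borel_measurable (vol m)"
    by (intro measurable_ndist) auto
  show ?thesis unfolding closed_ball_def by measurable
qed

lemma vol_affine:
  assumes z: "z \<in> Rn m" and s: "0 < s"
  defines "S \<equiv> (\<lambda>x. \<lambda>i\<in>{..<m}. z i + s * x i)"
  shows "scale_measure (ennreal (s ^ m)) (distr (vol m) (vol m) S) = vol m"
proof -
  interpret product_sigma_finite "\<lambda>_::nat. lborel :: real measure" ..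
  have S: "S \<in> measurable (vol m) (vol m)"
    unfolding S_def vol_def by measurable
  have "scale_measure (ennreal (s ^ m)) (distr (vol m) (vol m) S) = PiM {..<m} (\<lambda>_. lborel)"
  proof (rule PiM_eqI)
    show "sets (scale_measure (ennreal (s ^ m)) (distr (vol m) (vol m) S)) = sets (PiM {..<m} (\<lambda>_. lborel))"
      by (simp add: vol_def)
    fix A :: "nat \<Rightarrow> real set" assume A: "\<And>i. i \<in> {..<m} \<Longrightarrow> A i \<in> sets lborel"
    have box: "PiE {..<m} A \<in> sets (vol m)"
      unfolding vol_def using A by (intro sets_PiM_I_finite) auto
    have pre: "S -` PiE {..<m} A \<inter> Rn m = PiE {..<m} (\<lambda>i. (\<lambda>x. z i + s * x) -` A i)"
    proof -
      have "S x \<in> PiE {..<m} A \<longleftrightarrow> (\<forall>i<m. z i + s * x i \<in> A i)" for x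
        by (simp add: S_def PiE_iff Ball_def)
      then show ?thesis unfolding space_vol by (auto simp: PiE_def Pi_def)
    qed
    have A': "(\<lambda>x. z i + s * x) -` A i \<in> sets lborel" if "i < m" for i
    proof -
      have "(\<lambda>x. z i + s * x) \<in> borel_measurable borel" by measurable
      from measurable_sets[OF this, of "A i"] show ?thesis using A that by simp
    qed
    have one: "emeasure lborel (A i) = ennreal s * emeasure lborel ((\<lambda>x. z i + s * x) -` A i)" if "i < m" for i
    proof -
      have Ai: "A i \<in> sets borel" using A that by simp
      have "emeasure lborel (A i) = (\<integral>\<^sup>+x. indicator (A i) x \<partial>lborel)" using Ai by simp
      also have "\<dots> = \<bar>s\<bar> * (\<integral>\<^sup>+x. indicator (A i) (z i + s * x) \<partial>lborel)"
        using s Ai by (intro nn_integral_real_affine) auto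
      also have "(\<lambda>x. indicator (A i) (z i + s * x) :: ennreal) = indicator ((\<lambda>x. z i + s * x) -` A i)"
        by (auto simp: indicator_def)
      finally show ?thesis using s A'[OF that] by simp
    qed
    have "emeasure (scale_measure (ennreal (s ^ m)) (distr (vol m) (vol m) S)) (PiE {..<m} A)
        = ennreal (s ^ m) * emeasure (vol m) (S -` PiE {..<m} A \<inter> Rn m)"
      using S box by (simp add: emeasure_distr)
    also have "\<dots> = ennreal (s ^ m) * (\<Prod>i<m. emeasure lborel ((\<lambda>x. z i + s * x) -` A i))"
    proof -
      have "emeasure (vol m) (PiE {..<m} (\<lambda>i. (\<lambda>x. z i + s * x) -` A i))
          = (\<Prod>i<m. emeasure lborel ((\<lambda>x. z i + s * x) -` A i))"
        unfolding vol_def using A' by (intro emeasure_PiM) auto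
      then show ?thesis unfolding pre by simp
    qed
    also have "\<dots> = (\<Prod>i<m. ennreal s * emeasure lborel ((\<lambda>x. z i + s * x) -` A i))"
      using s by (simp add: prod.distrib ennreal_power)
    also have "\<dots> = (\<Prod>i<m. emeasure lborel (A i))"
      by (rule prod.cong) (auto simp: one)
    finally show "emeasure (scale_measure (ennreal (s ^ m)) (distr (vol m) (vol m) S)) (PiE {..<m} A)
        = (\<Prod>i<m. emeasure lborel (A i))" .
  qed simp
  then show ?thesis by (simp add: vol_def)
qed

text \<open>Only the ratio of the volumes of balls is used. That this value is neither 0 nor
  infinite is assumed where it matters; otherwise \<open>degenerate_stops\<close> takes
  over.\<close>

definition unit_vol :: ennreal where
  "unit_vol = emeasure (vol m) {x \<in> Rn m. N x \<le> 1}"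

lemma vol_ball:
  assumes z: "z \<in> Rn m" and s: "0 < s"
  shows "emeasure (vol m) (closed_ball m N z s) = ennreal (s ^ m) * unit_vol"
proof -
  define S where "S = (\<lambda>x. \<lambda>i\<in>{..<m}. z i + s * x i)"
  have S: "S \<in> measurable (vol m) (vol m)"
    unfolding S_def vol_def by measurable
  have "emeasure (vol m) (closed_ball m N z s)
      = emeasure (scale_measure (ennreal (s ^ m)) (distr (vol m) (vol m) S)) (closed_ball m N z s)"
    using vol_affine[OF z s] by (simp add: S_def)
  also have "\<dots> = ennreal (s ^ m) * emeasure (vol m) (S -` closed_ball m N z s \<inter> Rn m)"
    using S z by (simp add: emeasure_distr sets_closed_ball)
  also have "S -` closed_ball m N z s \<inter> Rn m = {x \<in> Rn m. N x \<le> 1}"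
  proof -
    have "ndist m N z (S x) = s * N x" if "x \<in> Rn m" for x
    proof -
      have "(\<lambda>i\<in>{..<m}. z i - S x i) = (\<lambda>i\<in>{..<m}. (- s) * x i)"
        by (auto simp: S_def restrict_def)
      then show ?thesis unfolding ndist_def using that s by (simp only: N_scale)
    qed
    moreover have "S x \<in> Rn m" for x by (simp add: S_def)
    ultimately show ?thesis using s by (auto simp: closed_ball_def)
  qed
  finally show ?thesis by (simp add: unit_vol_def)
qed

text \<open>Packing: the balls of radius \<open>e / 2\<close> around the points are disjoint and
  contained in the ball of radius \<open>R + e / 2\<close>.\<close>

lemma separated_card_bound:
  assumes P: "finite P" "P \<subseteq> closed_ball m N z R" and z: "z \<in> Rn m" and R: "0 \<le> R" and e: "0 < e"
    and sep: "\<And>x y. x \<in> P \<Longrightarrow> y \<in> P \<Longrightarrow> x \<noteq> y \<Longrightarrow> e < ndist m N x y"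
    and u: "0 < unit_vol" "unit_vol < \<infinity>"
  shows "real (card P) \<le> (1 + 2 * R / e) ^ m"
proof -
  have PR: "x \<in> Rn m" if "x \<in> P" for x using P that by (auto simp: closed_ball_def)
  have disj: "disjoint_family_on (\<lambda>x. closed_ball m N x (e / 2)) P"
  proof (unfold disjoint_family_on_def, intro ballI impI)
    fix x y assume xy: "x \<in> P" "y \<in> P" "x \<noteq> y"
    have False if "w \<in> closed_ball m N x (e / 2)" "w \<in> closed_ball m N y (e / 2)" for w
      using that sep[OF xy] ndist_triangle[of x y w] ndist_sym[of w y] by (auto simp: closed_ball_def)
    then show "closed_ball m N x (e / 2) \<inter> closed_ball m N y (e / 2) = {}" by blast
  qed
  have "ennreal (real (card P)) * (ennreal ((e / 2) ^ m) * unit_vol)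
      = (\<Sum>x\<in>P. emeasure (vol m) (closed_ball m N x (e / 2)))"
    using PR e by (simp add: vol_ball ennreal_of_nat_eq_real_of_nat)
  also have "\<dots> = emeasure (vol m) (\<Union>x\<in>P. closed_ball m N x (e / 2))"
    using PR P disj by (intro sum_emeasure) (auto simp: sets_closed_ball)
  also have "\<dots> \<le> emeasure (vol m) (closed_ball m N z (R + e / 2))"
  proof (intro emeasure_mono)
    show "(\<Union>x\<in>P. closed_ball m N x (e / 2)) \<subseteq> closed_ball m N z (R + e / 2)"
    proof
      fix w assume "w \<in> (\<Union>x\<in>P. closed_ball m N x (e / 2))"
      then obtain x where "x \<in> P" "w \<in> closed_ball m N x (e / 2)" by auto
      then show "w \<in> closed_ball m N z (R + e / 2)"
        using P(2) ndist_triangle[of z w x] by (force simp: closed_ball_def)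
    qed
  qed (simp add: sets_closed_ball z)
  also have "\<dots> = ennreal ((R + e / 2) ^ m) * unit_vol"
    using z R e by (simp add: vol_ball)
  finally have "ennreal (real (card P) * (e / 2) ^ m) * unit_vol \<le> ennreal ((R + e / 2) ^ m) * unit_vol"
    using e by (simp add: ennreal_mult mult.assoc)
  then have "ennreal (real (card P) * (e / 2) ^ m) \<le> ennreal ((R + e / 2) ^ m)"
    using u by (metis ennreal_mult_le_mult_iff infinity_ennreal_def mult.commute not_gr_zero order_less_irrefl)
  then have "real (card P) * (e / 2) ^ m \<le> (R + e / 2) ^ m"
    using R e by (simp add: ennreal_le_iff)
  then have "real (card P) \<le> (R + e / 2) ^ m / (e / 2) ^ m"
    using e by (subst pos_le_divide_eq) auto
  also have "\<dots> = ((R + e / 2) / (e / 2)) ^ m" by (rule power_divide[symmetric])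
  also have "(R + e / 2) / (e / 2) = 1 + 2 * R / e" using e by (simp add: field_simps)
  finally show ?thesis .
qed

text \<open>A separated subset of maximal size is a net, since an uncovered point could be added.
  The packing bound ensures that a maximum exists.\<close>

lemma net_exists:
  assumes M: "M \<subseteq> closed_ball m N z R" and z: "z \<in> Rn m" and R: "0 \<le> R" and e: "0 < e"
    and u: "0 < unit_vol" "unit_vol < \<infinity>"
  obtains P where "finite P" "P \<subseteq> M" "real (card P) \<le> (1 + 2 * R / e) ^ m"
    "\<And>x. x \<in> M \<Longrightarrow> \<exists>p\<in>P. ndist m N p x \<le> e"
proof -
  define Sep where "Sep P \<longleftrightarrow> finite P \<and> P \<subseteq> M \<and> (\<forall>x\<in>P. \<forall>y\<in>P. x \<noteq> y \<longrightarrow> e < ndist m N x y)" for P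
  have bound: "real (card P) \<le> (1 + 2 * R / e) ^ m" if "Sep P" for P
    using that M unfolding Sep_def by (intro separated_card_bound[OF _ _ z R e _ u]) auto
  have bound': "card P < Suc (nat \<lfloor>(1 + 2 * R / e) ^ m\<rfloor>)" if "Sep P" for P
    using bound[OF that] by (simp add: le_nat_floor less_Suc_eq_le)
  have "Sep {}" by (simp add: Sep_def)
  then obtain P where P: "Sep P" and max: "\<And>P'. Sep P' \<Longrightarrow> card P' \<le> card P"
    using ex_has_greatest_nat[of Sep "{}" card "Suc (nat \<lfloor>(1 + 2 * R / e) ^ m\<rfloor>)"] bound' by (meson less_imp_le)
  have "\<exists>p\<in>P. ndist m N p x \<le> e" if x: "x \<in> M" for x
  proof (rule ccontr)
    assume "\<not> ?thesis"
    then have far: "e < ndist m N p x" if "p \<in> P" for p using that by force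
    then have "x \<notin> P" using e ndist_self[of x] by force
    have "Sep (insert x P)"
      using P x far ndist_sym unfolding Sep_def by (metis (no_types, lifting) finite_insert insertE insert_subset)
    from max[OF this] show False using P \<open>x \<notin> P\<close> by (simp add: Sep_def)
  qed
  with P bound[OF P] show ?thesis by (intro that[of P]) (auto simp: Sep_def)
qed

end

section \<open>Lower bounds for the offline optimum\<close>

definition source_pos :: "nat \<Rightarrow> (nat \<Rightarrow> point) \<Rightarrow> (nat \<Rightarrow> request) \<Rightarrow> nat \<Rightarrow> point" where
  "source_pos k x0 r s = (if s < k then x0 s else snd (r (s - k)))"

lemma taxi_pos_eq: "j < k \<Longrightarrow> taxi_pos x0 r c t j = source_pos k x0 r (src k c t j)"
  by (induction t) (auto simp: source_pos_def)

lemma taxi_cost_eq: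
  assumes "c \<in> {..<n} \<rightarrow> {..<k}"
  shows "taxi_cost m N x0 n r c = (\<Sum>t<n. ndist m N (source_pos k x0 r (src k c t (c t))) (fst (r t)))"
  unfolding taxi_cost_def
proof (intro sum.cong refl)
  fix t assume "t \<in> {..<n}"
  then have "c t < k" using assms by auto
  then show "ndist m N (taxi_pos x0 r c t (c t)) (fst (r t)) = ndist m N (source_pos k x0 r (src k c t (c t))) (fst (r t))"
    by (simp add: taxi_pos_eq)
qed

lemma taxi_pos_cong:
  assumes "\<And>i. i < t \<Longrightarrow> c i = c' i" "\<And>i. i < t \<Longrightarrow> r i = r' i"
  shows "taxi_pos x0 r c t = taxi_pos x0 r' c' t"
  using assms by (induction t) auto

lemma taxi_cost_cong:
  assumes "\<And>i. i < n \<Longrightarrow> c i = c' i" "\<And>i. i < n \<Longrightarrow> r i = r' i"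
  shows "taxi_cost m N x0 n r c = taxi_cost m N x0 n r' c'"
  unfolding taxi_cost_def
proof (intro sum.cong refl)
  fix t assume t: "t \<in> {..<n}"
  then have "taxi_pos x0 r c t = taxi_pos x0 r' c' t" using assms by (intro taxi_pos_cong) auto
  then show "ndist m N (taxi_pos x0 r c t (c t)) (fst (r t)) = ndist m N (taxi_pos x0 r' c' t (c' t)) (fst (r' t))"
    using assms t by simp
qed

text \<open>The functions in \<open>{..<n} \<rightarrow> {..<k}\<close> are arbitrary beyond
  \<open>n\<close>. Extensional functions leave a finite set, so the infimum is attained.\<close>

lemma opt_cost_eq_PiE:
  "opt_cost m N k x0 n r = (INF c\<in>PiE {..<n} (\<lambda>_. {..<k}). taxi_cost m N x0 n r c)"
proof -
  have "taxi_cost m N x0 n r ` ({..<n} \<rightarrow> {..<k}) = taxi_cost m N x0 n r ` PiE {..<n} (\<lambda>_. {..<k})"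
  proof
    show "taxi_cost m N x0 n r ` ({..<n} \<rightarrow> {..<k}) \<subseteq> taxi_cost m N x0 n r ` PiE {..<n} (\<lambda>_. {..<k})"
    proof
      fix y assume "y \<in> taxi_cost m N x0 n r ` ({..<n} \<rightarrow> {..<k})"
      then obtain c where c: "c \<in> {..<n} \<rightarrow> {..<k}" "y = taxi_cost m N x0 n r c" by auto
      then have "y = taxi_cost m N x0 n r (restrict c {..<n})"
        using taxi_cost_cong[of n c "restrict c {..<n}" r r] by auto
      moreover have "restrict c {..<n} \<in> PiE {..<n} (\<lambda>_. {..<k})" using c by (simp add: restrict_PiE_iff Pi_iff)
      ultimately show "y \<in> taxi_cost m N x0 n r ` PiE {..<n} (\<lambda>_. {..<k})" by (rule image_eqI)
    qed
  qed auto
  then show ?thesis by (simp add: opt_cost_def)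
qed

lemma opt_cost_attained:
  assumes "0 < k"
  obtains c where "c \<in> {..<n} \<rightarrow> {..<k}" "opt_cost m N k x0 n r = taxi_cost m N x0 n r c"
proof -
  let ?C = "PiE {..<n} (\<lambda>_. {..<k})"
  have fin: "finite (taxi_cost m N x0 n r ` ?C)" by (intro finite_imageI finite_PiE) auto
  have "(\<lambda>i\<in>{..<n}. 0) \<in> ?C" using assms by auto
  then have ne: "taxi_cost m N x0 n r ` ?C \<noteq> {}" by blast
  have "opt_cost m N k x0 n r = Min (taxi_cost m N x0 n r ` ?C)"
    unfolding opt_cost_eq_PiE using fin ne by (rule cInf_eq_Min)
  then have "opt_cost m N k x0 n r \<in> taxi_cost m N x0 n r ` ?C" using Min_in[OF fin ne] by simp
  then show ?thesis using that by auto
qed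

text \<open>At time \<open>\<tau>\<close> only \<open>k\<close> sources are unused, and each of them serves at most one later request.\<close>

lemma old_uses:
  assumes c: "c \<in> {..<n} \<rightarrow> {..<k}" and \<tau>: "\<tau> \<le> n"
  shows "card {t. \<tau> \<le> t \<and> t < n \<and> src k c t (c t) < k + \<tau>} \<le> k"
proof -
  have c': "c \<in> {..<\<tau>} \<rightarrow> {..<k}" using c \<tau> by auto
  let ?S = "{t. \<tau> \<le> t \<and> t < n \<and> src k c t (c t) < k + \<tau>}"
  let ?U = "unused k \<tau> (sched_of k c \<tau>)"
  have inj: "inj_on (sched_of k c n) {..<n}" using sched_of[OF c] by (simp add: sched_def)
  have eq: "src k c t (c t) = sched_of k c n t" if "t < n" for t using that by (simp add: sched_of_def)
  have "card ?S \<le> card ?U"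
  proof (rule card_inj_on_le[where f = "\<lambda>t. src k c t (c t)"])
    show "inj_on (\<lambda>t. src k c t (c t)) ?S"
      using inj eq by (auto simp: inj_on_def)
    show "finite ?U" by (simp add: unused_def)
    show "(\<lambda>t. src k c t (c t)) ` ?S \<subseteq> ?U"
    proof
      fix s assume "s \<in> (\<lambda>t. src k c t (c t)) ` ?S"
      then obtain t where t: "\<tau> \<le> t" "t < n" "src k c t (c t) < k + \<tau>" "s = src k c t (c t)" by auto
      have "s \<noteq> sched_of k c \<tau> i" if "i < \<tau>" for i
      proof
        assume "s = sched_of k c \<tau> i"
        then have "sched_of k c n t = sched_of k c n i" using t that \<tau> by (simp add: sched_of_def)
        then have "t = i" using inj t that \<tau> by (simp add: inj_on_def)
        then show False using t that by simp
      qed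
      then show "s \<in> ?U" using t by (auto simp: unused_def)
    qed
  qed
  also have "card ?U = k" using sched_of[OF c'] by (intro card_unused) simp
  finally show ?thesis .
qed

text \<open>Windows are consecutive blocks of length \<open>W\<close>, and
  \<open>i div W * W\<close> is the start of the block of \<open>i\<close>. With blocks instead of
  sliding windows, \<open>old_uses\<close> is applied just once per block.\<close>

definition near_recent :: "nat \<Rightarrow> (point \<Rightarrow> real) \<Rightarrow> nat \<Rightarrow> real \<Rightarrow> (nat \<Rightarrow> request) \<Rightarrow> nat \<Rightarrow> bool" where
  "near_recent m N W \<rho> r i \<longleftrightarrow> (\<exists>s\<in>{i div W * W..<i}. ndist m N (snd (r s)) (fst (r i)) \<le> \<rho>)"

text \<open>A request served at cost at most \<open>\<rho>\<close> either uses a source older than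
  its block, which happens at most \<open>k\<close> times per block, or is close to an end point
  inside its block.\<close>

lemma taxi_cost_lower:
  assumes c: "c \<in> {..<n} \<rightarrow> {..<k}" and W: "0 < W" and \<rho>: "0 \<le> \<rho>" and nn: "\<And>x y. 0 \<le> ndist m N x y"
  shows "\<rho> * real n \<le> taxi_cost m N x0 n r c
       + \<rho> * (real k * (real n / real W + 1) + (\<Sum>i<n. of_bool (near_recent m N W \<rho> r i)))"
proof -
  let ?d = "\<lambda>t. ndist m N (source_pos k x0 r (src k c t (c t))) (fst (r t))"
  let ?old = "\<lambda>v. {t. v * W \<le> t \<and> t < n \<and> src k c t (c t) < k + v * W}"
  let ?near = "{t\<in>{..<n}. near_recent m N W \<rho> r t}"
  let ?cheap = "{t\<in>{..<n}. ?d t \<le> \<rho>}"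
  have sub: "?cheap \<subseteq> ?near \<union> (\<Union>v\<in>{v. v * W \<le> n}. ?old v)"
  proof
    fix t assume t: "t \<in> ?cheap"
    show "t \<in> ?near \<union> (\<Union>v\<in>{v. v * W \<le> n}. ?old v)"
    proof (cases "src k c t (c t) < k + t div W * W")
      case True
      moreover have le: "t div W * W \<le> t" by simp
      moreover have "t div W * W \<le> n" using le t by (simp del: div_times_less_eq_dividend)
      ultimately show ?thesis using t by (intro UnI2 UN_I[of "t div W"]) auto
    next
      case False
      let ?s = "src k c t (c t)"
      have "?s < k + t" using src_less[OF c] t by simp
      then have "?s - k \<in> {t div W * W..<t}" "source_pos k x0 r ?s = snd (r (?s - k))"
        using False by (auto simp: source_pos_def)
      then have "near_recent m N W \<rho> r t" using t unfolding near_recent_def by (intro bexI[of _ "?s - k"]) auto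
      then show ?thesis using t by auto
    qed
  qed
  have windows: "{v. v * W \<le> n} = {..n div W}"
    using W by (auto simp: less_eq_div_iff_mult_less_eq)
  have finold: "finite (?old v)" for v by (rule finite_subset[of _ "{..<n}"]) auto
  have "card ?cheap \<le> card (?near \<union> (\<Union>v\<in>{v. v * W \<le> n}. ?old v))"
    using finold by (intro card_mono sub) (auto simp: windows)
  also have "\<dots> \<le> card ?near + card (\<Union>v\<in>{v. v * W \<le> n}. ?old v)" by (rule card_Un_le)
  also have "card (\<Union>v\<in>{v. v * W \<le> n}. ?old v) \<le> (\<Sum>v\<in>{v. v * W \<le> n}. card (?old v))"
    by (rule card_UN_le) (simp add: windows)
  also have "\<dots> \<le> (\<Sum>v\<in>{v. v * W \<le> n}. k)" using c by (intro sum_mono old_uses) auto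
  also have "\<dots> = (n div W + 1) * k" by (simp add: windows)
  finally have "card ?cheap \<le> card ?near + (n div W + 1) * k" by simp
  then have "real (card ?cheap) \<le> real (card ?near + (n div W + 1) * k)" by (rule of_nat_mono)
  also have "\<dots> \<le> (\<Sum>i<n. of_bool (near_recent m N W \<rho> r i)) + real k * (real n / real W + 1)"
  proof -
    have "real (n div W) * real W \<le> real n" by (metis div_times_less_eq_dividend of_nat_le_iff of_nat_mult)
    then have "real (n div W) \<le> real n / real W" using W by (simp add: field_simps)
    then have "real ((n div W + 1) * k) \<le> real k * (real n / real W + 1)"
      by (simp only: of_nat_mult of_nat_add of_nat_1 mult.commute[of _ "real k"]) (intro mult_left_mono; simp)
    moreover have "real (card ?near) = (\<Sum>i<n. of_bool (near_recent m N W \<rho> r i))"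
      by (simp add: of_bool_def sum.If_cases Int_def)
    ultimately show ?thesis unfolding of_nat_add by linarith
  qed
  finally have cheap: "real (card ?cheap) \<le> (\<Sum>i<n. of_bool (near_recent m N W \<rho> r i)) + real k * (real n / real W + 1)" .
  have "\<rho> * real n - \<rho> * real (card ?cheap) = (\<Sum>t<n. \<rho> * (1 - of_bool (?d t \<le> \<rho>)))"
    by (simp add: sum_subtractf right_diff_distrib sum_distrib_left[symmetric] of_bool_def sum.If_cases Int_def)
  also have "\<dots> \<le> (\<Sum>t<n. ?d t)"
    using nn \<rho> by (intro sum_mono) (auto simp: of_bool_def)
  also have "\<dots> = taxi_cost m N x0 n r c" by (rule taxi_cost_eq[OF c, symmetric])
  finally have "\<rho> * real n \<le> taxi_cost m N x0 n r c + \<rho> * real (card ?cheap)" by simp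
  also have "\<rho> * real (card ?cheap) \<le> \<rho> * ((\<Sum>i<n. of_bool (near_recent m N W \<rho> r i)) + real k * (real n / real W + 1))"
    using cheap \<rho> by (intro mult_left_mono)
  finally show ?thesis by (simp add: add.commute)
qed

lemma opt_cost_mono:
  assumes k: "0 < k" and n: "n \<le> n'" and nn: "\<And>x y. 0 \<le> ndist m N x y"
  shows "opt_cost m N k x0 n r \<le> opt_cost m N k x0 n' r"
proof -
  obtain c where c: "c \<in> {..<n'} \<rightarrow> {..<k}" "opt_cost m N k x0 n' r = taxi_cost m N x0 n' r c"
    by (rule opt_cost_attained[OF k])
  have nonneg: "0 \<le> taxi_cost m N x0 n r c" for c unfolding taxi_cost_def using nn by (intro sum_nonneg) auto
  have "opt_cost m N k x0 n r \<le> taxi_cost m N x0 n r c"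
    unfolding opt_cost_def using c n nonneg by (intro cINF_lower bdd_belowI2[where m = 0]) auto
  also have "\<dots> \<le> taxi_cost m N x0 n' r c"
    unfolding taxi_cost_def using n nn by (intro sum_mono2) auto
  finally show ?thesis using c by simp
qed

lemma opt_cost_nonneg:
  assumes k: "0 < k" and nn: "\<And>x y. 0 \<le> ndist m N x y"
  shows "0 \<le> opt_cost m N k x0 n r"
  using opt_cost_attained[OF k, of n m N x0 r] nn unfolding taxi_cost_def by (metis (no_types, lifting) sum_nonneg)

text \<open>With blocks of length \<open>4 * k\<close>, old sources serve at most a quarter of the
  requests, up to an additive \<open>k\<close>; this leaves \<open>3 / 4\<close>.\<close>

lemma opt_cost_lower:
  assumes k: "0 < k" and \<rho>: "0 \<le> \<rho>" and nn: "\<And>x y. 0 \<le> ndist m N x y"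
  shows "3 / 4 * \<rho> * real n \<le> opt_cost m N k x0 n r + \<rho> * real k + \<rho> * (\<Sum>i<n. of_bool (near_recent m N (4 * k) \<rho> r i))"
proof -
  obtain c where c: "c \<in> {..<n} \<rightarrow> {..<k}" "opt_cost m N k x0 n r = taxi_cost m N x0 n r c"
    by (rule opt_cost_attained[OF k])
  have "real k * (real n / real (4 * k) + 1) = real n / 4 + real k" using k by (simp add: field_simps)
  then show ?thesis
    using taxi_cost_lower[OF c(1) _ \<rho> nn, of "4 * k" x0 r] c(2) k by (simp add: algebra_simps)
qed

section \<open>Measurability of the costs\<close>

locale taxi_setting = norm_space +
  fixes M :: "point set" and z :: point and R :: real and k :: nat and x0 :: "nat \<Rightarrow> point"
  assumes m_pos: "0 < m" and z: "z \<in> Rn m" and M: "M \<subseteq> closed_ball m N z R" and R_pos: "0 < R"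
    and k_pos: "0 < k" and x0: "\<And>j. j < k \<Longrightarrow> x0 j \<in> M"
    and unit_vol: "0 < unit_vol" "unit_vol < \<infinity>"
begin

lemma M_Rn: "x \<in> M \<Longrightarrow> x \<in> Rn m"
  using M by (auto simp: closed_ball_def)

lemma M_diam:
  assumes "x \<in> M" "y \<in> M" shows "ndist m N x y \<le> 2 * R"
proof -
  have "ndist m N z x \<le> R" "ndist m N z y \<le> R" using assms M by (auto simp: closed_ball_def)
  then show ?thesis using ndist_triangle[of x y z] ndist_sym[of x z] by simp
qed

lemma space_point_space: "space (point_space m M) = M"
  using M_Rn by (auto simp: point_space_def space_restrict_space)

lemma space_request_space: "space (request_space m M) = M \<times> M"
  by (simp add: request_space_def space_pair_measure space_point_space)

lemma measurable_point_vol: "(\<lambda>x. x) \<in> measurable (point_space m M) (vol m)"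
  unfolding point_space_def by (rule measurable_restrict_space1) simp

lemma measurable_request_fst: "fst \<in> measurable (request_space m M) (vol m)"
  and measurable_request_snd: "snd \<in> measurable (request_space m M) (vol m)"
  unfolding request_space_def
  by (rule measurable_compose[OF measurable_fst measurable_point_vol], rule measurable_compose[OF measurable_snd measurable_point_vol])

lemma measurable_history_fst: "i \<in> J \<Longrightarrow> (\<lambda>r. fst (r i)) \<in> measurable (history_space m M J) (vol m)"
  and measurable_history_snd: "i \<in> J \<Longrightarrow> (\<lambda>r. snd (r i)) \<in> measurable (history_space m M J) (vol m)"
  using measurable_compose[OF measurable_component_singleton[of i J "\<lambda>_. request_space m M"] measurable_request_fst]
    measurable_compose[OF measurable_component_singleton[of i J "\<lambda>_. request_space m M"] measurable_request_snd]
  by auto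

lemma measurable_source_pos:
  assumes "s < k + t" "{..<t} \<subseteq> J"
  shows "(\<lambda>r. source_pos k x0 r s) \<in> measurable (history_space m M J) (vol m)"
proof (cases "s < k")
  case True
  then show ?thesis using x0 M_Rn by (simp add: source_pos_def)
next
  case False
  then have "s - k \<in> J" using assms by auto
  then show ?thesis using False by (simp add: source_pos_def measurable_history_snd)
qed

lemma measurable_taxi_cost:
  assumes c: "c \<in> {..<n} \<rightarrow> {..<k}" and J: "{..<n} \<subseteq> J"
  shows "(\<lambda>r. taxi_cost m N x0 n r c) \<in> borel_measurable (history_space m M J)"
  unfolding taxi_cost_eq[OF c]
proof (intro borel_measurable_sum measurable_ndist)
  fix t assume t: "t \<in> {..<n}"
  then have "src k c t (c t) < k + t" using src_less[OF c] by simp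
  then show "(\<lambda>r. source_pos k x0 r (src k c t (c t))) \<in> measurable (history_space m M J) (vol m)"
    using t J by (intro measurable_source_pos[of _ t]) auto
  show "(\<lambda>r. fst (r t)) \<in> measurable (history_space m M J) (vol m)"
    using t J by (intro measurable_history_fst) auto
qed

lemma measurable_opt_cost:
  "opt_cost m N k x0 n \<in> borel_measurable (history_space m M UNIV)"
  unfolding opt_cost_eq_PiE
proof (rule borel_measurable_cINF_real)
  show "countable (PiE {..<n} (\<lambda>_. {..<k}))" by (intro countable_finite finite_PiE) auto
qed (auto intro!: measurable_taxi_cost)

end

section \<open>The law of a smooth instance and its expected length\<close>

locale smooth_setting = taxi_setting +
  fixes \<sigma> :: real and I :: instance_adv
  assumes smooth: "smooth_instance m M (closed_ball m N z R) \<sigma> I" and \<sigma>: "0 < \<sigma>"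
begin

lemma Ionescu_Tulcea: "Ionescu_Tulcea (next_dist I) (\<lambda>_. request_space m M)"
  and measurable_stop: "Measurable.pred (history_space m M {..<t}) (stop I t)"
  and AE_stopped: "AE r in request_law m M I. \<exists>t. stopped I t r"
  and smooth_dist: "h \<in> space (history_space m M {..<t}) \<Longrightarrow> \<not> stopped I t h
    \<Longrightarrow> smooth_dist m M (closed_ball m N z R) \<sigma> (next_dist I t h)"
  using smooth by (auto simp: smooth_instance_def is_instance_def)

sublocale IT: Ionescu_Tulcea "next_dist I" "\<lambda>_. request_space m M"
  by (rule Ionescu_Tulcea)

lemma law_eq: "request_law m M I = IT.PF.lim"
  by (simp add: request_law_def)

lemma space_law: "space (request_law m M I) = space (history_space m M UNIV)"
  and sets_law: "sets (request_law m M I) = sets (history_space m M UNIV)"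
  by (simp_all add: law_eq)

lemma prob_space_law: "prob_space (request_law m M I)"
proof
  \<comment> \<open>The total mass is read off from the marginal on the empty set of
    coordinates.\<close>
  have "emeasure IT.PF.lim (prod_emb UNIV (\<lambda>_. request_space m M) {0..<0} (space (history_space m M {0..<0})))
      = emeasure (IT.CI {0..<0}) (space (history_space m M {0..<0}))"
    by (rule IT.lim) auto
  also have "\<dots> = 1"
  proof -
    interpret P: prob_space "IT.CI {0..<0}" by (rule IT.PF.prob_space_P) auto
    have "space (IT.CI {0..<0}) = space (history_space m M {0..<0})" by (rule IT.PF.space_P) auto
    then show ?thesis using P.emeasure_space_1 by simp
  qed
  also have "prod_emb UNIV (\<lambda>_. request_space m M) {0..<0} (space (history_space m M {0..<0})) = space IT.PF.lim"
    by (auto simp: prod_emb_def space_PiM)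
  finally show "emeasure (request_law m M I) (space (request_law m M I)) = 1" by (simp add: law_eq)
qed

text \<open>Transfers events of the first \<open>n\<close> requests to the iterated kernels, whose
  last step is an integral over \<open>next_dist\<close>.\<close>

lemma law_restrict:
  assumes A: "A \<in> sets (history_space m M {0..<n})"
  shows "emeasure (request_law m M I) {r \<in> space (history_space m M UNIV). restrict r {0..<n} \<in> A}
       = emeasure (IT.C 0 n (\<lambda>_. undefined)) A"
proof -
  have "{r \<in> space (history_space m M UNIV). restrict r {0..<n} \<in> A} = prod_emb UNIV (\<lambda>_. request_space m M) {0..<n} A"
    by (auto simp: prod_emb_def space_PiM)
  then have "emeasure (request_law m M I) {r \<in> space (history_space m M UNIV). restrict r {0..<n} \<in> A}
      = emeasure (IT.CI {0..<n}) A"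
    by (simp add: law_eq IT.lim A)
  also have "\<dots> = emeasure (IT.C 0 n (\<lambda>_. undefined)) (prod_emb {0..<n} (\<lambda>_. request_space m M) {0..<n} A)"
    by (rule IT.emeasure_CI) (use A in auto)
  also have "prod_emb {0..<n} (\<lambda>_. request_space m M) {0..<n} A = A"
    using sets.sets_into_space[OF A] by (intro prod_emb_id) (simp add: space_PiM)
  finally show ?thesis .
qed

lemma stopped_restrict: "i \<le> n \<Longrightarrow> stopped I i (restrict r {..<n}) = stopped I i r"
  unfolding stopped_def by (intro ex_cong1 conj_cong refl) (simp add: Int_absorb1 restrict_restrict)

lemma measurable_stopped:
  assumes "{..<i} \<subseteq> J"
  shows "Measurable.pred (history_space m M J) (stopped I i)"
proof -
  have "Measurable.pred (history_space m M J) (\<lambda>r. \<exists>s\<in>{..i}. stop I s (restrict r {..<s}))"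
  proof (intro pred_intros_finite)
    fix s assume "s \<in> {..i}"
    then have "(\<lambda>r. restrict r {..<s}) \<in> measurable (history_space m M J) (history_space m M {..<s})"
      using assms by (intro measurable_restrict_subset) auto
    from measurable_compose[OF this measurable_stop]
    show "Measurable.pred (history_space m M J) (\<lambda>r. stop I s (restrict r {..<s}))" .
  qed simp
  moreover have "stopped I i = (\<lambda>r. \<exists>s\<in>{..i}. stop I s (restrict r {..<s}))"
    by (intro ext) (auto simp only: stopped_def atMost_iff Bex_def)
  ultimately show ?thesis by (simp only:)
qed

lemma measurable_near:
  assumes "{..i} \<subseteq> J"
  shows "Measurable.pred (history_space m M J) (\<lambda>r. near_recent m N W \<rho> r i)"
  unfolding near_recent_def
proof (intro pred_intros_finite)
  fix s assume s: "s \<in> {i div W * W..<i}"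
  have "(\<lambda>r. ndist m N (snd (r s)) (fst (r i))) \<in> borel_measurable (history_space m M J)"
    using s assms by (intro measurable_ndist measurable_history_fst measurable_history_snd) auto
  then show "Measurable.pred (history_space m M J) (\<lambda>r. ndist m N (snd (r s)) (fst (r i)) \<le> \<rho>)"
    by measurable
qed simp

text \<open>Smoothness compares with the volume of a ball of radius \<open>\<rho>\<close>, and
  \<open>unit_vol\<close> cancels in the ratio, whatever the norm. The outer measure allows the
  trace of this ball on \<open>M\<close> to be enlarged to the full ball.\<close>

lemma prob_near_point:
  assumes h: "h \<in> space (history_space m M {..<i})" and ns: "\<not> stopped I i h" and p: "p \<in> M"
    and \<rho>: "0 < \<rho>"
  shows "emeasure (next_dist I i h) {y \<in> space (request_space m M). ndist m N p (fst y) \<le> \<rho>}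
       \<le> ennreal (1 / \<sigma> * (\<rho> / R) ^ m)"
proof -
  have h': "h \<in> space (history_space m M {0..<i})" using h by (simp add: atLeast0LessThan)
  have sets: "sets (next_dist I i h) = sets (request_space m M)"
    and sp: "space (next_dist I i h) = space (request_space m M)"
    using IT.sets_P[OF h'] IT.space_P[OF h'] by auto
  let ?S = "closed_ball m N p \<rho> \<inter> M"
  have pR: "p \<in> Rn m" using p M_Rn by simp
  have S: "?S \<in> sets (point_space m M)"
  proof -
    have "M \<inter> closed_ball m N p \<rho> \<in> (\<inter>) M ` sets (vol m)"
      using sets_closed_ball[OF pR] by blast
    then show ?thesis by (simp add: point_space_def sets_restrict_space Int_commute)
  qed
  have fst: "fst \<in> measurable (next_dist I i h) (point_space m M)"
    unfolding measurable_cong_sets[OF sets refl] by (simp add: request_space_def)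
  have "{y \<in> space (request_space m M). ndist m N p (fst y) \<le> \<rho>} = fst -` ?S \<inter> space (next_dist I i h)"
    using M_Rn by (auto simp: sp space_request_space closed_ball_def)
  then have "emeasure (next_dist I i h) {y \<in> space (request_space m M). ndist m N p (fst y) \<le> \<rho>}
      = emeasure (distr (next_dist I i h) (point_space m M) fst) ?S"
    using fst S by (simp add: emeasure_distr)
  also have "\<dots> \<le> ennreal (1 / \<sigma>) * (outer_measure_of (vol m) (?S \<inter> closed_ball m N z R) / emeasure (vol m) (closed_ball m N z R))"
    using smooth_dist[OF h ns] S by (auto simp: smooth_dist_def smooth_marginal_def)
  also have "outer_measure_of (vol m) (?S \<inter> closed_ball m N z R) \<le> outer_measure_of (vol m) (closed_ball m N p \<rho>)"
    by (rule outer_measure_of_mono) auto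
  also have "outer_measure_of (vol m) (closed_ball m N p \<rho>) = ennreal (\<rho> ^ m) * unit_vol"
    using pR \<rho> by (simp add: sets_closed_ball vol_ball)
  also have "emeasure (vol m) (closed_ball m N z R) = ennreal (R ^ m) * unit_vol"
    using z R_pos by (simp add: vol_ball)
  also have "(ennreal (\<rho> ^ m) * unit_vol) / (ennreal (R ^ m) * unit_vol) = ennreal ((\<rho> / R) ^ m)"
  proof -
    obtain u where u: "unit_vol = ennreal u" "0 < u"
      using unit_vol by (cases unit_vol) (auto simp: less_top[symmetric])
    have "(ennreal (\<rho> ^ m) * unit_vol) / (ennreal (R ^ m) * unit_vol) = ennreal (\<rho> ^ m * u / (R ^ m * u))"
      using u \<rho> R_pos by (simp add: ennreal_mult[symmetric] divide_ennreal)
    then show ?thesis using u by (simp add: power_divide)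
  qed
  also have "ennreal (1 / \<sigma>) * ennreal ((\<rho> / R) ^ m) = ennreal (1 / \<sigma> * (\<rho> / R) ^ m)"
    using \<sigma> \<rho> R_pos by (intro ennreal_mult[symmetric]) auto
  finally show ?thesis
    by (simp add: mult_left_mono divide_right_mono_ennreal)
qed

text \<open>Given the history, the recent end points are fixed and there are fewer than
  \<open>W\<close> of them, so a union bound over \<open>prob_near_point\<close> applies. Since
  smoothness holds only before the adversary stops, the estimate is relative to the event that
  request \<open>i\<close> is made.\<close>

lemma prob_near_recent:
  assumes \<rho>: "0 < \<rho>" and W: "0 < W"
  shows "emeasure (request_law m M I) {r \<in> space (history_space m M UNIV). \<not> stopped I i r \<and> near_recent m N W \<rho> r i}
       \<le> ennreal (real W * (1 / \<sigma> * (\<rho> / R) ^ m))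
         * emeasure (request_law m M I) {r \<in> space (history_space m M UNIV). \<not> stopped I i r}"
proof -
  let ?q = "1 / \<sigma> * (\<rho> / R) ^ m"
  let ?H = "\<lambda>n. history_space m M {0..<n}"
  define E where "E = {h \<in> space (?H (Suc i)). \<not> stopped I i h \<and> near_recent m N W \<rho> h i}"
  define G where "G = {h \<in> space (?H i). \<not> stopped I i h}"
  have q0: "0 \<le> ?q" using \<sigma> \<rho> R_pos by simp
  have E: "E \<in> sets (?H (Suc i))"
  proof -
    have [measurable]: "Measurable.pred (?H (Suc i)) (stopped I i)"
        "Measurable.pred (?H (Suc i)) (\<lambda>h. near_recent m N W \<rho> h i)"
      by (intro measurable_stopped measurable_near; auto)+
    show ?thesis unfolding E_def by measurable
  qed
  have G: "G \<in> sets (?H i)"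
  proof -
    have [measurable]: "Measurable.pred (?H i) (stopped I i)" by (intro measurable_stopped) auto
    show ?thesis unfolding G_def by measurable
  qed
  have near_restrict: "near_recent m N W \<rho> (restrict r {0..<Suc i}) i = near_recent m N W \<rho> r i" for r
    unfolding near_recent_def by (intro bex_cong refl) auto
  have "{r \<in> space (history_space m M UNIV). \<not> stopped I i r \<and> near_recent m N W \<rho> r i}
      = {r \<in> space (history_space m M UNIV). restrict r {0..<Suc i} \<in> E}"
    using stopped_restrict[of i "Suc i"] near_restrict
    by (auto simp: E_def space_PiM PiE_iff atLeast0LessThan)
  then have "emeasure (request_law m M I) {r \<in> space (history_space m M UNIV). \<not> stopped I i r \<and> near_recent m N W \<rho> r i}
      = emeasure (IT.C 0 (Suc i) (\<lambda>_. undefined)) E"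
    using law_restrict[OF E] by simp
  also have "\<dots> = (\<integral>\<^sup>+h. emeasure (IT.eP i h) E \<partial>IT.C 0 i (\<lambda>_. undefined))"
  proof -
    have u: "(\<lambda>_. undefined) \<in> space (?H 0)" by (simp add: space_PiM)
    have "space (IT.C 0 i (\<lambda>_. undefined)) \<noteq> {}"
      using IT.prob_space_C[OF u, of i] prob_space.not_empty by blast
    moreover have "IT.eP i \<in> measurable (IT.C 0 i (\<lambda>_. undefined)) (subprob_algebra (?H (Suc i)))"
      using IT.measurable_eP[of i] measurable_cong_sets[OF IT.sets_C[OF u, of i] refl, of "subprob_algebra (?H (Suc i))"]
      by simp
    ultimately show ?thesis using E by (simp add: emeasure_bind)
  qed
  also have "\<dots> \<le> (\<integral>\<^sup>+h. ennreal (real W * ?q) * indicator G h \<partial>IT.C 0 i (\<lambda>_. undefined))"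
  proof (rule nn_integral_mono)
    fix h assume "h \<in> space (IT.C 0 i (\<lambda>_. undefined))"
    then have h: "h \<in> space (?H i)"
      using IT.space_C[of "\<lambda>_. undefined" 0 i] by (simp add: space_PiM)
    then have h': "h \<in> space (history_space m M {..<i})" by (simp add: atLeast0LessThan)
    have stop_upd: "stopped I i (h(i := y)) = stopped I i h" for y
    proof -
      have "restrict (h(i := y)) {..<i} = restrict h {..<i}" by (auto simp: restrict_def)
      then show ?thesis using stopped_restrict[of i i h] stopped_restrict[of i i "h(i := y)"] by simp
    qed
    have eP: "emeasure (IT.eP i h) E = emeasure (next_dist I i h) ((\<lambda>y. h(i := y)) -` E \<inter> space (request_space m M))"
      by (rule IT.emeasure_eP[OF h E])
    show "emeasure (IT.eP i h) E \<le> ennreal (real W * ?q) * indicator G h"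
    proof (cases "stopped I i h")
      case True
      then have "(\<lambda>y. h(i := y)) -` E \<inter> space (request_space m M) = {}" by (auto simp: E_def stop_upd)
      then show ?thesis by (simp add: eP)
    next
      case False
      let ?w = "{i div W * W..<i}"
      let ?B = "\<lambda>s. {y \<in> space (request_space m M). ndist m N (snd (h s)) (fst y) \<le> \<rho>}"
      have sets: "sets (next_dist I i h) = sets (request_space m M)" by (rule IT.sets_P[OF h])
      have hM: "snd (h s) \<in> M" if "s < i" for s
      proof -
        have "h s \<in> space (request_space m M)" using h that by (auto simp: space_PiM PiE_iff)
        then show ?thesis by (auto simp: space_request_space)
      qed
      have B: "?B s \<in> sets (next_dist I i h)" if "s \<in> ?w" for s
      proof -
        have "(\<lambda>y. ndist m N (snd (h s)) (fst y)) \<in> borel_measurable (request_space m M)"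
          using hM[of s] that M_Rn by (intro measurable_ndist measurable_request_fst) auto
        then show ?thesis unfolding sets by measurable
      qed
      have "(\<lambda>y. h(i := y)) -` E \<inter> space (request_space m M) \<subseteq> (\<Union>s\<in>?w. ?B s)"
        by (auto simp: E_def near_recent_def)
      then have "emeasure (IT.eP i h) E \<le> emeasure (next_dist I i h) (\<Union>s\<in>?w. ?B s)"
        unfolding eP using B by (intro emeasure_mono sets.finite_UN) auto
      also have "\<dots> \<le> (\<Sum>s\<in>?w. emeasure (next_dist I i h) (?B s))"
        using B by (intro emeasure_subadditive_finite) auto
      also have "\<dots> \<le> (\<Sum>s\<in>?w. ennreal ?q)"
        using hM by (intro sum_mono prob_near_point[OF h' False _ \<rho>]) auto
      also have "\<dots> = ennreal (real (card ?w) * ?q)"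
        by (simp only: sum_constant ennreal_mult[OF of_nat_0_le_iff q0] ennreal_of_nat_eq_real_of_nat)
      also have "\<dots> \<le> ennreal (real W * ?q)"
      proof (intro ennreal_leI mult_right_mono)
        have "i - i div W * W = i mod W" by (rule minus_div_mult_eq_mod)
        also have "\<dots> \<le> W" using W by (simp add: less_imp_le)
        finally have "card ?w \<le> W" by (simp only: card_atLeastLessThan)
        then show "real (card ?w) \<le> real W" by (rule of_nat_mono)
      qed (rule q0)
      finally show ?thesis using False h by (simp add: G_def)
    qed
  qed
  also have "\<dots> = ennreal (real W * ?q) * emeasure (IT.C 0 i (\<lambda>_. undefined)) G"
  proof -
    have "sets (IT.C 0 i (\<lambda>_. undefined)) = sets (?H i)"
      using IT.sets_C[of "\<lambda>_. undefined" 0 i] by (simp add: space_PiM)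
    then show ?thesis using G by (simp add: nn_integral_cmult_indicator)
  qed
  also have "emeasure (IT.C 0 i (\<lambda>_. undefined)) G
      = emeasure (request_law m M I) {r \<in> space (history_space m M UNIV). restrict r {0..<i} \<in> G}"
    by (rule law_restrict[OF G, symmetric])
  also have "{r \<in> space (history_space m M UNIV). restrict r {0..<i} \<in> G} = {r \<in> space (history_space m M UNIV). \<not> stopped I i r}"
    using stopped_restrict[of i i] by (auto simp: G_def space_PiM PiE_iff atLeast0LessThan)
  finally show ?thesis .
qed

lemma measurable_num_requests:
  "num_requests I \<in> measurable (history_space m M UNIV) (count_space UNIV)"
proof -
  have [measurable]: "Measurable.pred (history_space m M UNIV) (stopped I i)" for i
    by (intro measurable_stopped) auto
  show ?thesis unfolding num_requests_def[abs_def] by measurable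
qed

lemma measurable_stopped_opt:
  "(\<lambda>r. opt_cost m N k x0 (num_requests I r) r) \<in> borel_measurable (history_space m M UNIV)"
  by (rule measurable_compose_countable[OF measurable_opt_cost measurable_num_requests])

lemma less_num_requests:
  assumes "\<exists>t. stopped I t r"
  shows "i < num_requests I r \<longleftrightarrow> \<not> stopped I i r"
proof
  assume "i < num_requests I r"
  then show "\<not> stopped I i r" unfolding num_requests_def by (rule not_less_Least)
next
  assume ns: "\<not> stopped I i r"
  have "stopped I (num_requests I r) r" unfolding num_requests_def by (rule LeastI_ex[OF assms])
  then show "i < num_requests I r" using ns unfolding stopped_def by (meson le_trans not_le)
qed

text \<open>Of the \<open>3 / 4\<close> in \<open>opt_cost_lower\<close>, close recent end points
  consume another quarter in expectation. The remaining half shows that the optimum pays for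
  \<open>\<rho> / 2\<close> per request.\<close>

lemma expected_num_requests:
  assumes \<rho>: "0 < \<rho>" and eq: "(\<rho> / R) ^ m = \<sigma> / (16 * real k)"
  shows "ennreal (\<rho> / 2) * (\<integral>\<^sup>+r. ennreal (real (num_requests I r)) \<partial>request_law m M I)
       \<le> expected_opt_cost m N M k x0 I + ennreal (\<rho> * real k)"
proof -
  let ?H = "history_space m M UNIV" and ?P = "request_law m M I"
  let ?O = "expected_opt_cost m N M k x0 I"
  interpret P: prob_space ?P by (rule prob_space_law)
  define S where "S i = {r \<in> space ?H. \<not> stopped I i r}" for i
  define Q where "Q i = {r \<in> space ?H. \<not> stopped I i r \<and> near_recent m N (4 * k) \<rho> r i}" for i
  have meas: "Measurable.pred ?H (stopped I i)" "Measurable.pred ?H (\<lambda>r. near_recent m N (4 * k) \<rho> r i)" for i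
    by (intro measurable_stopped measurable_near; auto)+
  have S: "S i \<in> sets ?P" and Q: "Q i \<in> sets ?P" for i
    unfolding sets_law S_def Q_def using meas by measurable
  have QS: "emeasure ?P (Q i) \<le> ennreal (1 / 4) * emeasure ?P (S i)" for i
  proof -
    \<comment> \<open>The origin of the 16 in \<open>eq\<close>: up to \<open>4 * k\<close> end
      points, each close with probability \<open>1 / (16 * k)\<close>.\<close>
    have e: "real (4 * k) * (1 / \<sigma> * (\<rho> / R) ^ m) = 1 / 4"
      unfolding eq using \<sigma> k_pos by (simp add: field_simps)
    have "0 < 4 * k" using k_pos by simp
    from prob_near_recent[OF \<rho> this, of i] show ?thesis unfolding e S_def Q_def .
  qed
  \<comment> \<open>The length is truncated at \<open>n\<close>, since its expectation is not known
    to be finite in advance and a multiple of it is subtracted from both sides. The optimum of a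
    prefix is no larger, and letting \<open>n\<close> grow removes the truncation.\<close>
  have bound: "ennreal (\<rho> / 2) * (\<Sum>i<n. emeasure ?P (S i)) \<le> ?O + ennreal (\<rho> * real k)" for n
  proof (cases "?O")
    case (real o')
    have pointwise: "ennreal (3 / 4 * \<rho>) * (\<Sum>i<n. indicator (S i) r)
        \<le> ennreal (opt_cost m N k x0 (num_requests I r) r) + ennreal (\<rho> * real k) + ennreal \<rho> * (\<Sum>i<n. indicator (Q i) r)"
      if r: "r \<in> space ?P" and st: "\<exists>t. stopped I t r" for r
    proof -
      let ?T = "num_requests I r"
      have lt: "i < ?T \<longleftrightarrow> \<not> stopped I i r" for i by (rule less_num_requests[OF st])
      have rH: "r \<in> space ?H" using r by (simp add: space_law)
      have Sn: "(\<Sum>i<n. indicator (S i) r) = real (min n ?T)"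
      proof -
        have "(\<Sum>i<n. indicator (S i) r) = (\<Sum>i<n. of_bool (i < ?T) :: real)"
          using rH lt by (intro sum.cong) (auto simp: S_def indicator_def)
        also have "\<dots> = real (card {..<min n ?T})"
        proof -
          have "{..<n} \<inter> {i. i < ?T} = {..<min n ?T}" by auto
          then show ?thesis by (simp add: of_bool_def sum.If_cases)
        qed
        finally show ?thesis by simp
      qed
      have "3 / 4 * \<rho> * real (min n ?T) \<le> opt_cost m N k x0 (min n ?T) r + \<rho> * real k
          + \<rho> * (\<Sum>i<min n ?T. of_bool (near_recent m N (4 * k) \<rho> r i))"
        using \<rho> by (intro opt_cost_lower k_pos ndist_nonneg) auto
      also have "opt_cost m N k x0 (min n ?T) r \<le> opt_cost m N k x0 ?T r"
        by (intro opt_cost_mono k_pos ndist_nonneg) auto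
      also have "(\<Sum>i<min n ?T. of_bool (near_recent m N (4 * k) \<rho> r i)) = (\<Sum>i<min n ?T. indicator (Q i) r :: real)"
        using rH lt by (intro sum.cong) (auto simp: Q_def indicator_def)
      also have "(\<Sum>i<min n ?T. indicator (Q i) r :: real) \<le> (\<Sum>i<n. indicator (Q i) r)"
        by (intro sum_mono2) auto
      finally have main: "3 / 4 * \<rho> * (\<Sum>i<n. indicator (S i) r)
          \<le> opt_cost m N k x0 ?T r + \<rho> * real k + \<rho> * (\<Sum>i<n. indicator (Q i) r)"
        using \<rho> by (simp add: Sn)
      have e: "(\<Sum>i<n. indicator (X i) r) = ennreal (\<Sum>i<n. indicator (X i) r)" for X :: "nat \<Rightarrow> (nat \<Rightarrow> request) set"
        by (subst sum_ennreal[symmetric]) (simp_all add: ennreal_indicator)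
      have nn: "0 \<le> opt_cost m N k x0 ?T r" "0 \<le> (\<Sum>i<n. indicator (S i) r :: real)" "0 \<le> (\<Sum>i<n. indicator (Q i) r :: real)"
        using ndist_nonneg by (auto intro!: opt_cost_nonneg k_pos sum_nonneg)
      show ?thesis
        unfolding e[of S] e[of Q] using main nn \<rho>
        by (simp add: ennreal_mult[symmetric] ennreal_plus[symmetric] ennreal_leI del: ennreal_plus)
    qed
    have "ennreal (3 / 4 * \<rho>) * (\<Sum>i<n. emeasure ?P (S i)) = (\<integral>\<^sup>+r. ennreal (3 / 4 * \<rho>) * (\<Sum>i<n. indicator (S i) r) \<partial>?P)"
      using S by (simp add: nn_integral_cmult nn_integral_sum)
    also have "\<dots> \<le> (\<integral>\<^sup>+r. ennreal (opt_cost m N k x0 (num_requests I r) r) + ennreal (\<rho> * real k)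
        + ennreal \<rho> * (\<Sum>i<n. indicator (Q i) r) \<partial>?P)"
      using AE_stopped pointwise by (intro nn_integral_mono_AE) (auto simp: AE_space)
    also have "\<dots> = ?O + ennreal (\<rho> * real k) + ennreal \<rho> * (\<Sum>i<n. emeasure ?P (Q i))"
    proof -
      have "(\<lambda>r. opt_cost m N k x0 (num_requests I r) r) \<in> borel_measurable ?P"
        using measurable_stopped_opt measurable_cong_sets[OF sets_law refl] by blast
      then show ?thesis
        using Q by (simp add: nn_integral_add nn_integral_cmult nn_integral_sum expected_opt_cost_def P.emeasure_space_1)
    qed
    also have "\<dots> \<le> ?O + ennreal (\<rho> * real k) + ennreal \<rho> * (\<Sum>i<n. ennreal (1 / 4) * emeasure ?P (S i))"
      using QS by (intro add_left_mono mult_left_mono sum_mono) auto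
    finally have main: "ennreal (3 / 4 * \<rho>) * (\<Sum>i<n. emeasure ?P (S i))
        \<le> ?O + ennreal (\<rho> * real k) + ennreal \<rho> * (\<Sum>i<n. ennreal (1 / 4) * emeasure ?P (S i))" .
    define a where "a = (\<Sum>i<n. measure ?P (S i))"
    have a: "(\<Sum>i<n. emeasure ?P (S i)) = ennreal a" "0 \<le> a"
      unfolding a_def by (auto simp: P.emeasure_eq_measure intro!: sum_nonneg)
    have "ennreal (3 / 4 * \<rho> * a) \<le> ennreal (o' + \<rho> * real k + \<rho> / 4 * a)"
      using main real \<rho> a(2)
      by (simp add: sum_distrib_left[symmetric] a(1) ennreal_mult[symmetric] ennreal_plus[symmetric] mult.assoc del: ennreal_plus)
    then have "3 / 4 * \<rho> * a \<le> o' + \<rho> * real k + \<rho> / 4 * a"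
      using real \<rho> a(2) by (subst (asm) ennreal_le_iff) auto
    then have "\<rho> / 2 * a \<le> o' + \<rho> * real k" by simp
    then show ?thesis
      using real \<rho> a by (simp add: ennreal_mult[symmetric] ennreal_plus[symmetric] ennreal_leI del: ennreal_plus)
  qed simp
  have "(\<integral>\<^sup>+r. ennreal (real (num_requests I r)) \<partial>?P) = (\<integral>\<^sup>+r. (\<Sum>i. indicator (S i) r) \<partial>?P)"
  proof (rule nn_integral_cong_AE)
    show "AE r in ?P. ennreal (real (num_requests I r)) = (\<Sum>i. indicator (S i) r)"
      using AE_stopped AE_space
    proof eventually_elim
      fix r assume st: "\<exists>t. stopped I t r" and r: "r \<in> space ?P"
      have "indicator (S i) r = (if i < num_requests I r then 1 else 0 :: ennreal)" for i
        using less_num_requests[OF st, of i] r by (simp add: S_def indicator_def space_law)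
      then have "(\<Sum>i. indicator (S i) r) = (\<Sum>i<num_requests I r. 1 :: ennreal)"
        by (subst suminf_finite[of "{..<num_requests I r}"]) auto
      then show "ennreal (real (num_requests I r)) = (\<Sum>i. indicator (S i) r)"
        by (simp add: ennreal_of_nat_eq_real_of_nat)
    qed
  qed
  also have "\<dots> = (\<Sum>i. emeasure ?P (S i))"
    using S by (subst nn_integral_suminf) auto
  also have "ennreal (\<rho> / 2) * (\<Sum>i. emeasure ?P (S i)) = (SUP n. ennreal (\<rho> / 2) * (\<Sum>i<n. emeasure ?P (S i)))"
    unfolding suminf_eq_SUP by (rule SUP_mult_left_ennreal)
  also have "\<dots> \<le> ?O + ennreal (\<rho> * real k)"
    by (rule SUP_least) (rule bound)
  finally show ?thesis .
qed

end

section \<open>The online algorithm\<close>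

context taxi_setting
begin

lemma nets_exist:
  obtains ctr :: "nat \<Rightarrow> nat \<Rightarrow> point" and n :: "nat \<Rightarrow> nat"
  where "\<And>j i. ctr j i \<in> M" "\<And>j. real (n j) \<le> (2 ^ (j + 2)) ^ m"
    "\<And>j x. x \<in> M \<Longrightarrow> \<exists>i<n j. ndist m N (ctr j i) x \<le> R * (1 / 2) ^ j"
proof -
  have "\<exists>c (n::nat). (\<forall>i. c i \<in> M) \<and> real n \<le> (2 ^ (j + 2)) ^ m
      \<and> (\<forall>x\<in>M. \<exists>i<n. ndist m N (c i) x \<le> R * (1 / 2) ^ j)" for j :: nat
  proof -
    have e: "0 < R * (1 / 2) ^ j" using R_pos by simp
    obtain P where P: "finite P" "P \<subseteq> M" "real (card P) \<le> (1 + 2 * R / (R * (1 / 2) ^ j)) ^ m"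
      and cov: "\<And>x. x \<in> M \<Longrightarrow> \<exists>p\<in>P. ndist m N p x \<le> R * (1 / 2) ^ j"
      by (rule net_exists[OF M z less_imp_le[OF R_pos] e unit_vol]) blast
    obtain f where f: "bij_betw f {0..<card P} P" using ex_bij_betw_nat_finite[OF P(1)] by blast
    \<comment> \<open>\<open>covered_space\<close> wants all centers in \<open>M\<close>, so the
      list is padded by a start position.\<close>
    define c where "c i = (if i < card P then f i else x0 0)" for i
    have "c i \<in> M" for i
      using f P(2) x0[of 0] k_pos by (auto simp: c_def bij_betw_def)
    moreover have "real (card P) \<le> (2 ^ (j + 2)) ^ m"
    proof -
      have "2 * R / (R * (1 / 2) ^ j) = 2 * 2 ^ j" using R_pos by (simp add: field_simps power_divide)
      moreover have "(1::real) \<le> 2 ^ j" by (rule two_realpow_ge_one)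
      ultimately have "1 + 2 * R / (R * (1 / 2) ^ j) \<le> 4 * 2 ^ j" by linarith
      also have "\<dots> = 2 ^ (j + 2)" by (simp add: power_add)
      finally have "1 + 2 * R / (R * (1 / 2) ^ j) \<le> 2 ^ (j + 2)" .
      then have "(1 + 2 * R / (R * (1 / 2) ^ j)) ^ m \<le> (2 ^ (j + 2)) ^ m"
        using R_pos by (intro power_mono) auto
      with P(3) show ?thesis by linarith
    qed
    moreover have "\<exists>i<card P. ndist m N (c i) x \<le> R * (1 / 2) ^ j" if "x \<in> M" for x
    proof -
      obtain p where p: "p \<in> P" "ndist m N p x \<le> R * (1 / 2) ^ j" using cov[OF \<open>x \<in> M\<close>] by blast
      then have "p \<in> f ` {0..<card P}" using f by (simp add: bij_betw_def)
      then obtain i where "i < card P" "p = f i" by auto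
      then show ?thesis using p by (intro exI[of _ i]) (simp add: c_def)
    qed
    ultimately show ?thesis by blast
  qed
  then obtain ctr n where "\<And>j. (\<forall>i. ctr j i \<in> M) \<and> real (n j) \<le> (2 ^ (j + 2)) ^ m
      \<and> (\<forall>x\<in>M. \<exists>i<n j. ndist m N (ctr j i) x \<le> R * (1 / 2) ^ j)"
    by metis
  then show ?thesis by (intro that[of ctr n]) auto
qed

end

locale taxi_algorithm = taxi_setting m N M z R k x0 + covered_space M "ndist m N" R ctr n L K
  for m N M z R k x0 ctr n L K
begin

text \<open>Seeds of an algorithm are reals, so the finitely many pairs of noise vectors are
  numbered. \<open>dec\<close> maps every real into their support.\<close>

definition enc :: "(nat \<times> nat \<Rightarrow> nat) \<times> (nat \<times> nat \<Rightarrow> nat) \<Rightarrow> real" where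
  "enc s = real (to_nat_on (set_pmf seeds) s)"

definition dec :: "real \<Rightarrow> (nat \<times> nat \<Rightarrow> nat) \<times> (nat \<times> nat \<Rightarrow> nat)" where
  "dec u = from_nat_into (set_pmf seeds) (nat \<lfloor>u\<rfloor>)"

definition alg :: online_alg where
  "alg = \<lparr>seed = measure_pmf (map_pmf enc seeds),
     dispatch = (\<lambda>u t h. online_taxi k (dec u) (source_pos k x0 h) (\<lambda>i. fst (h i)) t)\<rparr>"

lemma dec_enc: "s \<in> set_pmf seeds \<Longrightarrow> dec (enc s) = s"
  using countable_finite[OF finite_set_seeds] by (simp add: dec_def enc_def)

lemma dec_in: "dec u \<in> set_pmf seeds"
  unfolding dec_def by (rule from_nat_into) (simp add: set_pmf_not_empty)

lemma online_taxi_less: "online_taxi k s q A t < k"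
  by (simp add: online_taxi_def perturbed_taxi_def alg_taxi_less k_pos)

lemma online_taxi_cong:
  assumes "\<And>i. i \<le> t \<Longrightarrow> h i = h' i"
  shows "online_taxi k s (source_pos k x0 h) (\<lambda>i. fst (h i)) t = online_taxi k s (source_pos k x0 h') (\<lambda>i. fst (h' i)) t"
  unfolding online_taxi_def perturbed_taxi_def
  using assms by (intro alg_taxi_cong) (auto simp: source_pos_def)

lemma measurable_lab:
  assumes f: "f \<in> measurable Q (vol m)"
  shows "(\<lambda>x. lab u (f x)) \<in> measurable Q (count_space UNIV)"
  unfolding lab_def label_def
proof (rule measurable_map_upt)
  fix j
  have [measurable]: "(\<lambda>x. ndist m N (ctr j i) (f x)) \<in> borel_measurable Q" for i
    using ctr M_Rn f by (intro measurable_ndist) auto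
  show "(\<lambda>x. cell (ndist m N) R K ctr u j (f x)) \<in> measurable Q (count_space UNIV)"
    unfolding cell_def by measurable
qed

text \<open>For a fixed seed the decision depends on the history only through the labels of the
  requests, which form lists over a countable type. In particular the choice operator causes no
  problem.\<close>

lemma measurable_online_taxi:
  "(\<lambda>h. online_taxi k s (source_pos k x0 h) (\<lambda>i. fst (h i)) t)
     \<in> measurable (history_space m M {..t}) (count_space {..<k})"
proof -
  let ?lab = "lab (fst s)"
  let ?l1 = "\<lambda>h. map (\<lambda>i. ?lab (fst (h i))) [0..<Suc t]" and ?l2 = "\<lambda>h. map (\<lambda>i. ?lab (snd (h i))) [0..<Suc t]"
  define g where "g = (\<lambda>l1 l2. alg_taxi k (cut_dist wt L) (noise wt L K (snd s))
      (\<lambda>i. if i < k then ?lab (x0 i) else l2 ! (i - k)) (\<lambda>i. l1 ! i) t)"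
  have eq: "online_taxi k s (source_pos k x0 h) (\<lambda>i. fst (h i)) t = g (?l1 h) (?l2 h)" for h
    unfolding online_taxi_def perturbed_taxi_def g_def
    by (rule alg_taxi_cong) (auto simp: source_pos_def nth_append less_Suc_eq)
  have l1: "?l1 \<in> measurable (history_space m M {..t}) (count_space UNIV)"
    by (intro measurable_map_upt measurable_lab measurable_history_fst) auto
  have l2: "?l2 \<in> measurable (history_space m M {..t}) (count_space UNIV)"
    by (intro measurable_map_upt measurable_lab measurable_history_snd) auto
  have "(\<lambda>h. g a (?l2 h)) \<in> measurable (history_space m M {..t}) (count_space UNIV)" for a
    by (rule measurable_compose[OF l2]) simp
  from measurable_compose_countable[OF this l1]
  have "(\<lambda>h. g (?l1 h) (?l2 h)) \<in> measurable (history_space m M {..t}) (count_space UNIV)" .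
  then have "(\<lambda>h. online_taxi k s (source_pos k x0 h) (\<lambda>i. fst (h i)) t)
      \<in> measurable (history_space m M {..t}) (count_space UNIV)"
    unfolding eq .
  then show ?thesis
    by (rule measurable_count_space_extend[OF subset_UNIV, rotated]) (auto simp: online_taxi_less)
qed

lemma alg_is_online: "is_online_alg m M k alg"
  unfolding is_online_alg_def
proof (intro conjI allI)
  show "prob_space (seed alg)" by (simp add: alg_def measure_pmf.prob_space_axioms)
  fix t
  let ?Q = "seed alg \<Otimes>\<^sub>M history_space m M {..t}"
  have "(\<lambda>p. online_taxi k (dec (fst p)) (source_pos k x0 (snd p)) (\<lambda>i. fst (snd p i)) t) \<in> measurable ?Q (count_space {..<k})"
  proof (rule measurable_compose_countable'[where I = "set_pmf seeds" and g = "\<lambda>p. dec (fst p)"])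
    show "(\<lambda>p. online_taxi k s (source_pos k x0 (snd p)) (\<lambda>i. fst (snd p i)) t) \<in> measurable ?Q (count_space {..<k})" for s
      by (rule measurable_compose[OF measurable_snd measurable_online_taxi])
    have "dec \<in> measurable (seed alg) (count_space (set_pmf seeds))"
      unfolding alg_def by (simp add: measurable_def dec_in)
    then show "(\<lambda>p. dec (fst p)) \<in> measurable ?Q (count_space (set_pmf seeds))"
      by (rule measurable_compose[OF measurable_fst])
  qed (simp add: countable_finite finite_set_seeds)
  then show "(\<lambda>(u, h). dispatch alg u t h) \<in> measurable ?Q (count_space {..<k})"
    by (simp add: alg_def case_prod_unfold)
qed

lemma alg_cost_eq:
  "alg_cost m N x0 alg T r = ennreal (expect seeds
     (\<lambda>s. \<Sum>t<T. ndist m N (source_pos k x0 r (src k (online_taxi k s (source_pos k x0 r) (\<lambda>i. fst (r i))) t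
        (online_taxi k s (source_pos k x0 r) (\<lambda>i. fst (r i)) t))) (fst (r t))))"
proof -
  let ?c = "\<lambda>s. online_taxi k s (source_pos k x0 r) (\<lambda>i. fst (r i))"
  let ?X = "\<lambda>s. \<Sum>t<T. ndist m N (source_pos k x0 r (src k (?c s) t (?c s t))) (fst (r t))"
  have X: "taxi_cost m N x0 T r (?c s) = ?X s" for s
    by (rule taxi_cost_eq) (simp add: online_taxi_less)
  have "online_taxi k s (source_pos k x0 (restrict r {..t})) (\<lambda>i. fst (restrict r {..t} i)) t = ?c s t" for s t
    by (rule online_taxi_cong) simp
  then have disp: "(\<lambda>t. dispatch alg u t (restrict r {..t})) = ?c (dec u)" for u
    by (simp add: alg_def)
  have "alg_cost m N x0 alg T r = (\<integral>\<^sup>+u. ennreal (?X (dec u)) \<partial>map_pmf enc seeds)"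
    unfolding alg_cost_def disp X by (simp add: alg_def)
  also have "\<dots> = (\<integral>\<^sup>+s. ennreal (?X (dec (enc s))) \<partial>seeds)" by simp
  also have "\<dots> = (\<integral>\<^sup>+s. ennreal (?X s) \<partial>seeds)"
    by (intro nn_integral_cong_AE) (auto simp: AE_measure_pmf_iff dec_enc)
  also have "\<dots> = ennreal (expect seeds ?X)"
    by (intro nn_integral_eq_integral integrable_measure_pmf_finite finite_set_seeds)
       (auto intro!: sum_nonneg ndist_nonneg)
  finally show ?thesis .
qed

lemma source_pos_in:
  assumes "r \<in> space (history_space m M UNIV)"
  shows "source_pos k x0 r s \<in> M" and "fst (r t) \<in> M"
proof -
  have "r i \<in> M \<times> M" for i using assms by (auto simp: space_PiM PiE_iff space_request_space)
  then have "fst (r i) \<in> M" "snd (r i) \<in> M" for i by (simp_all add: mem_Times_iff)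
  then show "source_pos k x0 r s \<in> M" "fst (r t) \<in> M" using x0 by (simp_all add: source_pos_def)
qed

text \<open>The trivial bound that settles the case of high dimension.\<close>

lemma alg_cost_le_diam:
  assumes r: "r \<in> space (history_space m M UNIV)"
  shows "alg_cost m N x0 alg T r \<le> ennreal (2 * R * real T)"
  unfolding alg_cost_eq
proof (intro ennreal_leI)
  let ?c = "\<lambda>s. online_taxi k s (source_pos k x0 r) (\<lambda>i. fst (r i))"
  have "expect seeds (\<lambda>s. \<Sum>t<T. ndist m N (source_pos k x0 r (src k (?c s) t (?c s t))) (fst (r t)))
      \<le> expect seeds (\<lambda>_. \<Sum>t<T. 2 * R)"
    by (intro expectation_mono_finite[OF finite_set_seeds] sum_mono M_diam source_pos_in[OF r])
  then show "expect seeds (\<lambda>s. \<Sum>t<T. ndist m N (source_pos k x0 r (src k (?c s) t (?c s t))) (fst (r t)))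
      \<le> 2 * R * real T" by (simp add: mult.commute)
qed

lemma alg_cost_bound:
  assumes r: "r \<in> space (history_space m M UNIV)" and J: "J \<le> L" and Z: "2 \<le> Z" and Y: "2 \<le> Y"
    and n: "\<And>j. j \<le> J \<Longrightarrow> real (n j) * exp (1 - Y\<^sup>2) \<le> 1"
  shows "alg_cost m N x0 alg T r \<le> ennreal (16 * (real (J + 1))\<^sup>2 * rate Z * rate Y * opt_cost m N k x0 T r
         + real T * R * (8 * real (J + 1) * rate Z * ((4 * rate Y + real k + 1) / real K + (1 / 2) ^ J)
             + 16 * slack Z + 12 * (1 / 2) ^ J)
         + 16 * real (J + 1) * rate Z * real k * R)"
proof -
  obtain c where c: "c \<in> {..<T} \<rightarrow> {..<k}" "opt_cost m N k x0 T r = taxi_cost m N x0 T r c"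
    by (rule opt_cost_attained[OF k_pos])
  show ?thesis
    unfolding alg_cost_eq c(2) taxi_cost_eq[OF c(1)]
    using source_pos_in[OF r] by (intro ennreal_leI online_taxi_cost k_pos c(1) J Z Y n) auto
qed

end

section \<open>Competitive ratio\<close>

text \<open>An error \<open>S\<close> per request is charged to the optimum, which pays
  \<open>\<rho> / 2\<close> per request in expectation. This is why it enters the ratio as
  \<open>2 * S / \<rho>\<close>.\<close>

lemma expected_alg_cost_le:
  assumes I: "smooth_setting m N M z R k x0 \<sigma> I"
    and A: "\<And>r T. r \<in> space (history_space m M UNIV)
      \<Longrightarrow> alg_cost m N x0 A T r \<le> ennreal (C * opt_cost m N k x0 T r + real T * S + \<alpha>)"
    and C: "0 \<le> C" and S: "0 \<le> S" and \<alpha>: "0 \<le> \<alpha>"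
    and \<rho>: "0 < \<rho>" and eq: "(\<rho> / R) ^ m = \<sigma> / (16 * real k)"
  shows "expected_alg_cost m N M x0 A I
       \<le> ennreal (C + 2 * S / \<rho>) * expected_opt_cost m N M k x0 I + ennreal (2 * S * real k + \<alpha>)"
proof -
  interpret smooth_setting m N M z R k x0 \<sigma> I by (rule I)
  interpret P: prob_space "request_law m M I" by (rule prob_space_law)
  let ?P = "request_law m M I" and ?O = "expected_opt_cost m N M k x0 I"
  let ?opt = "\<lambda>r. opt_cost m N k x0 (num_requests I r) r" and ?T = "\<lambda>r. real (num_requests I r)"
  have [measurable]: "?opt \<in> borel_measurable ?P"
    using measurable_stopped_opt measurable_cong_sets[OF sets_law refl] by blast
  have "num_requests I \<in> measurable ?P (count_space UNIV)"
    using measurable_num_requests measurable_cong_sets[OF sets_law refl] by blast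
  from measurable_compose[OF this, of real borel]
  have [measurable]: "?T \<in> borel_measurable ?P" by simp
  have opt0: "0 \<le> opt_cost m N k x0 T r" for T r by (intro opt_cost_nonneg k_pos ndist_nonneg)
  have "expected_alg_cost m N M x0 A I
      \<le> (\<integral>\<^sup>+r. ennreal C * ennreal (?opt r) + ennreal S * ennreal (?T r) + ennreal \<alpha> \<partial>?P)"
    unfolding expected_alg_cost_def
  proof (rule nn_integral_mono)
    fix r assume r: "r \<in> space ?P"
    have "alg_cost m N x0 A (num_requests I r) r \<le> ennreal (C * ?opt r + ?T r * S + \<alpha>)"
      using r by (intro A) (simp add: space_law)
    also have "\<dots> = ennreal C * ennreal (?opt r) + ennreal S * ennreal (?T r) + ennreal \<alpha>"
      using C S \<alpha> opt0 by (simp add: ennreal_mult[symmetric] ennreal_plus[symmetric] mult.commute del: ennreal_plus)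
    finally show "alg_cost m N x0 A (num_requests I r) r \<le> \<dots>" .
  qed
  also have "\<dots> = ennreal C * ?O + ennreal S * (\<integral>\<^sup>+r. ennreal (?T r) \<partial>?P) + ennreal \<alpha>"
    by (simp add: nn_integral_add nn_integral_cmult expected_opt_cost_def P.emeasure_space_1)
  also have "ennreal S * (\<integral>\<^sup>+r. ennreal (?T r) \<partial>?P) = ennreal (2 * S / \<rho>) * (ennreal (\<rho> / 2) * (\<integral>\<^sup>+r. ennreal (?T r) \<partial>?P))"
    using S \<rho> by (simp add: mult.assoc[symmetric] ennreal_mult[symmetric])
  also have "\<dots> \<le> ennreal (2 * S / \<rho>) * (?O + ennreal (\<rho> * real k))"
    by (intro mult_left_mono expected_num_requests \<rho> eq) auto
  also have "ennreal C * ?O + ennreal (2 * S / \<rho>) * (?O + ennreal (\<rho> * real k)) + ennreal \<alpha>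
      = ennreal (C + 2 * S / \<rho>) * ?O + ennreal (2 * S * real k + \<alpha>)"
  proof -
    have "ennreal (2 * S / \<rho>) * ennreal (\<rho> * real k) = ennreal (2 * S * real k)"
      using S \<rho> by (simp add: ennreal_mult[symmetric])
    then show ?thesis using C S \<rho> \<alpha> by (simp add: algebra_simps ennreal_plus)
  qed
  finally show ?thesis by (simp add: add_right_mono add_left_mono)
qed

section \<open>Choice of the parameters\<close>

lemma two_power_le_exp: "2 ^ J \<le> exp (real J)"
proof -
  have "2 \<le> exp (1 :: real)" using exp_ge_add_one_self[of 1] by simp
  then have "2 ^ J \<le> exp (1 :: real) ^ J" by (intro power_mono) auto
  also have "\<dots> = exp (real J)" by (simp add: exp_of_nat_mult[symmetric])
  finally show ?thesis .
qed

lemma exp_half_power: "exp (- real J) \<le> (1 / 2) ^ J"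
  using two_power_le_exp[of J] by (simp add: exp_minus power_one_over field_simps)

lemma rate_sqrt_le:
  assumes "4 \<le> a" shows "rate (sqrt a) \<le> 2 * a\<^sup>2"
proof -
  have "1 \<le> sqrt a" using assms by simp
  then have "sqrt a ^ 3 \<le> sqrt a ^ 4" by (intro power_increasing) auto
  also have "\<dots> = (sqrt a ^ 2) ^ 2" by (simp add: power_mult[symmetric])
  finally show ?thesis using assms by (simp add: rate_def)
qed

text \<open>With \<open>Z\<^sup>2 = J + 4\<close> the factor \<open>exp (1 - Z\<^sup>2)\<close> is
  below \<open>(1 / 2) ^ J\<close>, like the truncated levels and the resolution. The constant is 76
  = 32 + 32 + 12.\<close>

lemma slack_bound:
  fixes J :: nat and \<kappa> :: real
  assumes \<kappa>: "0 \<le> \<kappa>" "\<kappa> \<le> (1 / 2) ^ J"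
  defines "a \<equiv> real J + 4"
  shows "8 * real (J + 1) * rate (sqrt a) * (\<kappa> + (1 / 2) ^ J) + 16 * slack (sqrt a) + 12 * (1 / 2) ^ J
       \<le> 76 * a ^ 3 * (1 / 2) ^ J"
proof -
  let ?h = "(1 / 2 :: real) ^ J"
  have a: "4 \<le> a" by (simp add: a_def)
  have r: "0 \<le> rate (sqrt a)" "rate (sqrt a) \<le> 2 * a\<^sup>2"
    using a rate_sqrt_le by (auto simp: rate_nonneg)
  have a3: "a\<^sup>2 \<le> a ^ 3" "1 \<le> a ^ 3" using a by (auto intro!: power_increasing one_le_power)
  have "8 * real (J + 1) * rate (sqrt a) * (\<kappa> + ?h) \<le> 8 * a * (2 * a\<^sup>2) * (2 * ?h)"
    using a r \<kappa> by (intro mult_mono) (auto simp: a_def)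
  also have "\<dots> = 32 * a ^ 3 * ?h" by (simp add: power2_eq_square power3_eq_cube)
  finally have 1: "8 * real (J + 1) * rate (sqrt a) * (\<kappa> + ?h) \<le> 32 * a ^ 3 * ?h" .
  have r3: "rate (sqrt a) \<le> 2 * a ^ 3" using r a3 by linarith
  have "exp (1 - (sqrt a)\<^sup>2) \<le> exp (- real J)" using a by (simp add: a_def)
  also have "\<dots> \<le> ?h" by (rule exp_half_power)
  finally have "16 * (rate (sqrt a) * exp (1 - (sqrt a)\<^sup>2)) \<le> 16 * (2 * a ^ 3 * ?h)"
    using r r3 a by (intro mult_left_mono mult_mono) auto
  then have 2: "16 * slack (sqrt a) \<le> 32 * a ^ 3 * ?h"
    by (simp add: slack_def rate_def)
  have 3: "12 * ?h \<le> 12 * a ^ 3 * ?h" using a3 by simp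
  show ?thesis using 1 2 3 by linarith
qed

text \<open>The two rates together give \<open>a ^ 3\<close>, and \<open>m\<close> enters to the
  power \<open>3 / 2\<close> only, rounded up to 2. It must stay below 5 as \<open>a\<close> is
  later of order \<open>l / m\<close>.\<close>

lemma rate_product_bound:
  fixes J m :: nat
  assumes m: "0 < m"
  defines "a \<equiv> real J + 4"
  shows "16 * (real (J + 1))\<^sup>2 * rate (sqrt a) * rate (sqrt (real m * a)) \<le> 64 * (real m)\<^sup>2 * a ^ 5"
proof -
  have a: "4 \<le> a" by (simp add: a_def)
  have m1: "1 \<le> sqrt (real m)" using m by simp
  have "sqrt a ^ 3 * sqrt a ^ 3 = a ^ 3"
    using a by (simp add: power_mult_distrib[symmetric])
  then have "rate (sqrt a) * rate (sqrt (real m * a)) = 4 * (sqrt (real m) ^ 3 * a ^ 3)"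
    by (simp add: rate_def real_sqrt_mult power_mult_distrib)
  also have "\<dots> \<le> 4 * (sqrt (real m) ^ 4 * a ^ 3)"
    using m1 a by (intro mult_left_mono mult_mono power_increasing) auto
  also have "sqrt (real m) ^ 4 = (real m)\<^sup>2"
    using power_mult[of "sqrt (real m)" 2 2] by simp
  finally have p: "rate (sqrt a) * rate (sqrt (real m * a)) \<le> 4 * ((real m)\<^sup>2 * a ^ 3)" .
  have "(real (J + 1))\<^sup>2 * (rate (sqrt a) * rate (sqrt (real m * a))) \<le> a\<^sup>2 * (4 * ((real m)\<^sup>2 * a ^ 3))"
    using a by (intro mult_mono[OF _ p] power_mono mult_nonneg_nonneg) (auto simp: a_def rate_nonneg)
  also have "\<dots> = 4 * ((real m)\<^sup>2 * a ^ 5)" by (simp add: eval_nat_numeral)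
  finally show ?thesis unfolding mult.assoc by linarith
qed

text \<open>The exponent is at most \<open>(J + 2) * m + 1 - m * (J + 4) = 1 - 2 * m\<close>. The
  summand 4 also makes both thresholds at least 2.\<close>

lemma net_size_bound:
  assumes "0 < m" "j \<le> J" "n \<le> (2 ^ (j + 2)) ^ m"
  shows "n * exp (1 - (sqrt (real m * (real J + 4)))\<^sup>2) \<le> 1"
proof -
  have "(2 ^ (j + 2)) ^ m \<le> ((2::real) ^ (J + 2)) ^ m"
    using assms by (intro power_mono power_increasing) auto
  also have "\<dots> = 2 ^ ((J + 2) * m)" by (simp only: power_mult)
  also have "\<dots> \<le> exp (real ((J + 2) * m))" by (rule two_power_le_exp)
  finally have "n \<le> exp (real ((J + 2) * m))" using assms by linarith
  then have "n * exp (1 - real m * (real J + 4)) \<le> exp (real ((J + 2) * m)) * exp (1 - real m * (real J + 4))"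
    by (intro mult_right_mono) auto
  also have "\<dots> = exp (1 - 2 * real m)" by (simp add: mult_exp_exp algebra_simps)
  also have "\<dots> \<le> 1" using assms by simp
  finally show ?thesis by simp
qed

text \<open>Chosen such that \<open>(R / \<rho>)\<^sup>2 \<le> 2 ^ levels m k \<sigma>\<close> for the
  radius \<open>\<rho>\<close> with \<open>(\<rho> / R) ^ m = \<sigma> / (16 * k)\<close>.\<close>

definition levels :: "nat \<Rightarrow> nat \<Rightarrow> real \<Rightarrow> nat" where
  "levels m k \<sigma> = nat \<lceil>2 * ln (16 * real k / \<sigma>) / (real m * ln 2)\<rceil>"

lemma levels_antimono:
  assumes "0 < k" "0 < \<sigma>\<^sub>0" "\<sigma>\<^sub>0 \<le> \<sigma>"
  shows "levels m k \<sigma> \<le> levels m k \<sigma>\<^sub>0"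
proof -
  have "ln (16 * real k / \<sigma>) \<le> ln (16 * real k / \<sigma>\<^sub>0)"
    using assms by (intro ln_mono divide_left_mono) auto
  then show ?thesis
    unfolding levels_def by (intro nat_mono ceiling_mono divide_right_mono mult_left_mono) auto
qed

lemma ln_scale_bound:
  assumes "0 < k" "0 < \<sigma>"
  shows "ln (16 * real k / \<sigma>) \<le> 5 * max 1 (ln (real k / \<sigma>))"
proof -
  have "ln (16 * real k / \<sigma>) = ln 16 + ln (real k / \<sigma>)"
    using assms by (simp add: ln_mult ln_div)
  moreover have "ln (16::real) = 4 * ln 2"
    using ln_realpow[of "2::real" 4] by simp
  moreover have "ln (2::real) \<le> 1" using ln_le_minus_one[of "2::real"] by simp
  ultimately show ?thesis by (simp add: max_def)
qed

text \<open>20 comes from \<open>2 * 5 / (1 / 2)\<close>, with 5 from \<open>ln_scale_bound\<close>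
  and \<open>1 / 2\<close> below \<open>ln 2\<close>. The ceiling and the summand 4 add 5, which
  \<open>m \<le> l\<close> absorbs.\<close>

lemma levels_bound:
  assumes "0 < k" "0 < \<sigma>" "0 < m" and m: "real m \<le> max 1 (ln (real k / \<sigma>))"
  shows "real (levels m k \<sigma>) + 4 \<le> 25 * max 1 (ln (real k / \<sigma>)) / real m"
proof -
  let ?l = "max 1 (ln (real k / \<sigma>))"
  have ln2: "1 / 2 \<le> ln (2::real)" using ln2_ge_two_thirds by simp
  have "2 * ln (16 * real k / \<sigma>) / (real m * ln 2) \<le> 2 * (5 * ?l) / (real m * ln 2)"
    using ln_scale_bound[OF assms(1,2)] by (intro divide_right_mono mult_left_mono) auto
  also have "\<dots> \<le> 2 * (5 * ?l) / (real m * (1 / 2))"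
    using assms ln2 by (intro divide_left_mono mult_left_mono mult_pos_pos) (auto simp: max_def)
  also have "\<dots> = 20 * ?l / real m" by simp
  finally have b: "2 * ln (16 * real k / \<sigma>) / (real m * ln 2) \<le> 20 * ?l / real m" .
  have "0 \<le> 20 * ?l / real m" by (simp add: max_def)
  with b have "real (levels m k \<sigma>) \<le> 20 * ?l / real m + 1"
    unfolding levels_def by linarith
  moreover have "5 \<le> 5 * ?l / real m" using m assms by (simp add: field_simps)
  ultimately show ?thesis by (simp add: add_divide_distrib[symmetric])
qed

lemma radius_exists:
  assumes k: "0 < k" and \<sigma>: "0 < \<sigma>" "\<sigma> \<le> 1" and m: "0 < m" and R: "0 < R"
  obtains \<rho> where "0 < \<rho>" "\<rho> \<le> R" "(\<rho> / R) ^ m = \<sigma> / (16 * real k)"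
    "(R / \<rho>)\<^sup>2 * (1 / 2) ^ levels m k \<sigma> \<le> 1" "real m * ln (R / \<rho>) = ln (16 * real k / \<sigma>)"
proof -
  define \<rho> where "\<rho> = R * root m (\<sigma> / (16 * real k))"
  have q: "0 < \<sigma> / (16 * real k)" "\<sigma> / (16 * real k) \<le> 1" using k \<sigma> by (auto simp: field_simps)
  have \<rho>: "0 < \<rho>" using R q m by (simp add: \<rho>_def)
  have le: "\<rho> \<le> R" using R q m by (simp add: \<rho>_def mult_le_cancel_left1)
  have eq: "(\<rho> / R) ^ m = \<sigma> / (16 * real k)" using R q m by (simp add: \<rho>_def)
  have pos: "0 < R / \<rho>" using R \<rho> by simp
  have "(R / \<rho>) ^ m = 16 * real k / \<sigma>"
  proof -
    have "(R / \<rho>) ^ m = inverse ((\<rho> / R) ^ m)" by (simp add: power_inverse[symmetric])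
    then show ?thesis unfolding eq by (simp add: field_simps)
  qed
  then have ln: "real m * ln (R / \<rho>) = ln (16 * real k / \<sigma>)"
    using ln_realpow[of "R / \<rho>" m] by simp
  have "2 * ln (R / \<rho>) \<le> real (levels m k \<sigma>) * ln 2"
  proof -
    have "2 * ln (16 * real k / \<sigma>) / (real m * ln 2) \<le> real (levels m k \<sigma>)"
      unfolding levels_def by linarith
    then have "2 * (real m * ln (R / \<rho>)) \<le> real (levels m k \<sigma>) * (real m * ln 2)"
      using m by (simp add: ln pos_divide_le_eq)
    then have "real m * (2 * ln (R / \<rho>)) \<le> real m * (real (levels m k \<sigma>) * ln 2)" by (simp add: mult_ac)
    then show ?thesis using m by simp
  qed
  then have "ln ((R / \<rho>)\<^sup>2) \<le> ln (2 ^ levels m k \<sigma>)"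
    using pos by (simp add: ln_realpow)
  then have "(R / \<rho>)\<^sup>2 \<le> 2 ^ levels m k \<sigma>" using pos by (subst (asm) ln_le_cancel_iff) auto
  then have "(R / \<rho>)\<^sup>2 * (1 / 2) ^ levels m k \<sigma> \<le> 2 ^ levels m k \<sigma> * (1 / 2) ^ levels m k \<sigma>"
    by (rule mult_right_mono) simp
  also have "\<dots> = 1" by (simp add: power_mult_distrib[symmetric])
  finally have "(R / \<rho>)\<^sup>2 * (1 / 2) ^ levels m k \<sigma> \<le> 1" .
  then show ?thesis using that \<rho> le eq ln by blast
qed

context taxi_setting
begin

text \<open>The algorithm is fixed before \<open>\<sigma>\<close> is: \<open>L\<close> and
  \<open>K\<close> come from \<open>\<sigma>\<^sub>0\<close>, while \<open>J\<close>,
  \<open>\<rho>\<close> and the thresholds come from \<open>\<sigma>\<close> and occur only in the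
  analysis.\<close>

lemma competitive_algorithm_exists:
  assumes \<sigma>0: "0 < \<sigma>\<^sub>0"
  shows "\<exists>A. is_online_alg m M k A \<and> (\<forall>\<sigma>. \<sigma>\<^sub>0 \<le> \<sigma> \<and> \<sigma> \<le> 1 \<longrightarrow>
    competitive_on_smooth m N M (closed_ball m N z R) k x0 \<sigma> (216 * 25 ^ 5 * max 1 (ln (real k / \<sigma>)) ^ 5) A)"
proof -
  obtain ctr :: "nat \<Rightarrow> nat \<Rightarrow> point" and n :: "nat \<Rightarrow> nat"
    where nets: "\<And>j i. ctr j i \<in> M" "\<And>j. real (n j) \<le> (2 ^ (j + 2)) ^ m"
      "\<And>j x. x \<in> M \<Longrightarrow> \<exists>i<n j. ndist m N (ctr j i) x \<le> R * (1 / 2) ^ j"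
    by (rule nets_exist) blast
  define L where "L = levels m k \<sigma>\<^sub>0"
  \<comment> \<open>\<open>Q\<close> dominates \<open>4 * rate Y + k + 1\<close> for each
    \<open>Y\<close> that can occur, so \<open>K\<close> is fine enough to push the discretization
    error below \<open>(1 / 2) ^ L\<close>, hence below \<open>(1 / 2) ^ J\<close>.\<close>
  define Q where "Q = 4 * rate (sqrt (real m * (real L + 4))) + real k + 1"
  define K where "K = nat \<lceil>Q * 2 ^ L\<rceil>"
  have Q: "1 \<le> Q" by (simp add: Q_def rate_nonneg)
  then have "0 < Q * 2 ^ L" by simp
  then have K: "0 < K" "Q * 2 ^ L \<le> real K" unfolding K_def by linarith+
  interpret taxi_algorithm m N M z R k x0 ctr n L K
  proof unfold_locales
    show "ndist m N x y = ndist m N y x" for x y by (rule ndist_sym)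
  qed (use nets ndist_nonneg ndist_triangle M_diam K R_pos in auto)
  show ?thesis
  proof (intro exI[of _ alg] conjI allI impI alg_is_online)
    fix \<sigma> assume s: "\<sigma>\<^sub>0 \<le> \<sigma> \<and> \<sigma> \<le> 1"
    then have \<sigma>: "0 < \<sigma>" "\<sigma> \<le> 1" using \<sigma>0 by auto
    define l where "l = max 1 (ln (real k / \<sigma>))"
    have l: "1 \<le> l" by (simp add: l_def)
    define J where "J = levels m k \<sigma>"
    obtain \<rho> where \<rho>: "0 < \<rho>" "\<rho> \<le> R" and eq: "(\<rho> / R) ^ m = \<sigma> / (16 * real k)"
      and sq: "(R / \<rho>)\<^sup>2 * (1 / 2) ^ J \<le> 1" and lnx: "real m * ln (R / \<rho>) = ln (16 * real k / \<sigma>)"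
      unfolding J_def by (rule radius_exists[OF k_pos \<sigma> m_pos R_pos])
    have x1: "1 \<le> R / \<rho>" using \<rho> by simp
    have setting: "smooth_setting m N M z R k x0 \<sigma> I"
      if "smooth_instance m M (closed_ball m N z R) \<sigma> I" for I
      by unfold_locales (use that \<sigma> in auto)
    have "\<exists>c \<alpha>. 0 \<le> \<alpha> \<and> c \<le> 216 * 25 ^ 5 * l ^ 5 \<and> (\<forall>I. smooth_instance m M (closed_ball m N z R) \<sigma> I \<longrightarrow>
        expected_alg_cost m N M x0 alg I \<le> ennreal c * expected_opt_cost m N M k x0 I + ennreal \<alpha>)"
    \<comment> \<open>For larger \<open>m\<close>, \<open>m * ln (R / \<rho>) \<le> 5 * l\<close>
      gives \<open>R / \<rho> \<le> exp 5\<close>, so a cost of \<open>2 * R\<close> per request is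
      only a constant factor above \<open>\<rho>\<close>.\<close>
    proof (cases "real m \<le> l")
      case True
      define a where "a = real J + 4"
      define Z where "Z = sqrt a"
      define Y where "Y = sqrt (real m * a)"
      define \<kappa> where "\<kappa> = (4 * rate Y + real k + 1) / real K"
      define S where "S = 8 * real (J + 1) * rate Z * (\<kappa> + (1 / 2) ^ J) + 16 * slack Z + 12 * (1 / 2) ^ J"
      define C where "C = 16 * (real (J + 1))\<^sup>2 * rate Z * rate Y"
      define \<alpha> where "\<alpha> = 16 * real (J + 1) * rate Z * real k * R"
      have a: "4 \<le> a" by (simp add: a_def)
      have m1: "1 \<le> real m" using m_pos by simp
      have ma: "4 \<le> real m * a" using mult_mono[of 1 "real m" 4 a] a m1 by simp
      have ZY: "2 \<le> Z" "2 \<le> Y" using a ma by (simp_all add: Z_def Y_def real_le_rsqrt)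
      have JL: "J \<le> L" unfolding J_def L_def using s \<sigma>0 by (intro levels_antimono k_pos) auto
      have YL: "Y \<le> sqrt (real m * (real L + 4))" using JL by (simp add: Y_def a_def mult_left_mono)
      have \<kappa>: "0 \<le> \<kappa>" "\<kappa> \<le> (1 / 2) ^ J"
      proof -
        show "0 \<le> \<kappa>" using ZY by (simp add: \<kappa>_def rate_nonneg)
        have "Y ^ 3 \<le> sqrt (real m * (real L + 4)) ^ 3" using YL ZY by (intro power_mono) auto
        then have "4 * rate Y + real k + 1 \<le> Q" by (simp add: Q_def rate_def)
        then have "\<kappa> \<le> Q / real K" unfolding \<kappa>_def by (rule divide_right_mono) simp
        also have "\<dots> \<le> Q / (Q * 2 ^ L)" using K Q by (intro divide_left_mono) auto
        also have "\<dots> = (1 / 2) ^ L" using Q by (simp add: power_one_over)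
        also have "\<dots> \<le> (1 / 2) ^ J" using JL by (intro power_decreasing) auto
        finally show "\<kappa> \<le> (1 / 2) ^ J" .
      qed
      have S0: "0 \<le> S" unfolding S_def using ZY \<kappa> by (simp add: rate_nonneg slack_nonneg)
      have C0: "0 \<le> C" and \<alpha>0: "0 \<le> \<alpha>" using ZY R_pos by (simp_all add: C_def \<alpha>_def rate_nonneg)
      have cost: "alg_cost m N x0 alg T r \<le> ennreal (C * opt_cost m N k x0 T r + real T * (R * S) + \<alpha>)"
        if r: "r \<in> space (history_space m M UNIV)" for r T
      proof -
        have "real (n j) * exp (1 - Y\<^sup>2) \<le> 1" if "j \<le> J" for j
          unfolding Y_def a_def by (rule net_size_bound[OF m_pos that nets(2)])
        from alg_cost_bound[OF r JL ZY this]
        show ?thesis unfolding C_def S_def \<alpha>_def \<kappa>_def by (simp only: mult.assoc)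
      qed
      let ?c = "C + 2 * (R * S) / \<rho>"
      have main: "expected_alg_cost m N M x0 alg I \<le> ennreal ?c * expected_opt_cost m N M k x0 I
            + ennreal (2 * (R * S) * real k + \<alpha>)"
        if "smooth_instance m M (closed_ball m N z R) \<sigma> I" for I
        using setting[OF that] cost C0 S0 \<alpha>0 R_pos \<rho> eq by (intro expected_alg_cost_le) auto
      have "?c \<le> 216 * 25 ^ 5 * l ^ 5"
      proof -
        have "S \<le> 76 * a ^ 3 * (1 / 2) ^ J"
          unfolding S_def Z_def a_def by (rule slack_bound[OF \<kappa>])
        then have "R / \<rho> * S \<le> R / \<rho> * (76 * a ^ 3 * (1 / 2) ^ J)" using x1 by (intro mult_left_mono) auto
        also have "\<dots> = 76 * a ^ 3 * (R / \<rho> * (1 / 2) ^ J)" by simp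
        also have "R / \<rho> * (1 / 2) ^ J \<le> (R / \<rho>)\<^sup>2 * (1 / 2) ^ J"
          using x1 power_increasing[of 1 2 "R / \<rho>"] by (intro mult_right_mono) auto
        also note sq
        finally have RS: "R / \<rho> * S \<le> 76 * a ^ 3" using a by simp
        have "a ^ 3 \<le> (real m)\<^sup>2 * a ^ 5"
          using mult_mono[of 1 "(real m)\<^sup>2" "a ^ 3" "a ^ 5"] m1 a power_increasing[of 3 5 a] by simp
        moreover have "C \<le> 64 * (real m)\<^sup>2 * a ^ 5"
          unfolding C_def Z_def Y_def a_def by (rule rate_product_bound[OF m_pos])
        \<comment> \<open>216 = 64 + 2 * 76.\<close>
        ultimately have "?c \<le> 216 * ((real m)\<^sup>2 * a ^ 5)" using RS by simp
        also have "(real m)\<^sup>2 * a ^ 5 \<le> (real m)\<^sup>2 * (25 * l / real m) ^ 5"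
          using levels_bound[OF k_pos \<sigma>(1) m_pos] True a unfolding a_def J_def l_def
          by (intro mult_left_mono power_mono) auto
        also have "(real m)\<^sup>2 * (25 * l / real m) ^ 5 = 25 ^ 5 * l ^ 5 / real m ^ 3"
          using m1 by (simp add: power_divide power_mult_distrib eval_nat_numeral)
        also have "\<dots> \<le> 25 ^ 5 * l ^ 5 / 1"
          using m1 l by (intro divide_left_mono) (auto intro!: one_le_power)
        finally show ?thesis by simp
      qed
      with main S0 \<alpha>0 R_pos show ?thesis
        by (intro exI[of _ ?c] exI[of _ "2 * (R * S) * real k + \<alpha>"]) auto
    next
      case False
      have "real m * ln (R / \<rho>) \<le> real m * 5"
        using ln_scale_bound[OF k_pos \<sigma>(1)] False lnx by (simp add: l_def)
      then have "ln (R / \<rho>) \<le> 5" using m_pos by simp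
      then have "R / \<rho> \<le> exp 5" using x1 by (metis exp_le_cancel_iff exp_ln_iff less_le_trans zero_less_one)
      also have "exp (5 :: real) = exp 1 ^ 5" by (simp add: exp_of_nat_mult[symmetric])
      also have "\<dots> \<le> 3 ^ 5" using exp_le by (intro power_mono) auto
      finally have x: "R / \<rho> \<le> 3 ^ 5" .
      let ?c = "0 + 2 * (2 * R) / \<rho>"
      have cost: "alg_cost m N x0 alg T r \<le> ennreal (0 * opt_cost m N k x0 T r + real T * (2 * R) + 0)"
        if "r \<in> space (history_space m M UNIV)" for r T
        using alg_cost_le_diam[OF that, of T] by (simp add: mult_ac)
      have main: "expected_alg_cost m N M x0 alg I \<le> ennreal ?c * expected_opt_cost m N M k x0 I
            + ennreal (2 * (2 * R) * real k + 0)"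
        if "smooth_instance m M (closed_ball m N z R) \<sigma> I" for I
        by (rule expected_alg_cost_le[OF setting[OF that] cost]) (use R_pos \<rho> eq in auto)
      have "?c = 4 * (R / \<rho>)" by simp
      also have "\<dots> \<le> 4 * 3 ^ 5" using x by simp
      also have "\<dots> \<le> 216 * 25 ^ 5 * 1 ^ 5" by simp
      also have "\<dots> \<le> 216 * 25 ^ 5 * l ^ 5" using l by (intro mult_left_mono power_mono) auto
      finally have "?c \<le> 216 * 25 ^ 5 * l ^ 5" .
      with main R_pos show ?thesis
        by (intro exI[of _ ?c] exI[of _ "2 * (2 * R) * real k + 0"]) auto
    qed
    then obtain c \<alpha> where c: "0 \<le> \<alpha>" "c \<le> 216 * 25 ^ 5 * l ^ 5"
      and main: "\<And>I. smooth_instance m M (closed_ball m N z R) \<sigma> I \<Longrightarrow>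
        expected_alg_cost m N M x0 alg I \<le> ennreal c * expected_opt_cost m N M k x0 I + ennreal \<alpha>"
      by blast
    have "expected_alg_cost m N M x0 alg I
        \<le> ennreal (216 * 25 ^ 5 * l ^ 5) * expected_opt_cost m N M k x0 I + ennreal \<alpha>"
      if "smooth_instance m M (closed_ball m N z R) \<sigma> I" for I
      using main[OF that] by (rule order_trans) (intro add_right_mono mult_right_mono ennreal_leI c, simp)
    then show "competitive_on_smooth m N M (closed_ball m N z R) k x0 \<sigma> (216 * 25 ^ 5 * max 1 (ln (real k / \<sigma>)) ^ 5) alg"
      using c(1) unfolding competitive_on_smooth_def l_def by blast
  qed
qed

end

text \<open>For the degenerate cases, in which every way of serving the requests is free.\<close>

lemma constant_alg_exists:
  assumes k: "1 \<le> k"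
    and zero: "\<And>\<sigma> I r c. 0 < \<sigma> \<Longrightarrow> smooth_instance m M B \<sigma> I \<Longrightarrow> r \<in> space (history_space m M UNIV)
      \<Longrightarrow> c \<in> UNIV \<rightarrow> {..<k} \<Longrightarrow> taxi_cost m N x0 (num_requests I r) r c = 0"
    and \<sigma>0: "0 < \<sigma>\<^sub>0"
  shows "\<exists>A. is_online_alg m M k A \<and> (\<forall>\<sigma>. \<sigma>\<^sub>0 \<le> \<sigma> \<and> \<sigma> \<le> 1 \<longrightarrow> competitive_on_smooth m N M B k x0 \<sigma> (C \<sigma>) A)"
proof -
  define A where "A = \<lparr>seed = measure_pmf (return_pmf 0), dispatch = (\<lambda>u t h. 0)\<rparr>"
  have "is_online_alg m M k A"
    using k by (auto simp: is_online_alg_def A_def measure_pmf.prob_space_axioms)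
  moreover have "competitive_on_smooth m N M B k x0 \<sigma> (C \<sigma>) A" if "\<sigma>\<^sub>0 \<le> \<sigma>" for \<sigma>
    unfolding competitive_on_smooth_def
  proof (intro exI[of _ 0] conjI allI impI)
    fix I assume I: "smooth_instance m M B \<sigma> I"
    have IT: "Ionescu_Tulcea (next_dist I) (\<lambda>_. request_space m M)"
      using I by (simp add: smooth_instance_def is_instance_def)
    interpret IT: Ionescu_Tulcea "next_dist I" "\<lambda>_. request_space m M" by (rule IT)
    have sp: "space (request_law m M I) = space (history_space m M UNIV)" by (simp add: request_law_def)
    have "alg_cost m N x0 A (num_requests I r) r = 0" if "r \<in> space (request_law m M I)" for r
      using zero[of \<sigma> I r "\<lambda>_. 0"] that \<sigma>0 \<open>\<sigma>\<^sub>0 \<le> \<sigma>\<close> I k by (simp add: alg_cost_def A_def sp)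
    then have "expected_alg_cost m N M x0 A I = (\<integral>\<^sup>+r. 0 \<partial>request_law m M I)"
      unfolding expected_alg_cost_def by (intro nn_integral_cong) auto
    then show "expected_alg_cost m N M x0 A I \<le> ennreal (C \<sigma>) * expected_opt_cost m N M k x0 I + ennreal 0"
      by simp
  qed simp
  ultimately show ?thesis by blast
qed

text \<open>
  If the ball has volume \<open>0\<close> or \<open>\<infinity>\<close>, the bound in \<open>smooth_marginal\<close> evaluates to \<open>0\<close>, so a smooth
  instance must stop before the first request.
\<close>

lemma (in norm_space) degenerate_stops:
  assumes I: "smooth_instance m M B \<sigma> I" and M: "M \<subseteq> Rn m" and B: "B \<in> sets (vol m)"
    and deg: "emeasure (vol m) B = 0 \<or> emeasure (vol m) B = \<infinity>"
  shows "num_requests I r = 0"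
proof -
  let ?h = "\<lambda>_::nat. undefined :: request"
  have h: "?h \<in> space (history_space m M {..<0})" by (simp add: space_PiM)
  have "Ionescu_Tulcea (next_dist I) (\<lambda>_. request_space m M)"
    using I by (simp add: smooth_instance_def is_instance_def)
  then interpret IT: Ionescu_Tulcea "next_dist I" "\<lambda>_. request_space m M" .
  have "stopped I 0 ?h"
  proof (rule ccontr)
    assume "\<not> stopped I 0 ?h"
    then have "smooth_dist m M B \<sigma> (next_dist I 0 ?h)"
      using I h unfolding smooth_instance_def by blast
    then have sm: "smooth_marginal m M B \<sigma> (distr (next_dist I 0 ?h) (point_space m M) fst)"
      by (simp add: smooth_dist_def)
    have h': "?h \<in> space (history_space m M {0..<0})" by (simp add: space_PiM)
    interpret P: prob_space "next_dist I 0 ?h" by (rule IT.prob_space_P[OF h'])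
    have meas: "fst \<in> measurable (next_dist I 0 ?h) (point_space m M)"
      unfolding measurable_cong_sets[OF IT.sets_P[OF h'] refl] by (simp add: request_space_def)
    have sp: "space (point_space m M) \<in> sets (point_space m M)" by (rule sets.top)
    have "1 = emeasure (distr (next_dist I 0 ?h) (point_space m M) fst) (space (point_space m M))"
      using prob_space.emeasure_space_1[OF P.prob_space_distr[OF meas]] by simp
    also have "\<dots> \<le> ennreal (1 / \<sigma>) * (outer_measure_of (vol m) (space (point_space m M) \<inter> B) / emeasure (vol m) B)"
      using sm sp unfolding smooth_marginal_def by blast
    also have "\<dots> \<le> ennreal (1 / \<sigma>) * (emeasure (vol m) B / emeasure (vol m) B)"
    proof (intro mult_left_mono divide_right_mono_ennreal)
      have "outer_measure_of (vol m) (space (point_space m M) \<inter> B) \<le> outer_measure_of (vol m) B"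
        by (rule outer_measure_of_mono) simp
      then show "outer_measure_of (vol m) (space (point_space m M) \<inter> B) \<le> emeasure (vol m) B"
        using B by simp
    qed simp
    \<comment> \<open>In \<open>ennreal\<close> both \<open>0 / 0\<close> and
      \<open>\<infinity> / \<infinity>\<close> are 0.\<close>
    also have "\<dots> = 0" using deg by (auto simp: ennreal_divide_self)
    finally show False by simp
  qed
  \<comment> \<open>\<open>?h\<close> is the only history of length 0, so stopping does not depend
    on \<open>r\<close>.\<close>
  then have "stopped I 0 r" by (simp add: stopped_def restrict_def)
  then show ?thesis unfolding num_requests_def by (intro Least_equality) auto
qed

theorem theorem1p3:
  shows "\<exists>C::real. 0 < C \<and> (\<forall>(m::nat) (N :: point \<Rightarrow> real) (M :: point set) (B :: point set) (k::nat)
           (x0 :: nat \<Rightarrow> point) (\<sigma>\<^sub>0 :: real).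
     0 < m \<longrightarrow> is_norm m N \<longrightarrow> M \<subseteq> Rn m \<longrightarrow> bounded_diameter m N M \<longrightarrow>
     smallest_enclosing_ball m N M B \<longrightarrow> 1 \<le> k \<longrightarrow> (\<forall>j<k. x0 j \<in> M) \<longrightarrow> 0 < \<sigma>\<^sub>0 \<longrightarrow>
     (\<exists>A. is_online_alg m M k A \<and>
        (\<forall>\<sigma>. \<sigma>\<^sub>0 \<le> \<sigma> \<and> \<sigma> \<le> 1 \<longrightarrow>
           competitive_on_smooth m N M B k x0 \<sigma> (C * (max 1 (ln (real k / \<sigma>))) ^ 5) A)))"
proof (intro exI[of _ "216 * 25 ^ 5"] conjI allI impI)
  fix m k :: nat and N :: "point \<Rightarrow> real" and M B :: "point set" and x0 :: "nat \<Rightarrow> point" and \<sigma>\<^sub>0 :: real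
  assume m: "0 < m" and norm: "is_norm m N" and M: "M \<subseteq> Rn m"
    and ball: "smallest_enclosing_ball m N M B" and k: "1 \<le> k" and x0: "\<forall>j<k. x0 j \<in> M" and \<sigma>0: "0 < \<sigma>\<^sub>0"
  interpret norm_space m N by unfold_locales (rule norm)
  obtain z R where z: "z \<in> Rn m" and R: "0 \<le> R" and B: "B = closed_ball m N z R" and MB: "M \<subseteq> B"
    using ball by (auto simp: smallest_enclosing_ball_def)
  show "\<exists>A. is_online_alg m M k A \<and> (\<forall>\<sigma>. \<sigma>\<^sub>0 \<le> \<sigma> \<and> \<sigma> \<le> 1 \<longrightarrow>
      competitive_on_smooth m N M B k x0 \<sigma> (216 * 25 ^ 5 * (max 1 (ln (real k / \<sigma>))) ^ 5) A)"
  proof (cases "0 < R \<and> 0 < unit_vol \<and> unit_vol < \<infinity>")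
    case True
    interpret taxi_setting m N M z R k x0
      by unfold_locales (use True m z MB B k x0 in auto)
    show ?thesis unfolding B by (rule competitive_algorithm_exists[OF \<sigma>0])
  next
    case False
    show ?thesis
    proof (rule constant_alg_exists[OF k _ \<sigma>0])
      fix \<sigma> :: real and I :: instance_adv and r :: "nat \<Rightarrow> request" and c :: "nat \<Rightarrow> nat"
      assume "0 < \<sigma>" and I: "smooth_instance m M B \<sigma> I"
        and r: "r \<in> space (history_space m M UNIV)" and c: "c \<in> UNIV \<rightarrow> {..<k}"
      show "taxi_cost m N x0 (num_requests I r) r c = 0"
      \<comment> \<open>If \<open>R = 0\<close>, all distances in \<open>M\<close> vanish. Otherwise
        the volume of the ball is 0 or infinite and no request is ever made.\<close>
      proof (cases "R = 0")
        case True
        have dist: "ndist m N x y = 0" if "x \<in> M" "y \<in> M" for x y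
        proof -
          have "ndist m N z x \<le> 0" "ndist m N z y \<le> 0" using that MB B True by (auto simp: closed_ball_def)
          then show ?thesis
            using ndist_triangle[of x y z] ndist_sym[of x z] ndist_nonneg[of x y] by simp
        qed
        have "space (request_space m M) \<subseteq> M \<times> M"
          by (auto simp: request_space_def space_pair_measure point_space_def space_restrict_space)
        then have rM: "r i \<in> M \<times> M" for i using r by (auto simp: space_PiM PiE_iff)
        have "source_pos k x0 r s \<in> M" "fst (r i) \<in> M" for s i
          using rM[of "s - k"] rM[of i] x0 by (auto simp: source_pos_def mem_Times_iff)
        then show ?thesis
          using c by (subst taxi_cost_eq) (auto intro!: sum.neutral dist)
      next
        case False
        with R have "0 < R" by simp
        then have "unit_vol = 0 \<or> unit_vol = \<infinity>"
          using \<open>\<not> (0 < R \<and> 0 < unit_vol \<and> unit_vol < \<infinity>)\<close>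
          by (metis infinity_ennreal_def less_top not_gr_zero)
        moreover have "emeasure (vol m) B = ennreal (R ^ m) * unit_vol"
          unfolding B by (rule vol_ball[OF z \<open>0 < R\<close>])
        ultimately have "emeasure (vol m) B = 0 \<or> emeasure (vol m) B = \<infinity>"
          using \<open>0 < R\<close> by (auto simp: ennreal_mult_eq_top_iff)
        then have "num_requests I r = 0"
          using degenerate_stops[OF I M] B z by (auto simp: sets_closed_ball)
        then show ?thesis by (simp add: taxi_cost_def)
      qed
    qed
  qed
qed simp

end
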